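(* Let $N\ge1$ and $m\ge1$. Let $W_m(N)=w_{\mathfrak{gl}(N)}(\mathbbm{s}_m)=\frac1{m!}\sum_{\alpha\in\mathbb S_m}w_{\mathfrak{gl}(N)}(\alpha)$ be the average value of the $\mathfrak{gl}(N)$-weight system, and let $\Omega_m(N)=\omega_{m,N}(\mathbbm{h}_m)$ be the average value of the quantum $\mathfrak{gl}(N)$-weight system. Regard both as symmetric polynomials in $x_1,\dots,x_N$ via the classical and the quantum Harish-Chandra isomorphisms, respectively. Then, coefficientwise, $\lim_{q\to1}\Omega_m(N)$ exists and $$\lim_{q\to1}\Omega_m(N)=W_m(N).$$
   Context: **Classical side.** Let $E_{ij}$, $1\le i,j\le N$, be the standard generators of $U(\mathfrak{gl}(N))$ over $\mathbb C$, $[E_{ij},E_{kl}]=\delta_{jk}E_{il}-\delta_{il}E_{kj}$, $E=(E_{ij})$. For $\alpha\in\mathbb S_m$, $w_{\mathfrak{gl}(N)}(\alpha)=\sum_{i_1,\dots,i_m=1}^NE_{i_1i_{\alpha(1)}}\cdots E_{i_mi_{\alpha(m)}}$, extended linearly to $\mathbb C[\mathbb S_m]$; it is central in $U(\mathfrak{gl}(N))$. $\mathbbm{s}_m=\frac1{m!}\sum_{\alpha\in\mathbb S_m}\alpha$. The Casimir elements are $C_m=\mathrm{Tr}(E^m)=\sum E_{i_1i_2}E_{i_2i_3}\cdots E_{i_mi_1}$. The classical Harish-Chandra isomorphism from the center of $U(\mathfrak{gl}(N))$ to $\mathbb C[x_1,\dots,x_N]^{\mathbb S_N}$ is determined by $1-Nv-\sum_{m\ge1}C_mv^{m+1}=\prod_{i=1}^N\frac{1-(x_i+\frac{N+1}2)v}{1-(x_i+\frac{N-1}2)v}$.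 **Quantum side.** Work over $\mathbb C(q)$, with $[a]_q=\frac{1-q^{-2a}}{1-q^{-2}}$. $\mathbb H_m$ is the unital associative $\mathbb C(q)$-algebra with generators $g_1,\dots,g_{m-1}$ and relations $g_ig_j=g_jg_i$ ($|i-j|>1$), $g_ig_{i+1}g_i=g_{i+1}g_ig_{i+1}$, $g_i^2=1+(q-q^{-1})g_i$. The $q$-symmetrizer $\mathbbm{h}_m\in\mathbb H_m$ is the central idempotent given by $\mathbbm{h}_1=1$, $\mathbbm{h}_m=\frac1{[m]_q}\mathbbm{h}_{m-1}\big(q^{2-2m}+q^{-1}[m-1]_q\,g_{m-1}\big)\mathbbm{h}_{m-1}$ for $m\ge2$. Let $V=\mathbb C(q)^N$ and $R=q\sum_iE_i^i\otimes E_i^i+\sum_{i\ne j}E_i^j\otimes E_j^i+(q-q^{-1})\sum_{i<j}E_i^i\otimes E_j^j\in\mathrm{End}(V\otimes V)$ ($E_i^j$ matrix units); $R_{i,i+1}$ is $R$ acting in tensor factors $i,i+1$; $\rho:\mathbb H_m\to\mathrm{End}(V^{\otimes m})$, $g_i\mapsto R_{i,i+1}$. With $D=\mathrm{diag}(q^{1-2N},q^{3-2N},\dots,q^{-1})$, set $\langle X\rangle_{k,n}=\mathrm{Tr}_{k,\dots,n}(D_k\cdots D_nX)$ (trace over tensor factors $k,\dots,n$). $\mathbb M(N)$ is the unital associative $\mathbb C(q)$-algebra generated by the entries of an $N\times N$ matrix $M$ subject to $R_{1,2}M_1R_{1,2}M_1=M_1R_{1,2}M_1R_{1,2}$. Put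 $L=\frac{1-M}{q-q^{-1}}$, and $K_{\overline1}=K_1$, $K_{\overline i}=R_{i-1,i}K_{\overline{i-1}}R_{i-1,i}^{-1}$ for a matrix $K$ over $\mathbb M(N)$. Then $\omega_{m,N}(x)=\langle L_{\overline1}\cdots L_{\overline m}\,\rho(x)\rangle_{1,m}$ for $x\in\mathbb H_m$; its values are known to lie in the center of $\mathbb M(N)$ and to be polynomials in $p_k=\langle M_{\overline1}\cdots M_{\overline k}R_{k-1,k}\cdots R_{1,2}\rangle_{1,k}$. The quantum Harish-Chandra isomorphism from the center of $\mathbb M(N)$ to symmetric polynomials in $\xi_1,\dots,\xi_N$ over $\mathbb C(q)$ is determined by $1+(q-q^{-1})\sum_{m\ge1}p_mv^m=\prod_{i=1}^N\frac{1-q^{-2}\xi_iv}{1-\xi_iv}$, and one sets $x_i=\frac{q^{1-N}-\xi_i}{q^2-1}$, so central elements become symmetric polynomials in the $x_i$ with coefficients in $\mathbb C(q)$. The limit $q\to1$ is taken coefficient by coefficient in the $x_i$. *)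

theory Defs
  imports
    "HOL-Computational_Algebra.Computational_Algebra"
    "HOL-Combinatorics.Permutations"
    "HOL-Library.Poly_Mapping"
    "HOL-Library.FuncSet"
    "HOL-Algebra.QuotRing"
begin

section \<open>Polynomials and algebras given by generators and relations\<close>

(* Words over an alphabet form a monoid under concatenation.  With this instance the type
   'x list \<Rightarrow>\<^sub>0 'k, with its convolution product, is the free associative unital 'k-algebra on 'x. *)
instantiation list :: (type) monoid_add
begin
definition zero_list :: "'a list" where "zero_list = []"
definition plus_list :: "'a list \<Rightarrow> 'a list \<Rightarrow> 'a list" where "plus_list = (@)"
instance by standard (simp_all add: zero_list_def plus_list_def)
end

type_synonym ('x, 'k) falg = "'x list \<Rightarrow>\<^sub>0 'k"
type_synonym 'k mpol = "(nat \<Rightarrow>\<^sub>0 nat) \<Rightarrow>\<^sub>0 'k"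

(* The constant c, both in the polynomial ring and in the free algebra. *)
definition scal :: "'k::zero \<Rightarrow> 'm::zero \<Rightarrow>\<^sub>0 'k" where
  "scal c = Poly_Mapping.single 0 c"

definition gen :: "'x \<Rightarrow> ('x, 'k::zero_neq_one) falg" where
  "gen x = Poly_Mapping.single [x] 1"

definition Var :: "nat \<Rightarrow> 'k::zero_neq_one mpol" where
  "Var i = Poly_Mapping.single (Poly_Mapping.single i 1) 1"

definition psubst :: "(nat \<Rightarrow> 'k mpol) \<Rightarrow> 'k mpol \<Rightarrow> 'k::comm_ring_1 mpol" where
  "psubst \<sigma> p = (\<Sum>\<mu>\<in>Poly_Mapping.keys p. scal (Poly_Mapping.lookup p \<mu>) *
      (\<Prod>i\<in>Poly_Mapping.keys \<mu>. \<sigma> i ^ Poly_Mapping.lookup \<mu> i))"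

definition ring_on :: "'a set \<Rightarrow> 'a::ring_1 ring" where
  "ring_on A = \<lparr>carrier = A, mult = (*), one = 1, zero = 0, add = (+)\<rparr>"

definition sym_ring :: "nat \<Rightarrow> 'k::comm_ring_1 mpol ring" where
  "sym_ring N = ring_on {p. (\<forall>\<mu>\<in>Poly_Mapping.keys p. Poly_Mapping.keys \<mu> \<subseteq> {1..N}) \<and>
      (\<forall>\<pi>. \<pi> permutes {1..N} \<longrightarrow> psubst (\<lambda>i. Var (\<pi> i)) p = p)}"

definition free_alg :: "'x set \<Rightarrow> ('x, 'k::comm_ring_1) falg ring" where
  "free_alg X = ring_on {p. Poly_Mapping.keys p \<subseteq> lists X}"

lemma ring_free_alg: "ring (free_alg X :: ('x, 'k::comm_ring_1) falg ring)"
proof -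
  let ?F = "free_alg X :: ('x, 'k) falg ring"
  have mult: "Poly_Mapping.keys (p * q) \<subseteq> lists X"
    if "Poly_Mapping.keys p \<subseteq> lists X" "Poly_Mapping.keys q \<subseteq> lists X" for p q :: "('x, 'k) falg"
    using keys_mult[of p q] that by (fastforce simp: plus_list_def)
  have add: "Poly_Mapping.keys (p + q) \<subseteq> lists X"
    if "Poly_Mapping.keys p \<subseteq> lists X" "Poly_Mapping.keys q \<subseteq> lists X" for p q :: "('x, 'k) falg"
    using Poly_Mapping.keys_add[of p q] that by blast
  have one: "Poly_Mapping.keys (1 :: ('x, 'k) falg) \<subseteq> lists X"
    by (simp add: zero_list_def)
  have "abelian_group ?F"
  proof (rule abelian_groupI)
    fix x assume "x \<in> carrier ?F"
    then show "\<exists>y\<in>carrier ?F. y \<oplus>\<^bsub>?F\<^esub> x = \<zero>\<^bsub>?F\<^esub>"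
      by (intro bexI[of _ "- x"]) (auto simp: free_alg_def ring_on_def)
  qed (auto simp: free_alg_def ring_on_def add.assoc add.commute dest: add[THEN subsetD])
  moreover have "monoid ?F"
    by (rule monoidI) (use mult one in \<open>auto simp: free_alg_def ring_on_def mult.assoc\<close>)
  ultimately show ?thesis
    by (rule ringI) (auto simp: free_alg_def ring_on_def algebra_simps)
qed

(* The algebra with generators X and relations r = 0 for r \<in> S, and the class in it of an element
   of the free algebra. *)
definition pres_alg :: "'x set \<Rightarrow> ('x, 'k::comm_ring_1) falg set \<Rightarrow> ('x, 'k) falg set ring" where
  "pres_alg X S = free_alg X Quot (genideal (free_alg X) S)"

definition pres_class :: "'x set \<Rightarrow> ('x, 'k::comm_ring_1) falg set \<Rightarrow> ('x, 'k) falg \<Rightarrow> ('x, 'k) falg set" where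
  "pres_class X S p = genideal (free_alg X) S +>\<^bsub>free_alg X\<^esub> p"

definition center_ring :: "'a ring \<Rightarrow> 'a ring" where
  "center_ring R = R\<lparr>carrier := {z \<in> carrier R. \<forall>y\<in>carrier R. z \<otimes>\<^bsub>R\<^esub> y = y \<otimes>\<^bsub>R\<^esub> z}\<rparr>"

(* Multi-indices (i_1,...,i_m) with 1 \<le> i_k \<le> N, as extensional functions. *)
definition midx :: "nat \<Rightarrow> nat \<Rightarrow> (nat \<Rightarrow> nat) set" where
  "midx N m = {1..m} \<rightarrow>\<^sub>E {1..N}"

section \<open>The classical side\<close>

definition gl_gens :: "nat \<Rightarrow> (nat \<times> nat) set" where
  "gl_gens N = {1..N} \<times> {1..N}"

definition gl_rels :: "nat \<Rightarrow> (nat \<times> nat, complex) falg set" where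
  "gl_rels N = {gen (i, j) * gen (k, l) - gen (k, l) * gen (i, j)
       - ((if j = k then gen (i, l) else 0) - (if i = l then gen (k, j) else 0)) | i j k l.
       i \<in> {1..N} \<and> j \<in> {1..N} \<and> k \<in> {1..N} \<and> l \<in> {1..N}}"

definition U_gl :: "nat \<Rightarrow> (nat \<times> nat, complex) falg set ring" where
  "U_gl N = pres_alg (gl_gens N) (gl_rels N)"

abbreviation U_class :: "nat \<Rightarrow> (nat \<times> nat, complex) falg \<Rightarrow> (nat \<times> nat, complex) falg set" where
  "U_class N \<equiv> pres_class (gl_gens N) (gl_rels N)"

(* Elements of U(gl(N)) are described by representatives in the free algebra. *)
definition w_rep :: "nat \<Rightarrow> nat \<Rightarrow> (nat \<Rightarrow> nat) \<Rightarrow> (nat \<times> nat, complex) falg" where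
  "w_rep N m \<alpha> = (\<Sum>i\<in>midx N m. prod_list (map (\<lambda>k. gen (i k, i (\<alpha> k))) [1..<Suc m]))"

definition W :: "nat \<Rightarrow> nat \<Rightarrow> (nat \<times> nat, complex) falg set" where
  "W N m = U_class N (scal (1 / fact m) * (\<Sum>\<alpha> | \<alpha> permutes {1..m}. w_rep N m \<alpha>))"

definition casimir :: "nat \<Rightarrow> nat \<Rightarrow> (nat \<times> nat, complex) falg set" where
  "casimir N m = U_class N
     (\<Sum>i\<in>midx N m. prod_list (map (\<lambda>k. gen (i k, i (if k = m then 1 else Suc k))) [1..<Suc m]))"

(* Isomorphism of complex algebras from the center of U(gl(N)) to the symmetric polynomials; the
   quotient of power series (in the variable fps_X) is expressed by multiplying with the denominator,
   which is a unit. *)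
definition classical_HC :: "nat \<Rightarrow> ((nat \<times> nat, complex) falg set \<Rightarrow> complex mpol) \<Rightarrow> bool" where
  "classical_HC N \<phi> \<longleftrightarrow>
     \<phi> \<in> ring_iso (center_ring (U_gl N)) (sym_ring N) \<and>
     (\<forall>c. \<phi> (U_class N (scal c)) = scal c) \<and>
     (1 - of_nat N * fps_X - Abs_fps (\<lambda>n. if n \<ge> 2 then \<phi> (casimir N (n - 1)) else 0)) *
       (\<Prod>i\<in>{1..N}. 1 - fps_const (Var i + scal ((of_nat N - 1) / 2)) * fps_X) =
     (\<Prod>i\<in>{1..N}. 1 - fps_const (Var i + scal ((of_nat N + 1) / 2)) * fps_X)"

section \<open>Tensor powers\<close>

(* Endomorphisms of the m-th tensor power of V with coefficients in an algebra 'a: matrices with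
   rows and columns indexed by multi-indices, zero outside the index range. *)
type_synonym 'a tmat = "(nat \<Rightarrow> nat) \<Rightarrow> (nat \<Rightarrow> nat) \<Rightarrow> 'a"

definition tend :: "nat \<Rightarrow> nat \<Rightarrow> 'a::ring_1 tmat ring" where
  "tend N m = \<lparr>carrier = {A. \<forall>I J. \<not> (I \<in> midx N m \<and> J \<in> midx N m) \<longrightarrow> A I J = 0},
     mult = (\<lambda>A B I J. \<Sum>K\<in>midx N m. A I K * B K J),
     one = (\<lambda>I J. if I \<in> midx N m \<and> I = J then 1 else 0),
     zero = (\<lambda>I J. 0),
     add = (\<lambda>A B I J. A I J + B I J)\<rparr>"

definition tprod :: "nat \<Rightarrow> nat \<Rightarrow> 'a::ring_1 tmat list \<Rightarrow> 'a tmat" where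
  "tprod N m As = foldr (\<lambda>A B. A \<otimes>\<^bsub>tend N m\<^esub> B) As \<one>\<^bsub>tend N m\<^esub>"

definition ttrace :: "nat \<Rightarrow> nat \<Rightarrow> 'a::ring_1 tmat \<Rightarrow> 'a" where
  "ttrace N m A = (\<Sum>I\<in>midx N m. A I I)"

(* K_k: the matrix K acting in the k-th tensor factor. *)
definition at1 :: "nat \<Rightarrow> nat \<Rightarrow> nat \<Rightarrow> (nat \<Rightarrow> nat \<Rightarrow> 'a::ring_1) \<Rightarrow> 'a tmat" where
  "at1 N m k K = (\<lambda>I J. if I \<in> midx N m \<and> J \<in> midx N m \<and> (\<forall>l\<in>{1..m} - {k}. I l = J l)
      then K (I k) (J k) else 0)"

(* B_{k,k+1}: the matrix B, with rows and columns indexed by pairs, acting in factors k, k+1. *)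
definition at2 :: "nat \<Rightarrow> nat \<Rightarrow> nat \<Rightarrow> (nat \<times> nat \<Rightarrow> nat \<times> nat \<Rightarrow> 'a::ring_1) \<Rightarrow> 'a tmat" where
  "at2 N m k B = (\<lambda>I J. if I \<in> midx N m \<and> J \<in> midx N m \<and> (\<forall>l\<in>{1..m} - {k, Suc k}. I l = J l)
      then B (I k, I (Suc k)) (J k, J (Suc k)) else 0)"

definition lift :: "'k::zero tmat \<Rightarrow> ('x, 'k) falg tmat" where
  "lift A = (\<lambda>I J. scal (A I J))"

lemma ring_tend: "ring (tend N m :: 'a::ring_1 tmat ring)"
proof -
  let ?T = "tend N m :: 'a tmat ring"
  have fin: "finite (midx N m)"
    by (simp add: midx_def finite_PiE)
  have "abelian_group ?T"
  proof (rule abelian_groupI)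
    fix x assume "x \<in> carrier ?T"
    then show "\<exists>y\<in>carrier ?T. y \<oplus>\<^bsub>?T\<^esub> x = \<zero>\<^bsub>?T\<^esub>"
      by (intro bexI[of _ "\<lambda>I J. - x I J"]) (auto simp: tend_def)
  qed (auto simp: tend_def ac_simps)
  moreover have "monoid ?T"
  proof (rule monoidI)
    fix x y z assume "x \<in> carrier ?T" "y \<in> carrier ?T" "z \<in> carrier ?T"
    have "(\<Sum>K\<in>midx N m. (\<Sum>L\<in>midx N m. x I L * y L K) * z K J) =
      (\<Sum>K\<in>midx N m. x I K * (\<Sum>L\<in>midx N m. y K L * z L J))" for I J
    proof -
      have "(\<Sum>K\<in>midx N m. (\<Sum>L\<in>midx N m. x I L * y L K) * z K J) =
        (\<Sum>K\<in>midx N m. \<Sum>L\<in>midx N m. x I L * (y L K * z K J))"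
        by (simp add: sum_distrib_right mult.assoc)
      also have "\<dots> = (\<Sum>L\<in>midx N m. \<Sum>K\<in>midx N m. x I L * (y L K * z K J))"
        by (rule sum.swap)
      finally show ?thesis by (simp add: sum_distrib_left)
    qed
    then show "x \<otimes>\<^bsub>?T\<^esub> y \<otimes>\<^bsub>?T\<^esub> z = x \<otimes>\<^bsub>?T\<^esub> (y \<otimes>\<^bsub>?T\<^esub> z)"
      by (simp add: tend_def)
  next
    fix x assume x: "x \<in> carrier ?T"
    have "(\<Sum>K\<in>midx N m. (if I \<in> midx N m \<and> I = K then 1 else 0) * x K J) = x I J" for I J
    proof -
      have "(\<Sum>K\<in>midx N m. (if I \<in> midx N m \<and> I = K then 1 else 0) * x K J) =
        (\<Sum>K\<in>midx N m. if I = K then x K J else 0)"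
        by (rule sum.cong) auto
      then show ?thesis using x fin by (auto simp: tend_def)
    qed
    then show "\<one>\<^bsub>?T\<^esub> \<otimes>\<^bsub>?T\<^esub> x = x" by (simp add: tend_def)
    have "(\<Sum>K\<in>midx N m. x I K * (if K \<in> midx N m \<and> K = J then 1 else 0)) = x I J" for I J
    proof -
      have "(\<Sum>K\<in>midx N m. x I K * (if K \<in> midx N m \<and> K = J then 1 else 0)) =
        (\<Sum>K\<in>midx N m. if K = J then x I K else 0)"
        by (rule sum.cong) auto
      then show ?thesis using x fin by (auto simp: tend_def)
    qed
    then show "x \<otimes>\<^bsub>?T\<^esub> \<one>\<^bsub>?T\<^esub> = x" by (simp add: tend_def)
  qed (auto simp: tend_def intro!: sum.neutral)
  ultimately show ?thesis
    by (rule ringI) (auto simp: tend_def algebra_simps sum.distrib)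
qed

section \<open>The quantum side\<close>

type_synonym Cq = "complex poly fract"

definition q :: Cq where
  "q = Fract [:0, 1:] 1"

definition qnum :: "int \<Rightarrow> Cq" where
  "qnum a = (1 - q powi (-2 * a)) / (1 - q powi (-2))"

(* The rational function f has limit l at q = 1. *)
definition tendsto_q1 :: "Cq \<Rightarrow> complex \<Rightarrow> bool" where
  "tendsto_q1 f l \<longleftrightarrow> (\<exists>a b. b \<noteq> 0 \<and> f = Fract a b \<and>
     ((\<lambda>z. poly a z / poly b z) \<longlongrightarrow> l) (at 1))"

definition hecke_rels :: "nat \<Rightarrow> (nat, Cq) falg set" where
  "hecke_rels m =
     {gen i * gen j - gen j * gen i | i j.
        i \<in> {1..<m} \<and> j \<in> {1..<m} \<and> \<bar>int i - int j\<bar> > 1} \<union>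
     {gen i * gen (Suc i) * gen i - gen (Suc i) * gen i * gen (Suc i) | i.
        i \<in> {1..<m} \<and> Suc i \<in> {1..<m}} \<union>
     {gen i * gen i - (1 + scal (q - inverse q) * gen i) | i. i \<in> {1..<m}}"

(* A representative of the q-symmetrizer in the free algebra on g_1, g_2, ...; only g_1,...,g_{m-1}
   occur. *)
fun hsym_rep :: "nat \<Rightarrow> (nat, Cq) falg" where
  "hsym_rep (Suc 0) = 1"
| "hsym_rep (Suc (Suc n)) = (let m = Suc (Suc n) in
     scal (1 / qnum (int m)) * hsym_rep (Suc n) *
     (scal (q powi (2 - 2 * int m)) + scal (inverse q * qnum (int m - 1)) * gen (m - 1)) *
     hsym_rep (Suc n))"

definition hsym :: "nat \<Rightarrow> (nat, Cq) falg set" where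
  "hsym m = pres_class {1..<m} (hecke_rels m) (hsym_rep m)"

(* The entry in row a, column b of the matrix unit E_i^j.  The matrix R below does not change when
   the roles of rows and columns are exchanged. *)
definition munit :: "nat \<Rightarrow> nat \<Rightarrow> nat \<Rightarrow> nat \<Rightarrow> 'a::ring_1" where
  "munit i j a b = (if a = i \<and> b = j then 1 else 0)"

definition Rmat :: "nat \<Rightarrow> nat \<times> nat \<Rightarrow> nat \<times> nat \<Rightarrow> Cq" where
  "Rmat N = (\<lambda>(a, b) (c, d).
     q * (\<Sum>i\<in>{1..N}. munit i i a c * munit i i b d) +
     (\<Sum>i\<in>{1..N}. \<Sum>j\<in>{1..N} - {i}. munit i j a c * munit j i b d) +
     (q - inverse q) * (\<Sum>i\<in>{1..N}. \<Sum>j\<in>{i<..N}. munit i i a c * munit j j b d))"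

definition Rop :: "nat \<Rightarrow> nat \<Rightarrow> nat \<Rightarrow> Cq tmat" where
  "Rop N m i = at2 N m i (Rmat N)"

definition rho_rep :: "nat \<Rightarrow> nat \<Rightarrow> (nat, Cq) falg \<Rightarrow> Cq tmat" where
  "rho_rep N m p = (\<lambda>I J. \<Sum>w\<in>Poly_Mapping.keys p.
      Poly_Mapping.lookup p w * tprod N m (map (Rop N m) w) I J)"

(* The induced map on the Hecke algebra: the common value on all representatives (the operators
   R_{i,i+1} satisfy the Hecke relations). *)
definition rho :: "nat \<Rightarrow> nat \<Rightarrow> (nat, Cq) falg set \<Rightarrow> Cq tmat" where
  "rho N m X = the_elem (rho_rep N m ` X)"

definition Dmat :: "nat \<Rightarrow> nat \<Rightarrow> nat \<Rightarrow> Cq" where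
  "Dmat N a b = (if a = b then q powi (2 * int a - 1 - 2 * int N) else 0)"

definition qtrace :: "nat \<Rightarrow> nat \<Rightarrow> ('x, Cq) falg tmat \<Rightarrow> ('x, Cq) falg" where
  "qtrace N m X = ttrace N m
     (tprod N m (map (\<lambda>k. lift (at1 N m k (Dmat N))) [1..<Suc m]) \<otimes>\<^bsub>tend N m\<^esub> X)"

(* Matrices over the reflection equation algebra are given by entries in the free algebra on the
   symbols (i, j), which stand for the entries of M. *)
definition Mmat :: "nat \<Rightarrow> nat \<Rightarrow> (nat \<times> nat, Cq) falg" where
  "Mmat i j = gen (i, j)"

definition Lmat :: "nat \<Rightarrow> nat \<Rightarrow> (nat \<times> nat, Cq) falg" where
  "Lmat i j = scal (1 / (q - inverse q)) * ((if i = j then 1 else 0) - Mmat i j)"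

definition re_rels :: "nat \<Rightarrow> (nat \<times> nat, Cq) falg set" where
  "re_rels N = (let R = lift (Rop N 2 1); M1 = at1 N 2 1 Mmat in
     {tprod N 2 [R, M1, R, M1] I J - tprod N 2 [M1, R, M1, R] I J | I J.
        I \<in> midx N 2 \<and> J \<in> midx N 2})"

definition RE_alg :: "nat \<Rightarrow> (nat \<times> nat, Cq) falg set ring" where
  "RE_alg N = pres_alg (gl_gens N) (re_rels N)"

abbreviation RE_class :: "nat \<Rightarrow> (nat \<times> nat, Cq) falg \<Rightarrow> (nat \<times> nat, Cq) falg set" where
  "RE_class N \<equiv> pres_class (gl_gens N) (re_rels N)"

fun kbar :: "nat \<Rightarrow> nat \<Rightarrow> (nat \<Rightarrow> nat \<Rightarrow> ('x, Cq) falg) \<Rightarrow> nat \<Rightarrow> ('x, Cq) falg tmat" where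
  "kbar N m K (Suc 0) = at1 N m 1 K"
| "kbar N m K (Suc (Suc n)) = tprod N m
     [lift (Rop N m (Suc n)), kbar N m K (Suc n), lift (inv\<^bsub>tend N m\<^esub> (Rop N m (Suc n)))]"

definition omega :: "nat \<Rightarrow> nat \<Rightarrow> (nat, Cq) falg set \<Rightarrow> (nat \<times> nat, Cq) falg set" where
  "omega N m X = RE_class N (qtrace N m
     (tprod N m (map (kbar N m Lmat) [1..<Suc m]) \<otimes>\<^bsub>tend N m\<^esub> lift (rho N m X)))"

definition Omega :: "nat \<Rightarrow> nat \<Rightarrow> (nat \<times> nat, Cq) falg set" where
  "Omega N m = omega N m (hsym m)"

definition psum :: "nat \<Rightarrow> nat \<Rightarrow> (nat \<times> nat, Cq) falg set" where
  "psum N k = RE_class N (qtrace N k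
     (tprod N k (map (kbar N k Mmat) [1..<Suc k] @ map (\<lambda>i. lift (Rop N k i)) (rev [1..<k]))))"

(* Isomorphism of Cq-algebras from the center of M(N) to symmetric polynomials in the variables
   \<xi>_i = Var i. *)
definition quantum_HC :: "nat \<Rightarrow> ((nat \<times> nat, Cq) falg set \<Rightarrow> Cq mpol) \<Rightarrow> bool" where
  "quantum_HC N \<psi> \<longleftrightarrow>
     \<psi> \<in> ring_iso (center_ring (RE_alg N)) (sym_ring N) \<and>
     (\<forall>c. \<psi> (RE_class N (scal c)) = scal c) \<and>
     (1 + fps_const (scal (q - inverse q)) *
          Abs_fps (\<lambda>n. if n \<ge> 1 then \<psi> (psum N n) else 0)) *
       (\<Prod>i\<in>{1..N}. 1 - fps_const (Var i) * fps_X) =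
     (\<Prod>i\<in>{1..N}. 1 - fps_const (scal (q powi (-2)) * Var i) * fps_X)"

(* Rewriting a polynomial in the \<xi>_i as a polynomial in the x_i = (q^(1-N) - \<xi>_i) / (q^2 - 1). *)
definition x_coords :: "nat \<Rightarrow> Cq mpol \<Rightarrow> Cq mpol" where
  "x_coords N = psubst (\<lambda>i. scal (q powi (1 - int N)) - scal (q ^ 2 - 1) * Var i)"

end

(* Both averages are traces tr(h X_0 X_1 ... X_{m-1}) in a tower of algebras with a Markov trace, where
   h is the symmetrizer of the Hecke algebra (at t = 1 on the classical side), X_0 is the matrix of
   generators acting in the first tensor factor (L, respectively E) and X_{i+1} = g_i X_i g_i^{-1}.
   The defining relations of M(N) and of U(gl(N)) imply, with a_j = (q^{2j} - 1) / (q - q^{-1}),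
   respectively a_j = j, that
     (g_0 + t^{-1}) (X_0 + a_j) (X_1 + a_{j+1}) (g_0 - t) = 0,
   so that h (X_0 + a_0) ... (X_{m-1} + a_{m-1}) absorbs the g_i from the right as well.  Hence the
   traces S_m of these products satisfy Newton identities whose power sums are the traces of
   (X_0 + a_n) ... (X_0 + a_{m-1}).  Moreover S_m is a unitriangular combination of the averages
   Omega_k with coefficients that only depend on t, N and a.  So Omega_m is a universal polynomial in
   the moments tau(X_0^k), its coefficients converge as q tends to 1, and it remains to compare
   moments.  The moments of L = (1 - M) / (q - q^{-1}) come from the p_k by a substitution in the
   generating function, which turns the quantum Harish-Chandra formula into one that tends to the
   classical formula for the Casimir elements tr(E^k). *)
theory Submission
  imports Defs
begin

section \<open>Hecke symmetrizers and towers with a trace\<close>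

text \<open>No limit is taken inside an algebra: M(N) and U(gl(N)) have different ground fields, and
  convergence is defined only for coefficients of polynomials. Both averages are therefore expressed
  by one recursion, whose solutions are compared after evaluation in polynomials. The shifts have
  this origin: between g_0 + 1/t and g_0 - t, the reflection equation kills the quadratic term of a
  product of two shifted factors, and the linear terms cancel if the second constant is t^2 times
  the first. With M - q^(2j) as a multiple of L + a_j, this gives the a_j. The pole of L at q = 1 is
  the other obstacle, since the moments of L are alternating sums of the p_k divided by powers of q
  - 1/q. After the substitution, the generating function has a polynomial numerator that vanishes at
  the zero w = q^2 - 1 of its denominator; dividing out this linear factor leaves coefficients that
  converge. The trace calculus needs one ring for all m, whereas the algebras are set-based
  quotients that depend on N. So the algebras are realized faithfully by left multiplications on an
  infinite tensor power.\<close>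

lemma degree_prod_linear_le: "degree (\<Prod>b\<leftarrow>bs. [:b, 1:]) \<le> length bs"
  for bs :: "'k::comm_ring_1 list"
proof (induction bs)
  case (Cons b bs)
  have "degree ([:b, 1:] * (\<Prod>b\<leftarrow>bs. [:b, 1:])) \<le> 1 + length bs"
    using degree_mult_le[of "[:b, 1:]" "\<Prod>b\<leftarrow>bs. [:b, 1:]"] Cons by (simp del: mult_pCons_left)
  then show ?case by (simp only: list.map prod_list.Cons list.size)
qed simp

text \<open>The scalar action is a parameter, not a type class operation: in the instances it is
  multiplication by the central elements \<open>\<eta> (scal b)\<close>, and \<open>\<eta>\<close>
  depends on the relations of the algebra.\<close>

locale algebra_ring =
  fixes sc :: "'k::field \<Rightarrow> 'r::ring_1 \<Rightarrow> 'r" (infixr "\<cdot>" 75)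
  assumes sc_add_left: "(a + b) \<cdot> x = a \<cdot> x + b \<cdot> x"
    and sc_add_right: "a \<cdot> (x + y) = a \<cdot> x + a \<cdot> y"
    and sc_sc [simp]: "a \<cdot> b \<cdot> x = (a * b) \<cdot> x"
    and sc_one [simp]: "1 \<cdot> x = x"
    and sc_mult_left [simp]: "(a \<cdot> x) * y = a \<cdot> (x * y)"
    and sc_mult_right [simp]: "x * (a \<cdot> y) = a \<cdot> (x * y)"
begin

lemma sc_zero_left [simp]: "0 \<cdot> x = 0"
  using sc_add_left[of 0 0 x] by simp

lemma sc_zero_right [simp]: "a \<cdot> 0 = 0"
  using sc_add_right[of a 0 0] by simp

lemma sc_minus_left [simp]: "(- a) \<cdot> x = - (a \<cdot> x)"
  using sc_add_left[of a "- a" x] by (simp add: eq_neg_iff_add_eq_0 add.commute)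

lemma sc_minus_right [simp]: "a \<cdot> (- x) = - (a \<cdot> x)"
  using sc_add_right[of a x "- x"] by (simp add: eq_neg_iff_add_eq_0 add.commute)

lemma sc_diff_left: "(a - b) \<cdot> x = a \<cdot> x - b \<cdot> x"
  using sc_add_left[of a "- b" x] by simp

lemma sc_diff_right: "a \<cdot> (x - y) = a \<cdot> x - a \<cdot> y"
  using sc_add_right[of a x "- y"] by simp

lemma sc_sum_right: "a \<cdot> (\<Sum>i\<in>A. f i) = (\<Sum>i\<in>A. a \<cdot> f i)"
  by (induction A rule: infinite_finite_induct) (simp_all add: sc_add_right)

lemma sc_sum_left: "(\<Sum>i\<in>A. f i) \<cdot> x = (\<Sum>i\<in>A. f i \<cdot> x)"
  by (induction A rule: infinite_finite_induct) (simp_all add: sc_add_left)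

lemmas sc_distrib = sc_add_left sc_add_right sc_diff_left sc_diff_right

lemma sc_cancel: "a \<noteq> 0 \<Longrightarrow> a \<cdot> x = a \<cdot> y \<longleftrightarrow> x = y"
  by (metis sc_sc sc_one left_inverse)

end

text \<open>The quantum integer [n] as a geometric sum: the quotient form degenerates at t = 1,
  whereas the sum then gives n.\<close>

definition qn :: "'k::field \<Rightarrow> nat \<Rightarrow> 'k" where
  "qn t n = (\<Sum>i<n. inverse t ^ (2 * i))"

lemma qn_0 [simp]: "qn t 0 = 0"
  and qn_Suc: "qn t (Suc n) = inverse t ^ (2 * n) + qn t n"
  by (simp_all add: qn_def)

section \<open>The Hecke algebra and its symmetrizers\<close>

locale hecke = algebra_ring sc for sc :: "'k::field \<Rightarrow> 'r::ring_1 \<Rightarrow> 'r" (infixr "\<cdot>" 75) +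
  fixes t :: 'k and g :: "nat \<Rightarrow> 'r"
  assumes q_nz [simp]: "t \<noteq> 0"
    and qn_nz [simp]: "qn t (Suc n) \<noteq> 0"
    and g_sq: "g i * g i = 1 + (t - inverse t) \<cdot> g i"
    and braid: "g i * (g (Suc i) * g i) = g (Suc i) * (g i * g (Suc i))"
    and g_far: "Suc i < j \<Longrightarrow> g i * g j = g j * g i"
begin

lemma t_cancel [simp]: "t * (inverse t * x) = x" "inverse t * (t * x) = x"
  by (simp_all flip: mult.assoc)

lemma qn_cancel [simp]: "qn t (Suc n) * (inverse (qn t (Suc n)) * x) = x"
  by (simp flip: mult.assoc)

definition ginv :: "nat \<Rightarrow> 'r" where
  "ginv i = g i - (t - inverse t) \<cdot> 1"

lemma ginv_alt: "ginv i = g i + (inverse t - t) \<cdot> 1"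
  by (simp add: ginv_def sc_diff_left)

lemma g_ginv [simp]: "g i * ginv i = 1" and ginv_g [simp]: "ginv i * g i = 1"
  by (simp_all add: ginv_def algebra_simps g_sq)

lemma g_ginv_left [simp]: "g i * (ginv i * x) = x" and ginv_g_left [simp]: "ginv i * (g i * x) = x"
  by (simp_all flip: mult.assoc)

text \<open>Generators are counted from 0, so the generator that is new in \<open>hs (Suc n)\<close>
  is \<open>g (n - 1)\<close>. For \<open>n = 0\<close> the truncated difference names
  \<open>g 0\<close>, but its coefficient contains \<open>qn t 0 = 0\<close>.\<close>

fun hs :: "nat \<Rightarrow> 'r" where
  "hs 0 = 1"
| "hs (Suc n) = inverse (qn t (Suc n)) \<cdot>
     (hs n * ((inverse t ^ (2 * n)) \<cdot> 1 + (inverse t * qn t n) \<cdot> g (n - 1)) * hs n)"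

declare hs.simps(2) [simp del]

lemma hs_Suc: "qn t (Suc n) \<cdot> hs (Suc n) =
    inverse t ^ (2 * n) \<cdot> (hs n * hs n) + (inverse t * qn t n) \<cdot> (hs n * (g (n - 1) * hs n))"
  by (simp add: hs.simps(2) sc_cancel flip: sc_sc) (simp add: distrib_left distrib_right sc_add_right mult.assoc)

text \<open>\<open>hs n\<close> is built from \<open>g 0\<close>, ..., \<open>g (n - 2)\<close>, all
  of which are far from \<open>g k\<close>.\<close>

lemma g_hs_far: "n \<le> k \<Longrightarrow> g k * hs n = hs n * g k"
proof (induction n)
  case (Suc n)
  have *: "g k * (hs n * x) = hs n * (g k * x)" for x
    using Suc by (simp flip: mult.assoc)
  have "(inverse t * qn t n) \<cdot> (y * (g k * (g (n - 1) * x))) = (inverse t * qn t n) \<cdot> (y * (g (n - 1) * (g k * x)))" for x y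
  proof (cases n)
    case (Suc m)
    then have "g (n - 1) * g k = g k * g (n - 1)" using g_far[of "n - 1" k] \<open>Suc n \<le> k\<close> by simp
    then have "g (n - 1) * (g k * x) = g k * (g (n - 1) * x)" by (simp flip: mult.assoc)
    then show ?thesis by simp
  qed simp
  then have **: "g k * (qn t (Suc n) \<cdot> hs (Suc n)) = (qn t (Suc n) \<cdot> hs (Suc n)) * g k"
    using Suc by (simp only: hs_Suc) (simp add: distrib_left distrib_right mult.assoc * Suc.IH Suc_leD[OF Suc.prems])
  then show ?case by (simp add: sc_cancel)
qed simp

definition absorbs :: "nat \<Rightarrow> 'r \<Rightarrow> bool" where
  "absorbs n x \<longleftrightarrow> (\<forall>i. Suc i < n \<longrightarrow> g i * x = t \<cdot> x)"

text \<open>On a simultaneous eigenvector with eigenvalue t, the recursion for \<open>hs\<close>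
  yields t^(-2k) + t^(-1) [k] t = [k + 1], which cancels the denominator.\<close>

lemma absorbs_hs_mult:
  assumes "absorbs n x" "k \<le> n"
  shows "hs k * x = x"
  using assms(2)
proof (induction k)
  case (Suc k)
  have "(inverse t * qn t k) \<cdot> (hs k * (g (k - 1) * x)) = qn t k \<cdot> x"
  proof (cases k)
    case (Suc l)
    then have "g l * x = t \<cdot> x" using assms(1) Suc.prems by (simp add: absorbs_def)
    then show ?thesis using Suc Suc.IH Suc.prems by (simp add: field_simps)
  qed simp
  then have "qn t (Suc k) \<cdot> (hs (Suc k) * x) = qn t (Suc k) \<cdot> x"
    using Suc by (simp add: hs_Suc flip: sc_mult_left)
      (simp add: algebra_simps sc_add_left[symmetric] qn_Suc)
  then show ?case by (simp add: sc_cancel)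
qed simp

definition absorbs_r :: "nat \<Rightarrow> 'r \<Rightarrow> bool" where
  "absorbs_r n x \<longleftrightarrow> (\<forall>i. Suc i < n \<longrightarrow> x * g i = t \<cdot> x)"

lemma absorbs_r_hs_mult:
  assumes "absorbs_r n x" "k \<le> n"
  shows "x * hs k = x"
  using assms(2)
proof (induction k)
  case (Suc k)
  have 0: "x * (hs k * y) = x * y" for y
    using Suc by (simp flip: mult.assoc)
  have "(inverse t * qn t k) \<cdot> (x * (g (k - 1) * hs k)) = qn t k \<cdot> x"
  proof (cases k)
    case (Suc l)
    then have "x * g l = t \<cdot> x" using assms(1) Suc.prems by (simp add: absorbs_r_def)
    then have "x * (g l * y) = t \<cdot> (x * y)" for y by (simp flip: mult.assoc)
    then show ?thesis using Suc Suc.IH Suc.prems by (simp add: field_simps)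
  qed simp
  then have "qn t (Suc k) \<cdot> (x * hs (Suc k)) = qn t (Suc k) \<cdot> x"
    using Suc by (simp add: hs_Suc 0 flip: sc_mult_right)
      (simp add: algebra_simps 0 sc_add_left[symmetric] qn_Suc)
  then show ?case by (simp add: sc_cancel)
qed simp

text \<open>Strong induction. The old generators are absorbed by the outer factors \<open>?h\<close>
  of the recursion. For the new generator \<open>?G\<close>, one of these factors is expanded once
  more; by the braid relation the part containing \<open>?g\<close> is already a t-eigenvector, and
  what remains cancels against the first summand of \<open>top\<close>.\<close>

lemma hs_absorbs: "absorbs n (hs n) \<and> absorbs_r n (hs n)"
proof (induction n rule: less_induct)
  case (less n)
  have idem: "hs k * hs k = hs k" if "k < n" for k
    using absorbs_hs_mult[of k "hs k" k] less that by simp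
  consider "n = 0" | "n = 1" | k where "n = Suc (Suc k)"
    by (metis One_nat_def not0_implies_Suc)
  then show ?case
  proof cases
    case 3
    let ?h = "hs (Suc k)" and ?f = "hs k"
    let ?\<alpha> = "inverse t ^ (2 * k)" and ?\<beta> = "inverse t * qn t k"
    let ?G = "g k" and ?g = "g (k - 1)" and ?n = "qn t (Suc k)"
    have IH: "absorbs (Suc k) ?h" "absorbs_r (Suc k) ?h"
      using less 3 by auto
    have hh: "?h * ?h = ?h" and fh: "?f * ?h = ?h" and hf: "?h * ?f = ?h" and ff: "?f * ?f = ?f"
      using absorbs_hs_mult[OF IH(1), of k] absorbs_r_hs_mult[OF IH(2), of k] idem 3 by auto
    have hh': "?h * (?h * x) = ?h * x" and fh': "?f * (?h * x) = ?h * x"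
      and hf': "?h * (?f * x) = ?h * x" and ff': "?f * (?f * x) = ?f * x" for x
      using hh fh hf ff by (simp_all flip: mult.assoc)
    have fG: "?G * ?f = ?f * ?G" by (rule g_hs_far) simp
    then have fG': "?G * (?f * x) = ?f * (?G * x)" for x by (simp flip: mult.assoc)
    \<comment> \<open>The factor \<open>?\<beta>\<close> vanishes for \<open>k = 0\<close>, where
      \<open>?g\<close> is not a generator below \<open>?G\<close>; carrying it along settles this
      case.\<close>
    have gh: "?\<beta> \<cdot> (?g * ?h) = ?\<beta> \<cdot> t \<cdot> ?h" and hg: "?\<beta> \<cdot> (?h * ?g) = ?\<beta> \<cdot> t \<cdot> ?h"
      using IH by (cases k; simp add: absorbs_def absorbs_r_def)+
    have br: "?\<beta> \<cdot> (?G * (?g * ?G)) = ?\<beta> \<cdot> (?g * (?G * ?g))"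
      using braid[of "k - 1"] by (cases k) auto
    have GG: "?G * (?G * x) = x + (t - inverse t) \<cdot> (?G * x)" for x
      using arg_cong[OF g_sq[of k], of "\<lambda>y. y * x"] by (simp add: algebra_simps)
    have top: "qn t (Suc (Suc k)) \<cdot> hs (Suc (Suc k)) =
        (inverse t ^ 2 * ?\<alpha>) \<cdot> ?h + (inverse t * ?n) \<cdot> (?h * (?G * ?h))"
      by (simp add: hs_Suc[of "Suc k"] hh power2_eq_square mult.assoc)
    have A: "absorbs (Suc (Suc k)) (hs (Suc (Suc k)))"
      unfolding absorbs_def
    proof (intro allI impI)
      fix i assume "Suc i < Suc (Suc k)"
      then consider "i < k" | "i = k" by linarith
      then have "g i * (qn t (Suc (Suc k)) \<cdot> hs (Suc (Suc k))) = t \<cdot> (qn t (Suc (Suc k)) \<cdot> hs (Suc (Suc k)))"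
      proof cases
        case 1
        then have *: "g i * ?h = t \<cdot> ?h" using IH by (auto simp: absorbs_def)
        then have "g i * (?h * x) = t \<cdot> (?h * x)" for x by (simp flip: mult.assoc)
        with * show ?thesis by (simp only: top) (simp add: algebra_simps sc_distrib)
      next
        case 2
        \<comment> \<open>Expand the left \<open>?h\<close>; its factor \<open>?f\<close> commutes
          with \<open>?G\<close> and is swallowed by the right \<open>?h\<close>.\<close>
        have "?n \<cdot> (?h * (?G * ?h)) = (?n \<cdot> ?h) * (?G * ?h)" by simp
        also have "\<dots> = ?\<alpha> \<cdot> (?f * (?G * ?h)) + ?\<beta> \<cdot> (?f * (?g * (?f * (?G * ?h))))"
          by (simp add: hs_Suc ff algebra_simps ff')
        also have "?f * (?G * ?h) = ?G * ?h"
          by (simp add: fG'[symmetric] fh)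
        finally have hgh: "?n \<cdot> (?h * (?G * ?h)) = ?\<alpha> \<cdot> (?G * ?h) + ?\<beta> \<cdot> (?f * (?g * (?G * ?h)))" .
        \<comment> \<open>The braid relation turns \<open>?G\<close>, \<open>?g\<close>,
          \<open>?G\<close> into \<open>?g\<close>, \<open>?G\<close>, \<open>?g\<close>, and the
          last \<open>?g\<close> is absorbed by \<open>?h\<close> with eigenvalue t.\<close>
        have "?G * (?\<beta> \<cdot> (?f * (?g * (?G * ?h)))) = ?f * (?\<beta> \<cdot> (?G * (?g * ?G))) * ?h"
          by (simp add: mult.assoc fG')
        also have "\<dots> = ?f * (?g * (?G * (?\<beta> \<cdot> (?g * ?h))))"
          by (simp only: br) (simp add: mult.assoc)
        also have "\<dots> = t \<cdot> (?\<beta> \<cdot> (?f * (?g * (?G * ?h))))"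
          by (simp only: gh) (simp add: mult_ac)
        finally have 1: "?G * (?\<beta> \<cdot> (?f * (?g * (?G * ?h)))) = t \<cdot> (?\<beta> \<cdot> (?f * (?g * (?G * ?h))))" .
        have "?G * (?n \<cdot> (?h * (?G * ?h))) - t \<cdot> (?n \<cdot> (?h * (?G * ?h))) =
            ?\<alpha> \<cdot> ?h - (?\<alpha> * inverse t) \<cdot> (?G * ?h)"
          unfolding hgh distrib_left 1 by (simp add: sc_distrib GG algebra_simps)
        then have 2: "inverse t \<cdot> (?G * (?n \<cdot> (?h * (?G * ?h)))) - inverse t \<cdot> (t \<cdot> (?n \<cdot> (?h * (?G * ?h)))) =
            inverse t \<cdot> (?\<alpha> \<cdot> ?h - (?\<alpha> * inverse t) \<cdot> (?G * ?h))"
          by (simp only: flip: sc_diff_right)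
        have "?G * (qn t (Suc (Suc k)) \<cdot> hs (Suc (Suc k))) - t \<cdot> (qn t (Suc (Suc k)) \<cdot> hs (Suc (Suc k))) =
           (inverse t ^ 2 * ?\<alpha>) \<cdot> (?G * ?h) - (inverse t * ?\<alpha>) \<cdot> ?h +
           (inverse t \<cdot> (?G * (?n \<cdot> (?h * (?G * ?h)))) - inverse t \<cdot> (t \<cdot> (?n \<cdot> (?h * (?G * ?h)))))"
          by (simp only: top) (simp add: algebra_simps sc_distrib power2_eq_square)
        also have "\<dots> = 0"
          unfolding 2 by (simp add: algebra_simps sc_distrib power2_eq_square)
        finally show ?thesis using 2 \<open>i = k\<close> by simp
      qed
      then have "qn t (Suc (Suc k)) \<cdot> (g i * hs (Suc (Suc k))) = qn t (Suc (Suc k)) \<cdot> (t \<cdot> hs (Suc (Suc k)))"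
        by (simp add: mult.commute)
      then show "g i * hs (Suc (Suc k)) = t \<cdot> hs (Suc (Suc k))" by (simp only: sc_cancel[OF qn_nz])
    qed
    have B: "absorbs_r (Suc (Suc k)) (hs (Suc (Suc k)))"
      unfolding absorbs_r_def
    proof (intro allI impI)
      fix i assume "Suc i < Suc (Suc k)"
      then consider "i < k" | "i = k" by linarith
      then have "(qn t (Suc (Suc k)) \<cdot> hs (Suc (Suc k))) * g i = t \<cdot> (qn t (Suc (Suc k)) \<cdot> hs (Suc (Suc k)))"
      proof cases
        case 1
        then have *: "?h * g i = t \<cdot> ?h" using IH by (auto simp: absorbs_r_def)
        with * show ?thesis by (simp only: top) (simp add: algebra_simps sc_distrib)
      next
        case 2
        \<comment> \<open>The mirror image: now the right \<open>?h\<close> is expanded.\<close>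
        have "?n \<cdot> (?h * (?G * ?h)) = (?h * ?G) * (?n \<cdot> ?h)" by (simp add: mult.assoc)
        also have "\<dots> = ?\<alpha> \<cdot> (?h * (?G * ?f)) + ?\<beta> \<cdot> (?h * (?G * (?f * (?g * ?f))))"
          by (simp only: hs_Suc) (simp add: ff algebra_simps ff')
        also have "?h * (?G * ?f) = ?h * ?G"
          by (simp add: fG hf')
        also have "?h * (?G * (?f * (?g * ?f))) = ?h * (?G * (?g * ?f))"
          by (simp add: fG' hf')
        finally have hgh: "?n \<cdot> (?h * (?G * ?h)) = ?\<alpha> \<cdot> (?h * ?G) + ?\<beta> \<cdot> (?h * (?G * (?g * ?f)))" .
        have "(?\<beta> \<cdot> (?h * (?G * (?g * ?f)))) * ?G = ?h * (?\<beta> \<cdot> (?G * (?g * ?G))) * ?f"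
          by (simp add: mult.assoc fG)
        also have "\<dots> = (?\<beta> \<cdot> (?h * ?g)) * (?G * (?g * ?f))"
          by (simp only: br) (simp add: mult.assoc)
        also have "\<dots> = t \<cdot> (?\<beta> \<cdot> (?h * (?G * (?g * ?f))))"
          by (simp only: hg) (simp add: mult_ac)
        finally have 1: "(?\<beta> \<cdot> (?h * (?G * (?g * ?f)))) * ?G = t \<cdot> (?\<beta> \<cdot> (?h * (?G * (?g * ?f))))" .
        have "(?n \<cdot> (?h * (?G * ?h))) * ?G - t \<cdot> (?n \<cdot> (?h * (?G * ?h))) =
            ?\<alpha> \<cdot> ?h - (?\<alpha> * inverse t) \<cdot> (?h * ?G)"
          unfolding hgh distrib_right 1 by (simp add: sc_distrib g_sq algebra_simps)
        then have 2: "inverse t \<cdot> ((?n \<cdot> (?h * (?G * ?h))) * ?G) - inverse t \<cdot> (t \<cdot> (?n \<cdot> (?h * (?G * ?h)))) =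
            inverse t \<cdot> (?\<alpha> \<cdot> ?h - (?\<alpha> * inverse t) \<cdot> (?h * ?G))"
          by (simp only: flip: sc_diff_right)
        have "(qn t (Suc (Suc k)) \<cdot> hs (Suc (Suc k))) * ?G - t \<cdot> (qn t (Suc (Suc k)) \<cdot> hs (Suc (Suc k))) =
           (inverse t ^ 2 * ?\<alpha>) \<cdot> (?h * ?G) - (inverse t * ?\<alpha>) \<cdot> ?h +
           (inverse t \<cdot> ((?n \<cdot> (?h * (?G * ?h))) * ?G) - inverse t \<cdot> (t \<cdot> (?n \<cdot> (?h * (?G * ?h)))))"
          by (simp only: top) (simp add: algebra_simps sc_distrib power2_eq_square)
        also have "\<dots> = 0"
          unfolding 2 by (simp add: algebra_simps sc_distrib power2_eq_square)
        finally show ?thesis using 2 \<open>i = k\<close> by simp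
      qed
      then have "qn t (Suc (Suc k)) \<cdot> (hs (Suc (Suc k)) * g i) = qn t (Suc (Suc k)) \<cdot> (t \<cdot> hs (Suc (Suc k)))"
        by (simp add: mult.commute)
      then show "hs (Suc (Suc k)) * g i = t \<cdot> hs (Suc (Suc k))" by (simp only: sc_cancel[OF qn_nz])
    qed
    show ?thesis using A B 3 by simp
  qed (simp_all add: absorbs_def absorbs_r_def)
qed

lemma hs_absorb_left: "Suc i < n \<Longrightarrow> g i * hs n = t \<cdot> hs n"
  and hs_absorb_right: "Suc i < n \<Longrightarrow> hs n * g i = t \<cdot> hs n"
  using hs_absorbs[of n] by (auto simp: absorbs_def absorbs_r_def)

lemma hs_idem [simp]: "hs n * hs n = hs n"
  using absorbs_hs_mult[of n "hs n" n] hs_absorbs by simp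

end

text \<open>\<open>lev n\<close> stands for what acts on the strands below n, and
  \<open>\<tau> n\<close> closes strand n. In the instances \<open>lev 0\<close> contains the
  noncommuting entries of the matrix behind \<open>X 0\<close>, so traces are neither scalars nor
  cyclic in general. As (g + 1/t) (g - t) = 0, \<open>X_absorb\<close> expresses that symmetrizing
  on the left forces absorption on the right.\<close>

locale markov_tower = hecke sc t g
  for sc :: "'k::field \<Rightarrow> 'r::ring_1 \<Rightarrow> 'r" (infixr "\<cdot>" 75) and t g +
  fixes X :: "nat \<Rightarrow> 'r" and lev :: "nat \<Rightarrow> 'r set" and \<tau> :: "nat \<Rightarrow> 'r \<Rightarrow> 'r"
    and a :: "nat \<Rightarrow> 'k" and \<delta> :: 'k
  assumes X_Suc: "X (Suc i) = g i * X i * ginv i"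
    and X0_far: "g (Suc i) * X 0 = X 0 * g (Suc i)"
    and X_absorb: "(g 0 + inverse t \<cdot> 1) * ((X 0 + a j \<cdot> 1) * (X 1 + a (Suc j) \<cdot> 1)) * (g 0 - t \<cdot> 1) = 0"
    and lev_one: "1 \<in> lev n"
    and lev_add: "x \<in> lev n \<Longrightarrow> y \<in> lev n \<Longrightarrow> x + y \<in> lev n"
    and lev_mult: "x \<in> lev n \<Longrightarrow> y \<in> lev n \<Longrightarrow> x * y \<in> lev n"
    and lev_sc: "x \<in> lev n \<Longrightarrow> b \<cdot> x \<in> lev n"
    and lev_Suc: "x \<in> lev n \<Longrightarrow> x \<in> lev (Suc n)"
    and g_lev: "g i \<in> lev (Suc (Suc i))"
    and X0_lev: "X 0 \<in> lev 1"
    and \<tau>_lev: "x \<in> lev (Suc n) \<Longrightarrow> \<tau> n x \<in> lev n"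
    and \<tau>_add: "\<tau> n (x + y) = \<tau> n x + \<tau> n y"
    and \<tau>_sc: "\<tau> n (b \<cdot> x) = b \<cdot> \<tau> n x"
    and \<tau>_left: "y \<in> lev n \<Longrightarrow> \<tau> n (y * x) = y * \<tau> n x"
    and \<tau>_right: "y \<in> lev n \<Longrightarrow> \<tau> n (x * y) = \<tau> n x * y"
    and \<tau>_one: "\<tau> n 1 = \<delta> \<cdot> 1"
    and \<tau>_g: "\<tau> (Suc n) (g n) = 1"
    and \<tau>_conj: "x \<in> lev (Suc n) \<Longrightarrow> \<tau> (Suc n) (g n * x * ginv n) = \<tau> n x"
    and \<tau>_cyclic: "\<tau> n (\<tau> (Suc n) (g n * x)) = \<tau> n (\<tau> (Suc n) (x * g n))"
begin

lemma \<tau>_zero [simp]: "\<tau> n 0 = 0"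
  using \<tau>_sc[of n 0 0] by simp

lemma \<tau>_sum: "\<tau> n (\<Sum>i\<in>A. f i) = (\<Sum>i\<in>A. \<tau> n (f i))"
  by (induction A rule: infinite_finite_induct) (simp_all add: \<tau>_add)

lemma lev_mono: "m \<le> n \<Longrightarrow> x \<in> lev m \<Longrightarrow> x \<in> lev n"
  by (induction n rule: dec_induct) (auto intro: lev_Suc)

lemma ginv_lev: "ginv i \<in> lev (Suc (Suc i))"
  unfolding ginv_alt by (intro lev_add g_lev lev_sc lev_one)

lemma X_lev: "X i \<in> lev (Suc i)"
  by (induction i) (simp_all add: X_Suc X0_lev[simplified] lev_mult g_lev ginv_lev lev_Suc)

lemma hs_lev: "hs n \<in> lev n"
proof (induction n)
  case (Suc n)
  show ?case
  proof (cases n)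
    case (Suc m)
    then have "g (n - 1) \<in> lev (Suc n)" using lev_mono[OF _ g_lev[of m], of "Suc n"] by simp
    then show ?thesis
      unfolding hs.simps(2) by (intro lev_sc lev_mult lev_add lev_one lev_Suc[OF Suc.IH])
  qed (simp add: hs.simps(2) lev_sc lev_one)
qed (simp add: lev_one)

section \<open>Iterated partial traces and cyclicity\<close>

fun tr :: "nat \<Rightarrow> 'r \<Rightarrow> 'r" where
  "tr 0 x = x"
| "tr (Suc n) x = tr n (\<tau> n x)"

lemma tr_add: "tr n (x + y) = tr n x + tr n y"
  by (induction n arbitrary: x y) (simp_all add: \<tau>_add)

lemma tr_sc: "tr n (b \<cdot> x) = b \<cdot> tr n x"
  by (induction n arbitrary: x) (simp_all add: \<tau>_sc)

lemma tr_right: "y \<in> lev 0 \<Longrightarrow> tr n (x * y) = tr n x * y"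
  by (induction n arbitrary: x) (simp_all add: \<tau>_right lev_mono[of 0])

lemma tr_g_cyclic: "Suc i < n \<Longrightarrow> x \<in> lev n \<Longrightarrow> tr n (g i * x) = tr n (x * g i)"
proof (induction n arbitrary: x)
  case (Suc n)
  show ?case
  proof (cases "Suc i < n")
    case True
    then have "g i \<in> lev n" using lev_mono g_lev by (metis Suc_leI)
    then show ?thesis using Suc True by (simp add: \<tau>_left \<tau>_right \<tau>_lev)
  next
    case False
    then have "n = Suc i" using Suc by simp
    then show ?thesis by (simp add: \<tau>_cyclic)
  qed
qed simp

text \<open>The trace takes values in a possibly noncommutative ground level, so cyclicity has to be
  established element by element; it holds for the generators and hence for the
  symmetrizers.\<close>

definition cyc :: "nat \<Rightarrow> 'r set" where
  "cyc n = {y \<in> lev n. \<forall>x\<in>lev n. tr n (y * x) = tr n (x * y)}"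

lemma cyc_mult: "x \<in> cyc n \<Longrightarrow> y \<in> cyc n \<Longrightarrow> x * y \<in> cyc n"
  by (simp add: cyc_def lev_mult) (metis lev_mult mult.assoc)

lemma cyc_add: "x \<in> cyc n \<Longrightarrow> y \<in> cyc n \<Longrightarrow> x + y \<in> cyc n"
  by (simp add: cyc_def lev_add distrib_left distrib_right tr_add)

lemma cyc_sc: "x \<in> cyc n \<Longrightarrow> b \<cdot> x \<in> cyc n"
  by (simp add: cyc_def lev_sc tr_sc)

lemma cyc_one: "1 \<in> cyc n"
  by (simp add: cyc_def lev_one)

lemma cyc_g: "Suc i < n \<Longrightarrow> g i \<in> cyc n"
  using lev_mono[OF _ g_lev[of i], of n] by (auto simp: cyc_def tr_g_cyclic)

lemma cyc_ginv: "Suc i < n \<Longrightarrow> ginv i \<in> cyc n"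
  unfolding ginv_alt by (intro cyc_add cyc_g cyc_sc cyc_one)

lemma cyc_hs: "k \<le> n \<Longrightarrow> hs k \<in> cyc n"
proof (induction k)
  case (Suc k)
  have "(inverse t * qn t k) \<cdot> g (k - 1) \<in> cyc n"
    using Suc cyc_g[of "k - 1" n] cyc_sc[OF cyc_one, of 0 n] by (cases k) (auto intro: cyc_sc)
  with Suc show ?case
    unfolding hs.simps(2) by (intro cyc_sc[of "_ * _"] cyc_mult cyc_add cyc_sc[OF cyc_one]) auto
qed (simp add: cyc_one)

lemma cycD: "y \<in> cyc n \<Longrightarrow> x \<in> lev n \<Longrightarrow> tr n (y * x) = tr n (x * y)"
  by (simp add: cyc_def)

section \<open>Commutation of the generators with the conjugates of \<open>X 0\<close>\<close>

lemma ginv_commute: "g i * x = x * g i \<Longrightarrow> ginv i * x = x * ginv i"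
  by (simp add: ginv_def algebra_simps)

lemma g_X_low: "k < i \<Longrightarrow> g i * X k = X k * g i"
proof (induction k)
  case 0
  then show ?case using X0_far[of "i - 1"] by simp
next
  case (Suc k)
  have 1: "g i * g k = g k * g i" using g_far[of k i] Suc.prems by simp
  then have "ginv k * g i = g i * ginv k" by (intro ginv_commute) simp
  have "g i * X (Suc k) = (g i * g k) * X k * ginv k" by (simp add: X_Suc mult.assoc)
  also have "\<dots> = g k * (g i * X k) * ginv k" by (simp add: 1 mult.assoc)
  finally have "g i * X (Suc k) = g k * (X k * g i) * ginv k" using Suc by simp
  with \<open>ginv k * g i = g i * ginv k\<close> show ?case by (simp add: X_Suc mult.assoc)
qed

text \<open>The first case \<open>k = Suc (Suc i)\<close> is the braid relation: passing g_{i+1} g_i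
  turns \<open>g i\<close> into \<open>g (Suc i)\<close>, which commutes with \<open>X i\<close>,
  and passing the inverses turns it back. Higher \<open>k\<close> only add conjugations by
  generators far from \<open>g i\<close>.\<close>

lemma g_X_high: "Suc i < k \<Longrightarrow> g i * X k = X k * g i"
proof (induction k)
  case (Suc k)
  show ?case
  proof (cases "k = Suc i")
    case True
    let ?a = "g i" and ?b = "g (Suc i)" and ?a' = "ginv i" and ?b' = "ginv (Suc i)"
    have br: "?a * (?b * (?a * x)) = ?b * (?a * (?b * x))" for x
      using arg_cong[OF braid[of i], of "\<lambda>y. y * x"] by (simp add: mult.assoc)
    have "?b * (?a * (?b * (?a' * ?b'))) = ?a" by (simp flip: br)
    then have "?a' * (?b' * (?b * (?a * (?b * (?a' * ?b'))))) = ?a' * (?b' * ?a)" by simp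
    then have w: "?b * (?a' * ?b') = ?a' * (?b' * ?a)" by simp
    have "?a * X (Suc k) = ?a * (?b * (?a * X i * ?a') * ?b')"
      using True by (simp add: X_Suc)
    also have "\<dots> = ?b * (?a * (?b * X i * (?a' * ?b')))"
      by (simp add: mult.assoc br)
    also have "\<dots> = ?b * (?a * X i * (?b * (?a' * ?b')))"
      by (simp add: g_X_low[of i "Suc i"] mult.assoc)
    also have "\<dots> = X (Suc k) * ?a"
      by (simp add: w True X_Suc mult.assoc)
    finally show ?thesis .
  next
    case False
    then have 1: "g i * g k = g k * g i" using g_far[of i k] Suc.prems by simp
    then have 2: "ginv k * g i = g i * ginv k" by (intro ginv_commute) simp
    have "g i * X (Suc k) = (g i * g k) * X k * ginv k" by (simp add: X_Suc mult.assoc)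
    also have "\<dots> = g k * (g i * X k) * ginv k" by (simp add: 1 mult.assoc)
    finally have "g i * X (Suc k) = g k * (X k * g i) * ginv k" using Suc False by simp
    with 2 show ?thesis by (simp add: X_Suc mult.assoc)
  qed
qed simp

definition Y :: "nat \<Rightarrow> 'r" where
  "Y i = X i + a i \<cdot> 1"

text \<open>The invertible element \<open>?u\<close> intertwines \<open>g i\<close>,
  \<open>X i\<close>, \<open>X (Suc i)\<close> with the same triple one strand higher, so the
  relation for the first two strands climbs up.\<close>

lemma X_absorb_gen:
  "(g i + inverse t \<cdot> 1) * ((X i + a j \<cdot> 1) * (X (Suc i) + a (Suc j) \<cdot> 1)) * (g i - t \<cdot> 1) = 0"
proof (induction i)
  case 0
  then show ?case using X_absorb by simp
next
  case (Suc i)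
  let ?u = "g i * g (Suc i)" and ?v = "ginv (Suc i) * ginv i"
  have g: "?u * g i = g (Suc i) * ?u" using braid by (simp add: mult.assoc)
  have "?u * X i = g i * X i * g (Suc i)" using g_X_low[of i "Suc i"] by (simp add: mult.assoc)
  also have "\<dots> = X (Suc i) * ?u" by (simp add: X_Suc mult.assoc)
  finally have x: "?u * X i = X (Suc i) * ?u" .
  have "?u * X (Suc i) = g i * X (Suc (Suc i)) * g (Suc i)" by (simp add: X_Suc[of "Suc i"] mult.assoc)
  also have "\<dots> = X (Suc (Suc i)) * ?u" using g_X_high[of i "Suc (Suc i)"] by (simp add: mult.assoc)
  finally have x': "?u * X (Suc i) = X (Suc (Suc i)) * ?u" .
  have prod: "?u * (y * z) = (y' * z') * ?u" if "?u * y = y' * ?u" "?u * z = z' * ?u" for y z y' z'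
    by (metis that mult.assoc)
  have lin: "?u * (y + b \<cdot> 1) = (y' + b \<cdot> 1) * ?u" "?u * (y - b \<cdot> 1) = (y' - b \<cdot> 1) * ?u"
    if "?u * y = y' * ?u" for y y' b using that by (simp_all add: distrib_left distrib_right right_diff_distrib left_diff_distrib)
  have "?u * ((g i + inverse t \<cdot> 1) * ((X i + a j \<cdot> 1) * (X (Suc i) + a (Suc j) \<cdot> 1)) * (g i - t \<cdot> 1)) =
    ((g (Suc i) + inverse t \<cdot> 1) * ((X (Suc i) + a j \<cdot> 1) * (X (Suc (Suc i)) + a (Suc j) \<cdot> 1)) * (g (Suc i) - t \<cdot> 1)) * ?u"
    (is "_ = ?r * ?u")
    by (intro prod lin g x x')
  then have "?r * ?u = 0" unfolding Suc.IH by simp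
  then have "?r * ?u * ?v = 0" by simp
  then show ?case by (simp add: mult.assoc)
qed

section \<open>Ordered products with shifts and their absorption\<close>

definition asc :: "(nat \<Rightarrow> 'r) \<Rightarrow> nat \<Rightarrow> nat \<Rightarrow> 'r" where
  "asc f m k = prod_list (map f [m..<m + k])"

lemma asc_0 [simp]: "asc f m 0 = 1"
  and asc_Suc: "asc f m (Suc k) = asc f m k * f (m + k)"
  by (simp_all add: asc_def)

lemma asc_Suc_left: "asc f m (Suc k) = f m * asc f (Suc m) k"
  by (induction k) (simp_all add: asc_Suc mult.assoc)

lemma asc_add: "asc f m (k + l) = asc f m k * asc f (m + k) l"
  by (induction l) (simp_all add: asc_Suc mult.assoc add.assoc)

lemma asc_commute: "(\<And>i. m \<le> i \<Longrightarrow> i < m + k \<Longrightarrow> x * f i = f i * x) \<Longrightarrow> x * asc f m k = asc f m k * x"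
proof (induction k)
  case (Suc k)
  then have "x * asc f m k = asc f m k * x" "x * f (m + k) = f (m + k) * x" by auto
  then show ?case by (metis asc_Suc mult.assoc)
qed simp

lemma asc_lev: "(\<And>i. m \<le> i \<Longrightarrow> i < m + k \<Longrightarrow> f i \<in> lev n) \<Longrightarrow> asc f m k \<in> lev n"
  by (induction k) (simp_all add: asc_Suc lev_one lev_mult)

lemma Y_lev: "Y i \<in> lev (Suc i)"
  by (simp add: Y_def lev_add X_lev lev_sc lev_one)

lemma g_Y_low: "k < i \<Longrightarrow> g i * Y k = Y k * g i"
  and g_Y_high: "Suc i < k \<Longrightarrow> g i * Y k = Y k * g i"
  by (simp_all add: Y_def algebra_simps g_X_low g_X_high)

lemma asc_Y_lev: "m + k \<le> n \<Longrightarrow> asc Y m k \<in> lev n"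
  by (rule asc_lev) (auto intro!: lev_mono[OF _ Y_lev])

lemma t_add_inverse_nz: "t + inverse t \<noteq> 0"
proof -
  have "t + inverse t = t * qn t (Suc (Suc 0))"
    by (simp add: qn_Suc power2_eq_square algebra_simps)
  then show ?thesis using qn_nz[of "Suc 0"] by simp
qed

text \<open>Up to the nonzero scalar t + 1/t, \<open>hs n\<close> equals
  \<open>hs n * (g i + 1/t)\<close>. This factor and, from the right, g_i - t move next to
  \<open>Y i * Y (Suc i)\<close>, where \<open>X_absorb_gen\<close> annihilates the product. The
  Newton identities need the case in which the product is longer than the symmetrizer.\<close>

lemma absorbs_r_hs_asc:
  assumes "n \<le> m"
  shows "absorbs_r n (hs n * asc Y 0 m)"
  unfolding absorbs_r_def
proof (intro allI impI)
  fix i assume i: "Suc i < n"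
  define r where "r = m - Suc (Suc i)"
  have m: "m = i + (Suc (Suc 0) + r)" using i assms by (simp add: r_def)
  let ?Z = "asc Y 0 i" and ?W = "asc Y (Suc (Suc i)) r" and ?p = "g i + inverse t \<cdot> 1" and ?n = "g i - t \<cdot> 1"
  have Y: "asc Y 0 m = ?Z * ((Y i * Y (Suc i)) * ?W)"
    unfolding m asc_add by (simp add: asc_Suc)
  have Z: "g i * ?Z = ?Z * g i" by (rule asc_commute) (simp add: g_Y_low)
  have W: "g i * ?W = ?W * g i" by (rule asc_commute) (simp add: g_Y_high)
  have "(t + inverse t) \<cdot> (hs n * asc Y 0 m * ?n) = hs n * ?p * asc Y 0 m * ?n"
    using hs_absorb_right[OF i] by (simp add: sc_add_left distrib_right distrib_left)
  also have "\<dots> = hs n * (?p * ?Z) * (Y i * Y (Suc i)) * (?W * ?n)"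
    unfolding Y by (simp add: mult.assoc)
  also have "?p * ?Z = ?Z * ?p" by (simp add: Z algebra_simps)
  also have "?W * ?n = ?n * ?W" by (simp add: W algebra_simps)
  also have "hs n * (?Z * ?p) * (Y i * Y (Suc i)) * (?n * ?W) = hs n * ?Z * (?p * (Y i * Y (Suc i)) * ?n) * ?W"
    by (simp add: mult.assoc)
  also have "\<dots> = 0"
    unfolding Y_def X_absorb_gen by simp
  finally have "hs n * asc Y 0 m * ?n = 0"
    using sc_cancel[OF t_add_inverse_nz, of _ 0] by simp
  then show "hs n * asc Y 0 m * g i = t \<cdot> (hs n * asc Y 0 m)"
    by (simp add: algebra_simps)
qed

lemma hs_asc_hs: "n \<le> m \<Longrightarrow> hs n * asc Y 0 m * hs n = hs n * asc Y 0 m"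
  by (rule absorbs_r_hs_mult[OF absorbs_r_hs_asc]) auto

section \<open>Cycles of strands and the Newton identities\<close>

fun desc :: "nat \<Rightarrow> nat \<Rightarrow> 'r" where
  "desc n 0 = 1"
| "desc n (Suc j) = g (n + j) * desc n j"

lemma desc_Suc_right: "desc n (Suc j) = desc (Suc n) j * g n"
  by (induction j) (simp_all add: mult.assoc)

lemma desc_lev: "n + j < m \<Longrightarrow> desc n j \<in> lev m"
  by (induction j) (auto simp: lev_one intro!: lev_mult lev_mono[OF _ g_lev])

lemma desc_cyc: "n + j < m \<Longrightarrow> desc n j \<in> cyc m"
  by (induction j) (auto simp: cyc_one intro!: cyc_mult cyc_g)

lemma desc_hs: "desc n j * hs n = hs n * desc n j"
proof (induction j)
  case (Suc j)
  have "g (n + j) * hs n = hs n * g (n + j)" by (rule g_hs_far) simp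
  moreover have "desc n (Suc j) * hs n = g (n + j) * (desc n j * hs n)" by (simp add: mult.assoc)
  ultimately show ?case unfolding Suc by (simp add: mult.assoc[symmetric])
qed simp

definition S :: "nat \<Rightarrow> 'r" where
  "S m = tr m (hs m * asc Y 0 m)"

text \<open>All factors sit on one strand, so a polynomial in \<open>X 0\<close> is traced: this is
  the analogue of a power sum, as \<open>S\<close> is that of a complete symmetric function.\<close>

definition \<theta> :: "nat \<Rightarrow> nat \<Rightarrow> 'r" where
  "\<theta> n k = \<tau> 0 (asc (\<lambda>i. X 0 + a i \<cdot> 1) n k)"

lemma intertwine_mult_left: "u * x = x' * u \<Longrightarrow> u * y = y' * u \<Longrightarrow> u * (x * y) = (x' * y') * u"
  for x :: "'x::ring_1"
  by (metis mult.assoc)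

lemma intertwine_mult: "x * u = u * x' \<Longrightarrow> y * u = u * y' \<Longrightarrow> (x * y) * u = u * (x' * y')"
  for x :: "'x::ring_1"
  by (metis mult.assoc)

lemma asc_const_lev: "asc (\<lambda>i. X k + b i \<cdot> 1) n l \<in> lev (Suc k)"
  by (intro asc_lev lev_add X_lev lev_sc lev_one)

lemma asc_const_conj: "asc (\<lambda>i. X (Suc k) + b i \<cdot> 1) n l * g k = g k * asc (\<lambda>i. X k + b i \<cdot> 1) n l"
proof (induction l)
  case (Suc l)
  have "(X (Suc k) + b (n + l) \<cdot> 1) * g k = g k * (X k + b (n + l) \<cdot> 1)"
    by (simp add: X_Suc algebra_simps)
  with Suc show ?case unfolding asc_Suc by (intro intertwine_mult)
qed simp

lemma \<tau>_asc_const: "\<tau> k (asc (\<lambda>i. X k + b i \<cdot> 1) n l) = \<tau> 0 (asc (\<lambda>i. X 0 + b i \<cdot> 1) n l)"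
proof (induction k)
  case (Suc k)
  have "asc (\<lambda>i. X (Suc k) + b i \<cdot> 1) n l = g k * asc (\<lambda>i. X k + b i \<cdot> 1) n l * ginv k"
    by (simp flip: asc_const_conj) (simp add: mult.assoc)
  then show ?case using Suc by (simp add: \<tau>_conj asc_const_lev)
qed simp

lemma \<theta>_lev: "\<theta> n k \<in> lev 0"
  unfolding \<theta>_def by (intro \<tau>_lev asc_const_lev)

lemma asc_shift_lev: "m + k \<le> n \<Longrightarrow> asc (\<lambda>i. X i + c i \<cdot> 1) m k \<in> lev n"
  by (rule asc_lev) (auto intro!: lev_add lev_sc lev_one lev_mono[OF _ X_lev])

text \<open>The cycle is closed from the top strand down. Moving g_k to the left turns the
  polynomial in \<open>X (Suc k)\<close> into one in \<open>X k\<close>, and then \<tau>(g_k) = 1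
  removes the strand. The counter \<open>r\<close> records the factors collected so far and keeps
  the induction in one form; \<open>c\<close> is free because shifted and unshifted products are
  both needed.\<close>

lemma tr_cycle:
  assumes "b \<in> lev n"
  shows "tr (Suc (n + j)) (b * asc (\<lambda>i. X i + c i \<cdot> 1) n j * asc (\<lambda>i. X (n + j) + c i \<cdot> 1) (n + j) (Suc r) * desc n j) =
    tr n (b * \<tau> n (asc (\<lambda>i. X n + c i \<cdot> 1) n (Suc (j + r))))"
proof (induction j arbitrary: r)
  case 0
  then show ?case using assms by (simp add: \<tau>_left)
next
  case (Suc j)
  let ?k = "n + j"
  let ?Q = "\<lambda>k. asc (\<lambda>i. X k + c i \<cdot> 1) (Suc ?k) (Suc r)"
  have lev: "b * asc (\<lambda>i. X i + c i \<cdot> 1) n (Suc j) \<in> lev (Suc ?k)" "?Q ?k * desc n j \<in> lev (Suc ?k)"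
    using assms by (auto intro!: lev_mult asc_shift_lev asc_const_lev desc_lev lev_mono[OF _ assms])
  have "b * asc (\<lambda>i. X i + c i \<cdot> 1) n (Suc j) * ?Q (Suc ?k) * desc n (Suc j) = (b * asc (\<lambda>i. X i + c i \<cdot> 1) n (Suc j)) * (?Q (Suc ?k) * g ?k) * desc n j"
    by (simp add: mult.assoc)
  also have "\<dots> = (b * asc (\<lambda>i. X i + c i \<cdot> 1) n (Suc j)) * g ?k * (?Q ?k * desc n j)"
    by (simp add: asc_const_conj mult.assoc)
  finally have "\<tau> (Suc ?k) (b * asc (\<lambda>i. X i + c i \<cdot> 1) n (Suc j) * ?Q (Suc ?k) * desc n (Suc j)) =
     (b * asc (\<lambda>i. X i + c i \<cdot> 1) n (Suc j)) * (?Q ?k * desc n j)"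
    using lev by (simp add: \<tau>_left \<tau>_right \<tau>_g)
  also have "\<dots> = b * asc (\<lambda>i. X i + c i \<cdot> 1) n j * ((X ?k + c ?k \<cdot> 1) * ?Q ?k) * desc n j"
    by (simp add: asc_Suc mult.assoc)
  also have "(X ?k + c ?k \<cdot> 1) * ?Q ?k = asc (\<lambda>i. X ?k + c i \<cdot> 1) ?k (Suc (Suc r))"
    unfolding asc_Suc_left[of _ ?k "Suc r"] by simp
  finally show ?case using Suc.IH[of "Suc r"] by simp
qed

text \<open>This identifies the p_k and the Casimir elements with the moments of
  \<open>X 0\<close>.\<close>

lemma tr_asc_desc: "tr (Suc j) (asc X 0 (Suc j) * desc 0 j) = \<tau> 0 (X 0 ^ Suc j)"
proof -
  have "asc (\<lambda>i. X 0) 0 n = X 0 ^ n" for n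
    by (induction n) (simp_all add: asc_Suc power_commutes)
  then show ?thesis
    using tr_cycle[of 1 0 j "\<lambda>_. 0" 0] by (simp add: lev_one asc_Suc power_commutes del: tr.simps(2))
qed

text \<open>The cycle runs through the strands from n on and the symmetrizer through those below, so
  the cycle closes to a factor \<open>\<theta>\<close> at ground level.\<close>

lemma tr_desc_hs_asc: "tr (Suc (n + j)) (desc n j * hs n * asc Y 0 (Suc (n + j))) = S n * \<theta> n (Suc j)"
proof -
  have Y_fun: "Y = (\<lambda>i. X i + a i \<cdot> 1)" by (simp add: Y_def fun_eq_iff)
  have "tr (Suc (n + j)) (desc n j * (hs n * asc Y 0 (Suc (n + j)))) =
      tr (Suc (n + j)) (hs n * asc Y 0 (Suc (n + j)) * desc n j)"
    by (intro cycD desc_cyc lev_mult asc_Y_lev lev_mono[OF _ hs_lev]) auto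
  also have Y: "hs n * asc Y 0 (Suc (n + j)) * desc n j = hs n * asc Y 0 n * asc Y n j * asc (\<lambda>i. X (n + j) + a i \<cdot> 1) (n + j) (Suc 0) * desc n j"
    by (simp add: asc_Suc asc_add Y_def mult.assoc)
  also have "tr (Suc (n + j)) \<dots> = tr n (hs n * asc Y 0 n * \<tau> n (asc (\<lambda>i. X n + a i \<cdot> 1) n (Suc j)))"
    unfolding Y_fun by (subst tr_cycle) (auto intro!: lev_mult asc_shift_lev hs_lev)
  finally show ?thesis
    unfolding \<tau>_asc_const[of n] \<theta>_def[symmetric] tr_right[OF \<theta>_lev]
    by (simp only: S_def mult.assoc)
qed

text \<open>Insert the recursion for \<open>hs (Suc n)\<close>. Its term without a generator splits
  off a power sum; in the other term, \<open>desc n j * g (n - 1)\<close> is a cycle longer by one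
  strand, and the symmetrizer is shorter by one.\<close>

lemma desc_recursion:
  "qn t (Suc n) \<cdot> tr (Suc n + j) (desc n j * hs (Suc n) * asc Y 0 (Suc n + j)) =
     (inverse t ^ (2 * n)) \<cdot> (S n * \<theta> n (Suc j)) +
     inverse t \<cdot> qn t n \<cdot> tr (n + Suc j) (desc (n - 1) (Suc j) * hs n * asc Y 0 (n + Suc j))"
proof -
  let ?m = "Suc (n + j)"
  let ?A = "asc Y 0 ?m"
  \<comment> \<open>Of the two copies of \<open>hs n\<close>, the left one is carried around the
    trace and absorbed by the shifted product from the right.\<close>
  have red: "tr ?m (desc n j * hs n * w * hs n * ?A) = tr ?m (desc n j * w * hs n * ?A)" if w: "w \<in> lev ?m" for w
  proof -
    have "tr ?m (hs n * (desc n j * w * hs n * ?A)) = tr ?m (desc n j * w * hs n * ?A * hs n)"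
      using w by (intro cycD cyc_hs lev_mult asc_Y_lev lev_mono[OF _ hs_lev] desc_lev) auto
    also have "desc n j * w * hs n * ?A * hs n = desc n j * w * (hs n * ?A * hs n)"
      by (simp add: mult.assoc)
    also have "\<dots> = desc n j * w * hs n * ?A" by (metis hs_asc_hs[of n ?m, OF le_SucI[OF le_add1]] mult.assoc)
    finally show ?thesis by (simp add: mult.assoc[symmetric] desc_hs)
  qed
  have G: "(inverse t * qn t n) \<cdot> tr ?m (desc n j * hs n * g (n - 1) * hs n * ?A) =
    (inverse t * qn t n) \<cdot> tr ?m (desc (n - 1) (Suc j) * hs n * ?A)"
  proof (cases n)
    case (Suc k)
    have "g (n - 1) \<in> lev ?m" using lev_mono[OF _ g_lev[of k], of ?m] Suc by simp
    from red[OF this] show ?thesis unfolding Suc by (simp only: desc_Suc_right diff_Suc_1)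
  qed simp
  have "qn t (Suc n) \<cdot> tr ?m (desc n j * hs (Suc n) * ?A) = tr ?m (desc n j * (qn t (Suc n) \<cdot> hs (Suc n)) * ?A)"
    by (simp add: tr_sc)
  also have "\<dots> = inverse t ^ (2 * n) \<cdot> tr ?m (desc n j * hs n * ?A) +
       (inverse t * qn t n) \<cdot> tr ?m (desc n j * hs n * g (n - 1) * hs n * ?A)"
    unfolding hs_Suc by (simp add: distrib_left distrib_right tr_add tr_sc mult.assoc)
  finally show ?thesis unfolding G using tr_desc_hs_asc[of n j] by (simp del: tr.simps desc.simps)
qed

text \<open>Without shifts and at t = 1 this is m h_m = sum of h_n p_{m-n}. The proof iterates
  \<open>desc_recursion\<close> with the total number m of strands fixed: n strands are symmetrized
  and the others hang on the last of these as a cycle, from n = m down to n = 0.\<close>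

theorem newton:
  "qn t m \<cdot> S m = (\<Sum>n<m. (inverse t ^ (m - 1 - n) * inverse t ^ (2 * n)) \<cdot> (S n * \<theta> n (m - n)))"
proof -
  have "qn t n \<cdot> tr m (desc (n - 1) (m - n) * hs n * asc Y 0 m) =
      (\<Sum>k<n. (inverse t ^ (n - 1 - k) * inverse t ^ (2 * k)) \<cdot> (S k * \<theta> k (m - k)))" if "n \<le> m" for n
    using that
  proof (induction n)
    case (Suc n)
    then have m: "Suc (m - Suc n) = m - n" "Suc (n + (m - Suc n)) = m" by auto
    have step: "(inverse t ^ (n - k) * x) \<cdot> y = inverse t \<cdot> (inverse t ^ (n - 1 - k) * x) \<cdot> y" if "k < n" for k x y
    proof -
      have "inverse t ^ (n - k) = inverse t * inverse t ^ (n - 1 - k)"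
        using that by (metis Suc_diff_Suc diff_Suc_eq_diff_pred power_Suc)
      then show ?thesis by (simp only: sc_sc mult.assoc)
    qed
    have *: "(\<Sum>k<n. (inverse t ^ (n - k) * inverse t ^ (2 * k)) \<cdot> (S k * \<theta> k (m - k))) =
       inverse t \<cdot> (\<Sum>k<n. (inverse t ^ (n - 1 - k) * inverse t ^ (2 * k)) \<cdot> (S k * \<theta> k (m - k)))"
      unfolding sc_sum_right by (intro sum.cong refl step) simp
    have "Suc n + (m - Suc n) = m" "n + Suc (m - Suc n) = m" using Suc.prems by auto
    then have "qn t (Suc n) \<cdot> tr m (desc n (m - Suc n) * hs (Suc n) * asc Y 0 m) =
       inverse t ^ (2 * n) \<cdot> (S n * \<theta> n (m - n)) +
       inverse t \<cdot> qn t n \<cdot> tr m (desc (n - 1) (m - n) * hs n * asc Y 0 m)"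
      using desc_recursion[of n "m - Suc n"] unfolding m by metis
    also have "qn t n \<cdot> tr m (desc (n - 1) (m - n) * hs n * asc Y 0 m) =
       (\<Sum>k<n. (inverse t ^ (n - 1 - k) * inverse t ^ (2 * k)) \<cdot> (S k * \<theta> k (m - k)))"
      using Suc.prems by (intro Suc.IH) simp
    finally show ?case by (simp only: flip: *) (simp add: add.commute)
  qed simp
  from this[of m] show ?thesis by (simp add: S_def)
qed

section \<open>Expansion in the unshifted averages\<close>

definition \<Omega> :: "nat \<Rightarrow> 'r" where
  "\<Omega> k = tr k (hs k * asc X 0 k)"

text \<open>The shifts form a list detached from the strand numbers, so that the product can slide
  to neighbouring strands and keep its shifts.\<close>

definition shifts :: "'k list \<Rightarrow> nat \<Rightarrow> 'r" where
  "shifts bs k = prod_list (map (\<lambda>i. X (k + i) + (bs ! i) \<cdot> 1) [0..<length bs])"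

lemma shifts_Nil [simp]: "shifts [] k = 1"
  by (simp add: shifts_def)

lemma shifts_Cons: "shifts (b # bs) k = (X k + b \<cdot> 1) * shifts bs (Suc k)"
  by (simp add: shifts_def upt_conv_Cons map_Suc_upt[symmetric] o_def del: upt_Suc)

fun gasc :: "nat \<Rightarrow> nat \<Rightarrow> 'r" where
  "gasc k 0 = 1"
| "gasc k (Suc r) = g k * gasc (Suc k) r"

fun ginv_desc :: "nat \<Rightarrow> nat \<Rightarrow> 'r" where
  "ginv_desc k 0 = 1"
| "ginv_desc k (Suc r) = ginv_desc (Suc k) r * ginv k"

lemma gasc_ginv: "gasc k r * ginv_desc k r = 1"
proof (induction r arbitrary: k)
  case (Suc r)
  have "gasc k (Suc r) * ginv_desc k (Suc r) = g k * (gasc (Suc k) r * ginv_desc (Suc k) r) * ginv k"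
    by (simp add: mult.assoc)
  then show ?case by (simp add: Suc)
qed simp

lemma gasc_X: "k > i \<Longrightarrow> gasc k r * X i = X i * gasc k r"
proof (induction r arbitrary: k)
  case (Suc r)
  then have "gasc (Suc k) r * X i = X i * gasc (Suc k) r" "g k * X i = X i * g k"
    by (auto intro: g_X_low)
  then have "X i * (g k * gasc (Suc k) r) = (g k * gasc (Suc k) r) * X i"
    by (intro intertwine_mult_left) simp_all
  then show ?case by simp
qed simp

text \<open>The product g_k ... g_{k+r-1} carries \<open>X i\<close> to \<open>X (Suc i)\<close> for
  i from k to k + r - 1: \<open>g i\<close> conjugates, the later generators commute with
  \<open>X i\<close> and the earlier ones with \<open>X (Suc i)\<close>.\<close>

lemma gasc_shifts: "length bs \<le> r \<Longrightarrow> gasc k r * shifts bs k = shifts bs (Suc k) * gasc k r"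
proof (induction bs arbitrary: k r)
  case (Cons b bs)
  then obtain r' where r: "r = Suc r'" by (cases r) auto
  let ?U = "gasc (Suc k) r'"
  have "?U * (X k + b \<cdot> 1) = (X k + b \<cdot> 1) * ?U"
    by (simp add: gasc_X distrib_left distrib_right)
  then have "gasc k r * (X k + b \<cdot> 1) = g k * (X k + b \<cdot> 1) * ?U"
    by (simp add: r mult.assoc)
  also have "g k * (X k + b \<cdot> 1) = (X (Suc k) + b \<cdot> 1) * g k"
    by (simp add: X_Suc distrib_left distrib_right mult.assoc)
  finally have 1: "gasc k r * (X k + b \<cdot> 1) = (X (Suc k) + b \<cdot> 1) * gasc k r"
    by (simp add: r mult.assoc)
  have 2: "?U * shifts bs (Suc k) = shifts bs (Suc (Suc k)) * ?U"
    using Cons by (simp add: r)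
  have 3: "g k * shifts bs (Suc (Suc k)) = shifts bs (Suc (Suc k)) * g k"
  proof -
    have "g k * shifts cs l = shifts cs l * g k" if "l > Suc k" for l and cs :: "'k list"
      using that
    proof (induction cs arbitrary: l)
      case (Cons c cs)
      have "g k * (X l + c \<cdot> 1) = (X l + c \<cdot> 1) * g k" using Cons.prems by (simp add: g_X_high distrib_left distrib_right)
      moreover have "g k * shifts cs (Suc l) = shifts cs (Suc l) * g k" using Cons by simp
      ultimately show ?case unfolding shifts_Cons by (rule intertwine_mult_left)
    qed simp
    then show ?thesis by simp
  qed
  have "gasc k r * shifts bs (Suc k) = g k * (?U * shifts bs (Suc k))"
    by (simp add: r mult.assoc)
  also have "\<dots> = (g k * shifts bs (Suc (Suc k))) * ?U" by (simp only: 2 mult.assoc)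
  also have "\<dots> = shifts bs (Suc (Suc k)) * gasc k r" by (simp add: 3 r mult.assoc)
  finally have 4: "gasc k r * shifts bs (Suc k) = shifts bs (Suc (Suc k)) * gasc k r" .
  show ?case unfolding shifts_Cons by (intro intertwine_mult_left 1 4)
qed simp

lemma gasc_cyc: "k + r < m \<Longrightarrow> gasc k r \<in> cyc m" and ginv_desc_cyc: "k + r < m \<Longrightarrow> ginv_desc k r \<in> cyc m"
  by (induction r arbitrary: k) (simp_all add: cyc_one cyc_mult cyc_g cyc_ginv)

lemma hs_gasc: "k + r < m \<Longrightarrow> hs m * gasc k r = t ^ r \<cdot> hs m"
proof (induction r arbitrary: k)
  case (Suc r)
  then show ?case by (simp add: mult.assoc[symmetric] hs_absorb_right)
qed simp

lemma ginv_desc_hs: "k + r < m \<Longrightarrow> ginv_desc k r * hs m = inverse t ^ r \<cdot> hs m"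
proof (induction r arbitrary: k)
  case (Suc r)
  then have "ginv k * hs m = inverse t \<cdot> hs m"
    by (simp add: ginv_alt distrib_right hs_absorb_left flip: sc_add_left)
  with Suc show ?case by (simp add: mult.assoc)
qed simp

lemma shifts_lev: "k + length bs \<le> m \<Longrightarrow> shifts bs k \<in> lev m"
proof (induction bs arbitrary: k)
  case (Cons b bs)
  then show ?case unfolding shifts_Cons
    by (intro lev_mult lev_add lev_sc lev_one lev_mono[OF _ X_lev]) auto
qed (simp add: lev_one)

lemma asc_X_lev: "m + k \<le> n \<Longrightarrow> asc X m k \<in> lev n"
  by (rule asc_lev) (auto intro!: lev_mono[OF _ X_lev])

text \<open>Conjugation by a product of generators moves the tail of the product one strand to the left, and
  the symmetrizer absorbs this product at the cost of a scalar that cancels.\<close>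
lemma tr_shifts_Suc:
  assumes "k + Suc (length bs) \<le> m"
  shows "tr m (hs m * asc X 0 k * shifts bs (Suc k)) = tr m (hs m * asc X 0 k * shifts bs k)"
proof -
  let ?r = "length bs"
  let ?U = "gasc k ?r" and ?V = "ginv_desc k ?r" and ?A = "asc X 0 k"
  have UA: "?U * ?A = ?A * ?U" by (rule asc_commute) (simp add: gasc_X)
  have "shifts bs (Suc k) = shifts bs (Suc k) * (?U * ?V)" by (simp add: gasc_ginv)
  also have "\<dots> = ?U * shifts bs k * ?V" by (simp only: gasc_shifts order.refl mult.assoc)
  finally have "hs m * ?A * shifts bs (Suc k) = hs m * (?A * ?U) * shifts bs k * ?V"
    by (simp only: mult.assoc)
  also have "\<dots> = (hs m * ?U) * ?A * shifts bs k * ?V"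
    by (simp only: UA[symmetric] mult.assoc)
  also have "\<dots> = t ^ ?r \<cdot> (hs m * ?A * shifts bs k * ?V)"
    using assms by (simp add: hs_gasc)
  finally have 1: "tr m (hs m * ?A * shifts bs (Suc k)) = t ^ ?r \<cdot> tr m (hs m * ?A * shifts bs k * ?V)"
    by (simp add: tr_sc)
  have "tr m (hs m * ?A * shifts bs k * ?V) = tr m (?V * (hs m * ?A * shifts bs k))"
    using assms by (intro cycD[symmetric] ginv_desc_cyc lev_mult hs_lev asc_X_lev shifts_lev) auto
  also have "?V * (hs m * ?A * shifts bs k) = inverse t ^ ?r \<cdot> (hs m * ?A * shifts bs k)"
    using assms by (simp add: mult.assoc[symmetric] ginv_desc_hs)
  finally show ?thesis using 1 by (simp add: tr_sc flip: power_mult_distrib)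
qed

text \<open>Each strand that carries no factor \<open>X\<close> is closed by
  \<open>\<tau>_hs\<close> and contributes one factor.\<close>

definition cf :: "nat \<Rightarrow> nat \<Rightarrow> 'k" where
  "cf m k = (\<Prod>j\<in>{k..<m}. (inverse t ^ (2 * j) * \<delta> + inverse t * qn t j) / qn t (Suc j))"

lemma \<tau>_hs: "\<tau> n (hs (Suc n)) = ((inverse t ^ (2 * n) * \<delta> + inverse t * qn t n) / qn t (Suc n)) \<cdot> hs n"
proof -
  have g: "(inverse t * qn t n) \<cdot> \<tau> n (hs n * (g (n - 1) * hs n)) = (inverse t * qn t n) \<cdot> hs n"
  proof (cases n)
    case (Suc k)
    show ?thesis using \<tau>_left[OF hs_lev] \<tau>_right[OF hs_lev] \<tau>_g[of k] Suc by simp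
  qed simp
  have "qn t (Suc n) \<cdot> \<tau> n (hs (Suc n)) = inverse t ^ (2 * n) \<cdot> \<tau> n (hs n * 1 * hs n) +
      (inverse t * qn t n) \<cdot> \<tau> n (hs n * (g (n - 1) * hs n))"
    by (simp add: hs_Suc \<tau>_add flip: \<tau>_sc)
  also have "\<tau> n (hs n * 1 * hs n) = \<delta> \<cdot> hs n"
    using \<tau>_left[OF hs_lev, of n 1] \<tau>_right[OF hs_lev, of n "hs n * 1"] by (simp add: \<tau>_one)
  finally have "qn t (Suc n) \<cdot> \<tau> n (hs (Suc n)) = (inverse t ^ (2 * n) * \<delta> + inverse t * qn t n) \<cdot> hs n"
    unfolding g by (simp add: sc_add_left)
  then have "inverse (qn t (Suc n)) \<cdot> qn t (Suc n) \<cdot> \<tau> n (hs (Suc n)) =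
    inverse (qn t (Suc n)) \<cdot> (inverse t ^ (2 * n) * \<delta> + inverse t * qn t n) \<cdot> hs n" by simp
  then show ?thesis by (simp add: divide_inverse mult.commute)
qed

lemma tr_hs_asc: "k \<le> m \<Longrightarrow> tr m (hs m * asc X 0 k) = cf m k \<cdot> \<Omega> k"
proof (induction m rule: dec_induct)
  case (step m)
  have "tr (Suc m) (hs (Suc m) * asc X 0 k) = tr m (\<tau> m (hs (Suc m)) * asc X 0 k)"
    using step by (simp add: \<tau>_right asc_X_lev)
  also have "\<dots> = ((inverse t ^ (2 * m) * \<delta> + inverse t * qn t m) / qn t (Suc m)) \<cdot> tr m (hs m * asc X 0 k)"
    by (simp add: \<tau>_hs tr_sc)
  finally show ?case using step by (simp add: cf_def mult_ac)
qed (simp add: cf_def \<Omega>_def)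

text \<open>When the first factor \<open>X k + b\<close> is expanded, the summand \<open>b\<close>
  leaves a gap at strand k, which \<open>tr_shifts_Suc\<close> closes. So a term only depends on how
  many factors \<open>X\<close> were chosen, and the products of the remaining shifts add up to the
  coefficients of the product of the x + b.\<close>

lemma tr_shifts:
  "k + length bs \<le> m \<Longrightarrow> tr m (hs m * asc X 0 k * shifts bs k) =
     (\<Sum>i\<le>length bs. (coeff (\<Prod>b\<leftarrow>bs. [:b, 1:]) i * cf m (k + i)) \<cdot> \<Omega> (k + i))"
proof (induction bs arbitrary: k)
  case (Cons b bs)
  let ?p = "\<Prod>b\<leftarrow>bs. [:b, 1:]" and ?l = "length bs"
  have deg: "degree ?p \<le> ?l" by (rule degree_prod_linear_le)
  have "tr m (hs m * asc X 0 k * shifts (b # bs) k) =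
      tr m (hs m * asc X 0 (Suc k) * shifts bs (Suc k)) + b \<cdot> tr m (hs m * asc X 0 k * shifts bs (Suc k))"
    unfolding shifts_Cons asc_Suc by (simp add: distrib_left distrib_right tr_add tr_sc mult.assoc)
  also have "tr m (hs m * asc X 0 k * shifts bs (Suc k)) = tr m (hs m * asc X 0 k * shifts bs k)"
    using Cons.prems by (intro tr_shifts_Suc) simp
  also have "\<dots> = (\<Sum>i\<le>?l. (coeff ?p i * cf m (k + i)) \<cdot> \<Omega> (k + i))"
    using Cons by simp
  also have "\<dots> = (\<Sum>i\<le>Suc ?l. (coeff ?p i * cf m (k + i)) \<cdot> \<Omega> (k + i))"
    using deg by (simp add: coeff_eq_0)
  also have "tr m (hs m * asc X 0 (Suc k) * shifts bs (Suc k)) =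
      (\<Sum>i\<le>?l. (coeff ?p i * cf m (k + Suc i)) \<cdot> \<Omega> (k + Suc i))"
    using Cons.IH[of "Suc k"] Cons.prems by simp
  also have "\<dots> = (\<Sum>i\<le>Suc ?l. (coeff (pCons 0 ?p) i * cf m (k + i)) \<cdot> \<Omega> (k + i))"
    by (subst sum.atMost_Suc_shift) simp
  also have "\<dots> + b \<cdot> (\<Sum>i\<le>Suc ?l. (coeff ?p i * cf m (k + i)) \<cdot> \<Omega> (k + i)) =
      (\<Sum>i\<le>Suc ?l. ((coeff (pCons 0 ?p) i + b * coeff ?p i) * cf m (k + i)) \<cdot> \<Omega> (k + i))"
    by (simp only: sc_sum_right flip: sum.distrib) (simp only: sc_sc mult.assoc sc_add_left[symmetric] distrib_right)
  also have "\<dots> = (\<Sum>i\<le>Suc ?l. (coeff (\<Prod>b\<leftarrow>b # bs. [:b, 1:]) i * cf m (k + i)) \<cdot> \<Omega> (k + i))"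
    by (intro sum.cong refl) (simp add: add.commute)
  finally show ?case by simp
qed (simp add: tr_hs_asc)

theorem S_expansion:
  "S m = (\<Sum>k\<le>m. (coeff (\<Prod>b\<leftarrow>map a [0..<m]. [:b, 1:]) k * cf m k) \<cdot> \<Omega> k)"
proof -
  have "asc Y 0 m = shifts (map a [0..<m]) 0"
    unfolding asc_def shifts_def by (intro arg_cong[of _ _ prod_list]) (simp add: Y_def)
  then show ?thesis using tr_shifts[of 0 "map a [0..<m]" m] by (simp add: S_def)
qed

theorem \<theta>_expansion:
  "\<theta> n j = (\<Sum>k\<le>j. coeff (\<Prod>b\<leftarrow>map a [n..<n + j]. [:b, 1:]) k \<cdot> \<tau> 0 (X 0 ^ k))"
proof -
  have "asc (\<lambda>i. X 0 + a i \<cdot> 1) n j = (\<Sum>k\<le>j. coeff (\<Prod>b\<leftarrow>map a [n..<n + j]. [:b, 1:]) k \<cdot> (X 0 ^ k))"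
  proof (induction j arbitrary: n)
    case (Suc j)
    define p where "p = (\<Prod>b\<leftarrow>map a [Suc n..<Suc n + j]. [:b, 1:])"
    have deg: "degree p \<le> j" unfolding p_def
      using degree_prod_linear_le[of "map a [Suc n..<Suc n + j]"] by (simp del: upt_Suc)
    have *: "coeff (\<Prod>b\<leftarrow>map a [n..<n + Suc j]. [:b, 1:]) k = coeff (pCons 0 p) k + a n * coeff p k" for k
      by (simp add: p_def upt_conv_Cons add.commute del: upt_Suc)
    have "asc (\<lambda>i. X 0 + a i \<cdot> 1) n (Suc j) = (\<Sum>k\<le>j. coeff p k \<cdot> (X 0 ^ Suc k)) + (\<Sum>k\<le>j. (a n * coeff p k) \<cdot> (X 0 ^ k))"
      unfolding asc_Suc_left Suc.IH p_def[symmetric]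
      by (simp add: distrib_right sum_distrib_left sc_sum_right sc_add_right sum.distrib mult.commute)
    also have "(\<Sum>k\<le>j. coeff p k \<cdot> (X 0 ^ Suc k)) = (\<Sum>k\<le>Suc j. coeff (pCons 0 p) k \<cdot> (X 0 ^ k))"
      by (subst sum.atMost_Suc_shift) simp
    also have "(\<Sum>k\<le>j. (a n * coeff p k) \<cdot> (X 0 ^ k)) = (\<Sum>k\<le>Suc j. (a n * coeff p k) \<cdot> (X 0 ^ k))"
      using deg by (simp add: coeff_eq_0)
    finally show ?case unfolding * by (simp only: sc_add_left sum.distrib)
  qed simp
  then show ?thesis by (simp add: \<theta>_def \<tau>_sum \<tau>_sc)
qed

end

section \<open>The R-matrix and the quantum trace\<close>

text \<open>All tensor factors are kept in one ring, with \<open>e n a b\<close> the matrix unit in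
  factor n = 0, 1, 2, ..., so that the operators and partial traces for all m can be
  related.\<close>

locale matrix_units = algebra_ring sc for sc :: "'k::field \<Rightarrow> 'r::ring_1 \<Rightarrow> 'r" (infixr "\<cdot>" 75) +
  fixes t :: 'k and N :: nat and e :: "nat \<Rightarrow> nat \<Rightarrow> nat \<Rightarrow> 'r"
  assumes t_nz: "t \<noteq> 0"
    and qn_t_nz: "qn t (Suc n) \<noteq> 0"
    and e_same: "b \<in> {1..N} \<Longrightarrow> e n a b * e n b d = e n a d"
    and e_diff: "b \<noteq> c \<Longrightarrow> e n a b * e n c d = 0"
    and e_sum: "(\<Sum>a\<in>{1..N}. e n a a) = 1"
    and e_comm: "m \<noteq> n \<Longrightarrow> e m a b * e n c d = e n c d * e m a b"
begin

lemmas e_sum' = e_sum[unfolded One_nat_def]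

lemma e_mult: "b \<in> {1..N} \<Longrightarrow> e n a b * e n c d = (if b = c then e n a d else 0)"
  by (simp add: e_same e_diff)

lemma e_mult_left: "b \<in> {1..N} \<Longrightarrow> e n a b * (e n c d * x) = (if b = c then e n a d * x else 0)"
  by (simp add: e_mult flip: mult.assoc)

lemma e_swap: "e (Suc i) a b * e i c d = e i c d * e (Suc i) a b"
  by (simp add: e_comm)

lemma e_swap_left: "e (Suc i) a b * (e i c d * x) = e i c d * (e (Suc i) a b * x)"
  by (simp add: e_comm flip: mult.assoc)

text \<open>Right multiplication by the projections \<open>e n a a\<close>, which sum to 1, stands
  in for evaluation at the basis vectors of factor n.\<close>

lemma ket_ext:
  assumes "\<And>a. a \<in> {1..N} \<Longrightarrow> x * e n a a = y * e n a a"
  shows "x = y"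
proof -
  have "x * (\<Sum>a\<in>{1..N}. e n a a) = y * (\<Sum>a\<in>{1..N}. e n a a)"
    unfolding sum_distrib_left by (intro sum.cong assms refl)
  then show ?thesis by (simp only: e_sum mult_1_right)
qed

section \<open>The R-matrix and its Hecke relations\<close>

definition r :: "nat \<Rightarrow> nat \<Rightarrow> nat \<Rightarrow> nat \<Rightarrow> 'k" where
  "r a b c d = (if a = c \<and> b = d then if a = b then t else if a < b then t - inverse t else 0
     else if a = d \<and> b = c then 1 else 0)"

definition R :: "nat \<Rightarrow> 'r" where
  "R i = (\<Sum>a\<in>{1..N}. \<Sum>b\<in>{1..N}. \<Sum>c\<in>{1..N}. \<Sum>d\<in>{1..N}. r a b c d \<cdot> (e i a c * e (Suc i) b d))"

lemma R_ket_sum: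
  assumes "c \<in> {1..N}" "d \<in> {1..N}"
  shows "R i * (e i c x * (e (Suc i) d y * z)) =
    (\<Sum>a\<in>{1..N}. \<Sum>b\<in>{1..N}. r a b c d \<cdot> (e i a x * (e (Suc i) b y * z)))"
proof -
  have *: "(e i a c' * e (Suc i) b d') * (e i c x * (e (Suc i) d y * z)) =
     (if c' = c then if d' = d then e i a x * (e (Suc i) b y * z) else 0 else 0)"
    if "c' \<in> {1..N}" "d' \<in> {1..N}" for a b c' d'
    using that by (simp add: mult.assoc e_swap_left e_mult_left)
  have "(\<Sum>c'\<in>{1..N}. \<Sum>d'\<in>{1..N}. (r a b c' d' \<cdot> (e i a c' * e (Suc i) b d')) * (e i c x * (e (Suc i) d y * z))) =
     r a b c d \<cdot> (e i a x * (e (Suc i) b y * z))" (is "?L = _") for a b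
  proof -
    have "?L = (\<Sum>c'\<in>{1..N}. \<Sum>d'\<in>{1..N}. if d' = d then if c' = c then r a b c d \<cdot> (e i a x * (e (Suc i) b y * z)) else 0 else 0)"
      unfolding sc_mult_left by (intro sum.cong refl) (simp only: *, simp)
    then show ?thesis using assms by simp
  qed
  then show ?thesis unfolding R_def sum_distrib_right by (intro sum.cong refl) simp
qed

lemma R_bra_sum:
  assumes "a \<in> {1..N}" "b \<in> {1..N}"
  shows "e i x a * (e (Suc i) y b * (R i * z)) =
    (\<Sum>c\<in>{1..N}. \<Sum>d\<in>{1..N}. r a b c d \<cdot> (e i x c * (e (Suc i) y d * z)))"
proof -
  have *: "(e i x a * e (Suc i) y b) * (e i a' c * e (Suc i) b' d) =
     (if b' = b then if a' = a then e i x c * e (Suc i) y d else 0 else 0)" for a' b' c d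
    using assms by (simp add: mult.assoc e_swap_left e_mult_left e_mult)
  have "e i x a * (e (Suc i) y b * R i) = (\<Sum>a'\<in>{1..N}. \<Sum>b'\<in>{1..N}. if b' = b then if a' = a then
      (\<Sum>c\<in>{1..N}. \<Sum>d\<in>{1..N}. r a b c d \<cdot> (e i x c * e (Suc i) y d)) else 0 else 0)"
    unfolding R_def sum_distrib_left sc_mult_right
    by (intro sum.cong refl) (simp only: mult.assoc[symmetric], simp only: *[unfolded mult.assoc[symmetric]], simp)
  then have "e i x a * (e (Suc i) y b * R i) = (\<Sum>c\<in>{1..N}. \<Sum>d\<in>{1..N}. r a b c d \<cdot> (e i x c * e (Suc i) y d))"
    using assms by simp
  then have "e i x a * (e (Suc i) y b * R i) * z = (\<Sum>c\<in>{1..N}. \<Sum>d\<in>{1..N}. r a b c d \<cdot> (e i x c * e (Suc i) y d)) * z"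
    by simp
  then show ?thesis by (simp add: sum_distrib_right mult.assoc)
qed

lemma r_sum:
  assumes "c \<in> {1..N}" "d \<in> {1..N}"
  shows "(\<Sum>a\<in>{1..N}. \<Sum>b\<in>{1..N}. r a b c d \<cdot> f a b) =
    (if c = d then t \<cdot> f c c else f d c + (if c < d then (t - inverse t) \<cdot> f c d else 0))"
proof -
  have "r a b c d \<cdot> f a b = (if b = d then if a = c then (if c = d then t else if c < d then t - inverse t else 0) \<cdot> f c d else 0 else 0)
     + (if b = c then if a = d then if c = d then 0 else f d c else 0 else 0)" for a b
    by (auto simp: r_def)
  then show ?thesis using assms by (simp add: sum.distrib)
qed

lemma r_sym: "r a b c d = r c d a b"
proof -
  have "a = c \<and> b = d \<longleftrightarrow> c = a \<and> d = b" "a = d \<and> b = c \<longleftrightarrow> c = b \<and> d = a" by blast+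
  then show ?thesis unfolding r_def by (intro if_cong) (blast | simp)+
qed

lemma R_ket:
  assumes "c \<in> {1..N}" "d \<in> {1..N}"
  shows "R i * (e i c x * (e (Suc i) d y * z)) =
    (if c = d then t \<cdot> (e i c x * (e (Suc i) d y * z)) else e i d x * (e (Suc i) c y * z) +
       (if c < d then (t - inverse t) \<cdot> (e i c x * (e (Suc i) d y * z)) else 0))"
  unfolding R_ket_sum[OF assms] by (subst r_sum[OF assms]) simp

lemma R_bra:
  assumes "c \<in> {1..N}" "d \<in> {1..N}"
  shows "e i x c * (e (Suc i) y d * (R i * z)) =
    (if c = d then t \<cdot> (e i x c * (e (Suc i) y d * z)) else e i x d * (e (Suc i) y c * z) +
       (if c < d then (t - inverse t) \<cdot> (e i x c * (e (Suc i) y d * z)) else 0))"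
  unfolding R_bra_sum[OF assms] by (subst r_sym, subst r_sum[OF assms]) simp

lemma R_e_far:
  assumes "k \<noteq> i" "k \<noteq> Suc i"
  shows "R i * e k a b = e k a b * R i"
proof -
  have "(e i a' c * e (Suc i) b' d) * e k a b = e k a b * (e i a' c * e (Suc i) b' d)" for a' b' c d
    by (metis assms e_comm mult.assoc)
  then show ?thesis unfolding R_def sum_distrib_left sum_distrib_right by simp
qed

lemma R_e_far_left:
  assumes "k \<noteq> i" "k \<noteq> Suc i"
  shows "R i * (e k a b * x) = e k a b * (R i * x)"
  using R_e_far[OF assms] by (metis mult.assoc)

lemma R_sq: "R i * R i = 1 + (t - inverse t) \<cdot> R i"
proof (rule ket_ext[of _ i], rule ket_ext[of _ "Suc i"])
  fix a b assume ab: "a \<in> {1..N}" "b \<in> {1..N}"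
  note [simp] = R_ket[of _ _ i _ _ 1, simplified]
  have "t * t = 1 + (t - inverse t) * t" using t_nz by (simp add: field_simps)
  then show "R i * R i * e i a a * e (Suc i) b b = (1 + (t - inverse t) \<cdot> R i) * e i a a * e (Suc i) b b"
    using ab by (auto simp: mult.assoc distrib_left distrib_right sc_add_left sc_add_right)
qed

lemma R_far: "Suc i < j \<Longrightarrow> R i * R j = R j * R i"
proof -
  assume "Suc i < j"
  then have "R i * (e j a b * e (Suc j) c d) = (e j a b * e (Suc j) c d) * R i" for a b c d
    by (simp add: R_e_far R_e_far_left mult.assoc)
  then have "R i * (\<Sum>a\<in>{1..N}. \<Sum>b\<in>{1..N}. \<Sum>c\<in>{1..N}. \<Sum>d\<in>{1..N}. r a b c d \<cdot> (e j a c * e (Suc j) b d)) =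
     (\<Sum>a\<in>{1..N}. \<Sum>b\<in>{1..N}. \<Sum>c\<in>{1..N}. \<Sum>d\<in>{1..N}. r a b c d \<cdot> (e j a c * e (Suc j) b d)) * R i"
    by (simp add: sum_distrib_left sum_distrib_right)
  then show ?thesis by (simp only: R_def[of j])
qed

text \<open>On basis vectors of three factors, the operators permute the labels in
  \<open>K x y z\<close> and add multiples according to the order of the labels, so each relative
  order of three labels gives one finite check.\<close>

lemma R_braid: "R i * (R (Suc i) * R i) = R (Suc i) * (R i * R (Suc i))"
proof (rule ket_ext[of _ i], rule ket_ext[of _ "Suc i"], rule ket_ext[of _ "Suc (Suc i)"])
  fix a b c assume abc: "a \<in> {1..N}" "b \<in> {1..N}" "c \<in> {1..N}"
  let ?k = "\<lambda>a' b' c'. e i a' a * (e (Suc i) b' b * e (Suc (Suc i)) c' c)"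
  let ?l = "t - inverse t"
  define K where "K = ?k"
  have 1: "R i * K x y z = (if x = y then t \<cdot> K x y z else K y x z + (if x < y then ?l \<cdot> K x y z else 0))"
    if "x \<in> {1..N}" "y \<in> {1..N}" for x y z
    using that by (simp add: K_def R_ket)
  have 2: "R (Suc i) * K x y z = (if y = z then t \<cdot> K x y z else K x z y + (if y < z then ?l \<cdot> K x y z else 0))"
    if "y \<in> {1..N}" "z \<in> {1..N}" for x y z
    using that R_ket[of y z "Suc i" b c 1] by (simp add: K_def R_e_far_left distrib_left)
  have "R i * (R (Suc i) * (R i * K a b c)) = R (Suc i) * (R i * (R (Suc i) * K a b c))"
    using abc
    by (cases a b rule: linorder_cases; cases b c rule: linorder_cases; cases a c rule: linorder_cases)
      (simp_all add: 1 2 distrib_left sc_distrib mult.commute mult.left_commute t_nz algebra_simps)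
  then show "R i * (R (Suc i) * R i) * e i a a * e (Suc i) b b * e (Suc (Suc i)) c c =
    R (Suc i) * (R i * R (Suc i)) * e i a a * e (Suc i) b b * e (Suc (Suc i)) c c"
    by (simp add: K_def mult.assoc)
qed

sublocale hecke sc t R
  by unfold_locales (fact t_nz qn_t_nz R_sq R_braid R_far)+

text \<open>A commutant rather than a generated subalgebra: commuting with the matrix units of
  factor n is what allows an element to be pulled out of \<open>\<tau> n\<close>, and coefficients
  from the presented algebra belong to every level.\<close>

definition lev :: "nat \<Rightarrow> 'r set" where
  "lev n = {x. \<forall>k\<ge>n. \<forall>a b. e k a b * x = x * e k a b}"

lemma levD: "x \<in> lev n \<Longrightarrow> n \<le> k \<Longrightarrow> e k a b * x = x * e k a b"
  by (simp add: lev_def)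

lemma levD_left: "x \<in> lev n \<Longrightarrow> n \<le> k \<Longrightarrow> e k a b * (x * y) = x * (e k a b * y)"
  by (simp add: levD flip: mult.assoc)

lemma lev_mult: "x \<in> lev n \<Longrightarrow> y \<in> lev n \<Longrightarrow> x * y \<in> lev n"
  by (simp add: lev_def) (metis mult.assoc)

lemma lev_add: "x \<in> lev n \<Longrightarrow> y \<in> lev n \<Longrightarrow> x + y \<in> lev n"
  by (simp add: lev_def distrib_left distrib_right)

lemma lev_sc: "x \<in> lev n \<Longrightarrow> b \<cdot> x \<in> lev n"
  by (simp add: lev_def)

lemma lev_zero: "0 \<in> lev n"
  by (simp add: lev_def)

lemma lev_sum: "(\<And>i. i \<in> A \<Longrightarrow> f i \<in> lev n) \<Longrightarrow> (\<Sum>i\<in>A. f i) \<in> lev n"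
  by (induction A rule: infinite_finite_induct) (simp_all add: lev_add lev_zero)

lemma e_lev: "i < n \<Longrightarrow> e i a b \<in> lev n"
  by (auto simp: lev_def intro: e_comm)

lemma R_lev: "R n \<in> lev (Suc (Suc n))"
  unfolding R_def by (intro lev_sum lev_sc lev_mult e_lev) auto

section \<open>The quantum partial trace\<close>

definition d :: "nat \<Rightarrow> 'k" where
  "d a = t ^ (2 * a) * inverse t ^ (2 * N + 1)"

definition \<delta> :: 'k where
  "\<delta> = (\<Sum>a\<in>{1..N}. d a)"

text \<open>For fixed \<open>a\<close>, the sum over \<open>b\<close> spreads the diagonal block
  \<open>a\<close> of \<open>x\<close> in factor n to an operator that is trivial in this factor.
  With the weights of D this is the partial trace; at t = 1 all weights are 1.\<close>

definition \<tau> :: "nat \<Rightarrow> 'r \<Rightarrow> 'r" where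
  "\<tau> n x = (\<Sum>b\<in>{1..N}. \<Sum>a\<in>{1..N}. d a \<cdot> (e n b a * x * e n a b))"

text \<open>\<open>d a\<close> is the diagonal entry t^(2a-1-2N) of D written with natural
  exponents; consecutive entries have ratio t^2, so the sum telescopes.\<close>

lemma d_sum: "c \<le> b \<Longrightarrow> (t - inverse t) * (\<Sum>a\<in>{c<..b}. d a) = t * d b - t * d c"
proof (induction b rule: dec_induct)
  case (step b)
  have "{c<..Suc b} = insert (Suc b) {c<..b}" using step by auto
  moreover have "d (Suc b) = t * t * d b" by (simp add: d_def)
  ultimately show ?case using step by (simp add: algebra_simps)
qed simp

lemma d_N: "t * d N = 1"
  by (simp add: d_def t_nz field_simps)

lemma \<tau>_one: "\<tau> n 1 = \<delta> \<cdot> 1"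
proof -
  have "\<tau> n 1 = (\<Sum>b\<in>{1..N}. \<Sum>a\<in>{1..N}. d a \<cdot> e n b b)"
    unfolding \<tau>_def by (intro sum.cong refl) (simp add: e_mult)
  then show ?thesis by (simp add: \<delta>_def e_sum' flip: sc_sum_left sc_sum_right)
qed

lemma \<tau>_add: "\<tau> n (x + y) = \<tau> n x + \<tau> n y"
  by (simp add: \<tau>_def distrib_left distrib_right sc_add_right sum.distrib)

lemma \<tau>_sc: "\<tau> n (b \<cdot> x) = b \<cdot> \<tau> n x"
  by (simp add: \<tau>_def sc_sum_right mult.commute)

lemma \<tau>_left: "y \<in> lev n \<Longrightarrow> \<tau> n (y * x) = y * \<tau> n x"
  by (simp add: \<tau>_def sum_distrib_left levD_left mult.assoc)

lemma \<tau>_right: "y \<in> lev n \<Longrightarrow> \<tau> n (x * y) = \<tau> n x * y"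
  by (simp add: \<tau>_def sum_distrib_right levD mult.assoc)

lemma \<tau>_lev:
  assumes x: "x \<in> lev (Suc n)" and e0: "\<And>a b. a \<notin> {1..N} \<or> b \<notin> {1..N} \<Longrightarrow> e n a b = 0"
  shows "\<tau> n x \<in> lev n"
  unfolding lev_def
proof (intro CollectI allI impI)
  fix k f c assume "n \<le> k"
  show "e k f c * \<tau> n x = \<tau> n x * e k f c"
  proof (cases "k = n")
    case True
    show ?thesis
    proof (cases "f \<in> {1..N} \<and> c \<in> {1..N}")
      case fc: True
      have "e n f c * \<tau> n x = (\<Sum>b\<in>{1..N}. if c = b then (\<Sum>a\<in>{1..N}. d a \<cdot> (e n f a * (x * e n a b))) else 0)"
        using fc unfolding \<tau>_def sum_distrib_left
        by (intro sum.cong refl) (auto simp: e_mult_left mult.assoc)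
      also have "\<dots> = (\<Sum>a\<in>{1..N}. d a \<cdot> (e n f a * (x * e n a c)))"
        using fc by simp
      also have "\<dots> = (\<Sum>b\<in>{1..N}. if b = f then (\<Sum>a\<in>{1..N}. d a \<cdot> (e n b a * (x * e n a c))) else 0)"
        using fc by simp
      also have "\<dots> = \<tau> n x * e n f c"
        using fc unfolding \<tau>_def sum_distrib_right
        by (intro sum.cong refl) (auto simp: e_mult mult.assoc)
      finally show ?thesis using True by simp
    qed (use e0 True in auto)
  next
    case False
    with \<open>n \<le> k\<close> have "e k f c * x = x * e k f c" by (intro levD[OF x]) auto
    then have *: "e k f c * (x * y) = x * (e k f c * y)" for y by (simp flip: mult.assoc)
    have **: "e k f c * (e n b a * y) = e n b a * (e k f c * y)" for a b y
      using e_comm[of k n f c b a] False by (simp flip: mult.assoc)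
    show ?thesis unfolding \<tau>_def sum_distrib_left sum_distrib_right
      using False by (intro sum.cong refl) (simp add: mult.assoc * ** e_comm[of n k])
  qed
qed

text \<open>For the basis vector \<open>c\<close> the trace is t d_c plus (t - 1/t) times the sum of
  the d_a with a > c, which telescopes to t d_N = 1.\<close>

lemma \<tau>_R: "\<tau> (Suc n) (R n) = 1"
proof (rule ket_ext)
  fix c assume c: "c \<in> {1..N}"
  let ?w = "\<lambda>a. if c = a then t else if c < a then t - inverse t else 0"
  have "e (Suc n) b a * (R n * (e (Suc n) a b * e n c c)) = ?w a \<cdot> (e n c c * e (Suc n) b b)"
    if "a \<in> {1..N}" "b \<in> {1..N}" for a b
    using c that R_ket[of c a n c b 1]
    by (auto simp: e_swap e_swap_left e_mult_left e_mult distrib_left)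
  then have "\<tau> (Suc n) (R n) * e n c c = (\<Sum>b\<in>{1..N}. \<Sum>a\<in>{1..N}. (d a * ?w a) \<cdot> (e n c c * e (Suc n) b b))"
    unfolding \<tau>_def sum_distrib_right by (intro sum.cong refl) (simp add: mult.assoc)
  also have "\<dots> = (\<Sum>a\<in>{1..N}. d a * ?w a) \<cdot> (e n c c * (\<Sum>b\<in>{1..N}. e (Suc n) b b))"
    by (simp only: sum_distrib_left sc_sum_right sc_sum_left)
  also have "(\<Sum>a\<in>{1..N}. d a * ?w a) = (\<Sum>a\<in>{1..N}. (if c = a then d c * t else 0) + (if a \<in> {c<..N} then (t - inverse t) * d a else 0))"
    by (intro sum.cong) auto
  also have "\<dots> = d c * t + (t - inverse t) * (\<Sum>a\<in>{c<..N}. d a)"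
  proof -
    have "{1..N} \<inter> {c<..N} = {c<..N}" by auto
    then show ?thesis using c by (simp add: sum.distrib sum_distrib_left sum.inter_restrict[symmetric] del: greaterThanAtMost_iff)
  qed
  also have "\<dots> = 1" using d_sum[of c N] c d_N by (simp add: algebra_simps)
  finally show "\<tau> (Suc n) (R n) * e n c c = 1 * e n c c" by (simp add: e_sum')
qed

lemma \<tau>2: "\<tau> n (\<tau> (Suc n) x) = (\<Sum>b\<in>{1..N}. \<Sum>b'\<in>{1..N}. \<Sum>a\<in>{1..N}. \<Sum>a'\<in>{1..N}.
    (d a * d a') \<cdot> (e n b a * (e (Suc n) b' a' * (x * (e n a b * e (Suc n) a' b')))))"
proof -
  have "\<tau> n (\<tau> (Suc n) x) = (\<Sum>b\<in>{1..N}. \<Sum>a\<in>{1..N}. \<Sum>b'\<in>{1..N}. \<Sum>a'\<in>{1..N}.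
    (d a * d a') \<cdot> (e n b a * (e (Suc n) b' a' * (x * (e n a b * e (Suc n) a' b')))))"
    unfolding \<tau>_def sum_distrib_right sum_distrib_left sc_sum_right
    by (intro sum.cong refl) (simp add: mult.assoc e_swap)
  then show ?thesis by (subst (2) sum.swap)
qed

lemma \<tau>_cyclic: "\<tau> n (\<tau> (Suc n) (R n * x)) = \<tau> n (\<tau> (Suc n) (x * R n))"
  unfolding \<tau>2
proof (rule sum.cong[OF refl], rule sum.cong[OF refl])
  fix b b' assume "b \<in> {1..N}" "b' \<in> {1..N}"
  let ?I = "{1..N}"
  let ?F = "\<lambda>c c' a a'. e n b c * (e (Suc n) b' c' * (x * (e n a b * e (Suc n) a' b')))"
  \<comment> \<open>D in both factors commutes with R, because R preserves the unordered pair of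
    indices.\<close>
  have D: "(d a * d a') * r a a' c c' = (d c * d c') * r a a' c c'" for a a' c c'
    by (auto simp: r_def)
  have "(\<Sum>a\<in>?I. \<Sum>a'\<in>?I. (d a * d a') \<cdot> (e n b a * (e (Suc n) b' a' * (R n * x * (e n a b * e (Suc n) a' b'))))) =
    (\<Sum>a\<in>?I. \<Sum>a'\<in>?I. \<Sum>c\<in>?I. \<Sum>c'\<in>?I. (d a * d a' * r a a' c c') \<cdot> ?F c c' a a')"
    by (intro sum.cong refl) (simp add: mult.assoc R_bra_sum sc_sum_right)
  also have "\<dots> = (\<Sum>a\<in>?I. \<Sum>c\<in>?I. \<Sum>a'\<in>?I. \<Sum>c'\<in>?I. (d a * d a' * r a a' c c') \<cdot> ?F c c' a a')"
    by (intro sum.cong refl sum.swap)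
  also have "\<dots> = (\<Sum>c\<in>?I. \<Sum>a\<in>?I. \<Sum>a'\<in>?I. \<Sum>c'\<in>?I. (d a * d a' * r a a' c c') \<cdot> ?F c c' a a')"
    by (rule sum.swap)
  also have "\<dots> = (\<Sum>c\<in>?I. \<Sum>a\<in>?I. \<Sum>c'\<in>?I. \<Sum>a'\<in>?I. (d a * d a' * r a a' c c') \<cdot> ?F c c' a a')"
    by (intro sum.cong refl sum.swap)
  also have "\<dots> = (\<Sum>c\<in>?I. \<Sum>c'\<in>?I. \<Sum>a\<in>?I. \<Sum>a'\<in>?I. (d a * d a' * r a a' c c') \<cdot> ?F c c' a a')"
    by (intro sum.cong refl sum.swap)
  also have "\<dots> = (\<Sum>c\<in>?I. \<Sum>c'\<in>?I. (d c * d c') \<cdot> (e n b c * (e (Suc n) b' c' * (x * R n * (e n c b * e (Suc n) c' b')))))"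
  proof (intro sum.cong refl)
    fix c c' assume "c \<in> ?I" "c' \<in> ?I"
    then have "R n * (e n c b * e (Suc n) c' b') = (\<Sum>a\<in>?I. \<Sum>a'\<in>?I. r a a' c c' \<cdot> (e n a b * e (Suc n) a' b'))"
      using R_ket_sum[of c c' n b b' 1] by simp
    then show "(\<Sum>a\<in>?I. \<Sum>a'\<in>?I. (d a * d a' * r a a' c c') \<cdot> ?F c c' a a') =
      (d c * d c') \<cdot> (e n b c * (e (Suc n) b' c' * (x * R n * (e n c b * e (Suc n) c' b'))))"
      by (simp add: mult.assoc sum_distrib_left sc_sum_right)
        (intro sum.cong refl arg_cong2[of _ _ _ _ sc] D[unfolded mult.assoc])
  qed
  finally show "(\<Sum>a\<in>?I. \<Sum>a'\<in>?I. (d a * d a') \<cdot> (e n b a * (e (Suc n) b' a' * (R n * x * (e n a b * e (Suc n) a' b'))))) =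
    (\<Sum>a\<in>?I. \<Sum>a'\<in>?I. (d a * d a') \<cdot> (e n b a * (e (Suc n) b' a' * (x * R n * (e n a b * e (Suc n) a' b')))))" .
qed

text \<open>\<open>\<alpha> a c\<close> and, below, \<open>\<beta> a c\<close> are the diagonal
  entries of R and of its inverse at the basis vector with \<open>c\<close> in the first and
  \<open>a\<close> in the second of the two factors.\<close>

definition \<alpha> :: "nat \<Rightarrow> nat \<Rightarrow> 'k" where
  "\<alpha> a c = (if c = a then t else if c < a then t - inverse t else 0)"

definition \<beta> :: "nat \<Rightarrow> nat \<Rightarrow> 'k" where
  "\<beta> a c = (if c = a then inverse t else if a < c then - (t - inverse t) else 0)"

text \<open>For c < c' the boundary terms a = c and a = c' cancel against the telescoping sum
  between them; for c > c' every summand vanishes.\<close>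

lemma \<alpha>_\<beta>_sum:
  assumes "c \<in> {1..N}" "c' \<in> {1..N}"
  shows "(\<Sum>a\<in>{1..N}. d a * \<alpha> a c * \<beta> a c') = (if c = c' then d c else 0)"
proof (cases c c' rule: linorder_cases)
  case less
  let ?l = "t - inverse t"
  have "(\<Sum>a\<in>{1..N}. d a * \<alpha> a c * \<beta> a c') = (\<Sum>a\<in>{1..N}. (if c = a then - (t * ?l * d c) else 0) +
      (if c' = a then ?l * inverse t * d c' else 0) + (if a \<in> {c<..c' - 1} then - (?l * ?l * d a) else 0))"
    using less by (intro sum.cong) (auto simp: \<alpha>_def \<beta>_def algebra_simps)
  also have "\<dots> = - (t * ?l * d c) + ?l * inverse t * d c' - ?l * (?l * (\<Sum>a\<in>{c<..c' - 1}. d a))"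
  proof -
    have "{1..N} \<inter> {c<..c' - 1} = {c<..c' - 1}" using assms by auto
    then show ?thesis using assms
      by (simp add: sum.distrib sum_distrib_left sum.inter_restrict[symmetric] sum_negf mult.assoc del: greaterThanAtMost_iff)
  qed
  also have "\<dots> = 0"
  proof -
    have "d c' = t * t * d (c' - 1)" using less by (cases c') (simp_all add: d_def)
    moreover have "?l * (\<Sum>a\<in>{c<..c' - 1}. d a) = t * d (c' - 1) - t * d c" using d_sum[of c "c' - 1"] less by simp
    ultimately have "- (t * ?l * d c) + ?l * inverse t * d c' - ?l * (?l * (\<Sum>a\<in>{c<..c' - 1}. d a)) =
        - (t * ?l * d c) + ?l * (t * d (c' - 1)) - ?l * (t * d (c' - 1) - t * d c)"
      by (simp only: mult.assoc t_cancel)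
    also have "\<dots> = 0" by (simp add: right_diff_distrib left_diff_distrib mult_ac)
    finally show ?thesis .
  qed
  finally show ?thesis using less by simp
next
  case equal
  then have "d a * \<alpha> a c * \<beta> a c' = (if c = a then d c else 0)" for a
    using t_nz by (simp add: \<alpha>_def \<beta>_def)
  then show ?thesis using assms equal by simp
next
  case greater
  then have "d a * \<alpha> a c * \<beta> a c' = 0" for a
    by (simp add: \<alpha>_def \<beta>_def)
  then have "(\<Sum>a\<in>{1..N}. d a * \<alpha> a c * \<beta> a c') = 0" by (intro sum.neutral ballI)
  then show ?thesis using greater by simp
qed

text \<open>R and its inverse both split into a diagonal and a flip part. Since \<open>x\<close>
  does not involve factor \<open>Suc n\<close>, a product of one part of each kind has mismatched
  matrix units there and vanishes. The diagonal parts give, through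
  \<open>\<alpha>_\<beta>_sum\<close>, the terms of \<open>\<tau> n x\<close> with equal indices,
  and the flip parts those with different ones.\<close>

lemma \<tau>_conj:
  assumes x: "x \<in> lev (Suc n)"
  shows "\<tau> (Suc n) (R n * x * ginv n) = \<tau> n x"
proof -
  let ?I = "{1..N}"
  have bra: "e (Suc n) b a * R n = (\<Sum>c\<in>?I. \<alpha> a c \<cdot> (e n c c * e (Suc n) b a) + (if c = a then 0 else e n c a * e (Suc n) b c))"
    if "a \<in> ?I" for a b
  proof -
    have "e (Suc n) b a * R n = (\<Sum>c\<in>?I. e n c c) * (e (Suc n) b a * R n)" by (simp only: e_sum mult_1_left)
    also have "\<dots> = (\<Sum>c\<in>?I. e n c c * (e (Suc n) b a * (R n * 1)))" by (simp add: sum_distrib_right)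
    finally show ?thesis using that by (subst (asm) sum.cong[OF refl R_bra]) (auto simp: \<alpha>_def intro!: sum.cong)
  qed
  have ket: "ginv n * e (Suc n) a b = (\<Sum>c\<in>?I. \<beta> a c \<cdot> (e n c c * e (Suc n) a b) + (if c = a then 0 else e n a c * e (Suc n) c b))"
    if "a \<in> ?I" for a b
  proof -
    have "ginv n * e (Suc n) a b = ginv n * ((\<Sum>c\<in>?I. e n c c) * e (Suc n) a b)" by (simp only: e_sum mult_1_left)
    also have "\<dots> = (\<Sum>c\<in>?I. R n * (e n c c * (e (Suc n) a b * 1)) - (t - inverse t) \<cdot> (e n c c * e (Suc n) a b))"
      by (simp add: sum_distrib_right sum_distrib_left ginv_def left_diff_distrib)
    also have "\<dots> = (\<Sum>c\<in>?I. \<beta> a c \<cdot> (e n c c * e (Suc n) a b) + (if c = a then 0 else e n a c * e (Suc n) c b))"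
      using that by (intro sum.cong refl) (auto simp: R_ket[of _ _ n _ _ 1, simplified] \<beta>_def sc_diff_left algebra_simps)
    finally show ?thesis .
  qed
  have mv: "(p * e (Suc n) b y) * x * (p' * e (Suc n) y' b) = (if y = y' then p * x * p' * e (Suc n) b b else 0)"
    if "y \<in> ?I" "p' \<in> lev (Suc n)" for p p' b y y'
    using that x by (simp add: mult.assoc levD_left e_mult)
  have prod: "e (Suc n) b a * (R n * x * ginv n) * e (Suc n) a b =
      (\<Sum>c\<in>?I. \<Sum>c'\<in>?I. (\<alpha> a c * \<beta> a c') \<cdot> (e n c c * x * e n c' c') * e (Suc n) b b +
         (if c = c' \<and> c \<noteq> a then e n c a * x * e n a c * e (Suc n) b b else 0))"
    if ab: "a \<in> ?I" "b \<in> ?I" for a b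
  proof -
    have "e (Suc n) b a * (R n * x * ginv n) * e (Suc n) a b = (e (Suc n) b a * R n) * x * (ginv n * e (Suc n) a b)"
      by (simp add: mult.assoc)
    also have "\<dots> = (\<Sum>c\<in>?I. \<Sum>c'\<in>?I. (\<alpha> a c \<cdot> (e n c c * e (Suc n) b a) + (if c = a then 0 else e n c a * e (Suc n) b c)) * x *
          (\<beta> a c' \<cdot> (e n c' c' * e (Suc n) a b) + (if c' = a then 0 else e n a c' * e (Suc n) c' b)))"
      unfolding bra[OF ab(1)] ket[OF ab(1)] by (simp only: sum_distrib_right[of _ _ x] sum_product)
    also have "\<dots> = (\<Sum>c\<in>?I. \<Sum>c'\<in>?I. (\<alpha> a c * \<beta> a c') \<cdot> (e n c c * x * e n c' c') * e (Suc n) b b +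
         (if c = c' \<and> c \<noteq> a then e n c a * x * e n a c * e (Suc n) b b else 0))"
    proof (intro sum.cong refl)
      fix c c' assume cc: "c \<in> ?I" "c' \<in> ?I"
      have "(e n u v * e (Suc n) b y) * x * (e n u' v' * e (Suc n) y' b) = (if y = y' then e n u v * x * e n u' v' * e (Suc n) b b else 0)"
        if "y \<in> ?I" for u v u' v' y y'
        using that by (intro mv e_lev) auto
      then show "(\<alpha> a c \<cdot> (e n c c * e (Suc n) b a) + (if c = a then 0 else e n c a * e (Suc n) b c)) * x *
          (\<beta> a c' \<cdot> (e n c' c' * e (Suc n) a b) + (if c' = a then 0 else e n a c' * e (Suc n) c' b)) =
          (\<alpha> a c * \<beta> a c') \<cdot> (e n c c * x * e n c' c') * e (Suc n) b b +
         (if c = c' \<and> c \<noteq> a then e n c a * x * e n a c * e (Suc n) b b else 0)"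
        using cc ab by (simp add: distrib_left distrib_right mult.commute[of "\<beta> _ _"])
    qed
    finally show ?thesis .
  qed
  let ?P = "\<lambda>a c c'. (\<alpha> a c * \<beta> a c') \<cdot> (e n c c * x * e n c' c') + (if c = c' \<and> c \<noteq> a then e n c a * x * e n a c else 0)"
  have "\<tau> (Suc n) (R n * x * ginv n) = (\<Sum>b\<in>?I. \<Sum>a\<in>?I. d a \<cdot> (\<Sum>c\<in>?I. \<Sum>c'\<in>?I. ?P a c c') * e (Suc n) b b)"
    unfolding \<tau>_def by (intro sum.cong refl) (simp add: prod sum_distrib_right distrib_right if_distrib[of "\<lambda>u. u * _"] cong: if_cong)
  also have "\<dots> = (\<Sum>a\<in>?I. d a \<cdot> (\<Sum>c\<in>?I. \<Sum>c'\<in>?I. ?P a c c')) * (\<Sum>b\<in>?I. e (Suc n) b b)"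
    by (simp only: sum_distrib_right sum_distrib_left)
  also have "\<dots> = (\<Sum>a\<in>?I. d a \<cdot> (\<Sum>c\<in>?I. \<Sum>c'\<in>?I. ?P a c c'))" by (simp only: e_sum mult_1_right)
  also have "\<dots> = (\<Sum>a\<in>?I. \<Sum>c\<in>?I. \<Sum>c'\<in>?I. (d a * \<alpha> a c * \<beta> a c') \<cdot> (e n c c * x * e n c' c')) +
     (\<Sum>a\<in>?I. \<Sum>c\<in>?I. \<Sum>c'\<in>?I. if c' = c then (if c = a then 0 else d a \<cdot> (e n c a * x * e n a c)) else 0)"
    unfolding sum.distrib[symmetric] sc_sum_right
    by (intro sum.cong refl) (auto simp: sc_add_right mult.assoc)
  also have "(\<Sum>a\<in>?I. \<Sum>c\<in>?I. \<Sum>c'\<in>?I. if c' = c then (if c = a then 0 else d a \<cdot> (e n c a * x * e n a c)) else 0) =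
     (\<Sum>a\<in>?I. \<Sum>c\<in>?I. (if c = a then 0 else d a \<cdot> (e n c a * x * e n a c)))"
    by (intro sum.cong refl) simp
  also have "(\<Sum>a\<in>?I. \<Sum>c\<in>?I. \<Sum>c'\<in>?I. (d a * \<alpha> a c * \<beta> a c') \<cdot> (e n c c * x * e n c' c')) =
     (\<Sum>c\<in>?I. \<Sum>a\<in>?I. \<Sum>c'\<in>?I. (d a * \<alpha> a c * \<beta> a c') \<cdot> (e n c c * x * e n c' c'))"
    by (rule sum.swap)
  also have "\<dots> = (\<Sum>c\<in>?I. \<Sum>c'\<in>?I. \<Sum>a\<in>?I. (d a * \<alpha> a c * \<beta> a c') \<cdot> (e n c c * x * e n c' c'))"
    by (intro sum.cong refl sum.swap)
  also have "\<dots> = (\<Sum>c\<in>?I. \<Sum>c'\<in>?I. if c' = c then d c \<cdot> (e n c c * x * e n c c) else 0)"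
  proof (intro sum.cong refl)
    fix c c' assume "c \<in> ?I" "c' \<in> ?I"
    then show "(\<Sum>a\<in>?I. (d a * \<alpha> a c * \<beta> a c') \<cdot> (e n c c * x * e n c' c')) =
        (if c' = c then d c \<cdot> (e n c c * x * e n c c) else 0)"
      unfolding sc_sum_left[symmetric] by (subst \<alpha>_\<beta>_sum) auto
  qed
  also have "\<dots> = (\<Sum>c\<in>?I. d c \<cdot> (e n c c * x * e n c c))" by simp
  also have "\<dots> = (\<Sum>c\<in>?I. \<Sum>a\<in>?I. if a = c then d a \<cdot> (e n c a * x * e n a c) else 0)" by simp
  also have "(\<Sum>a\<in>?I. \<Sum>c\<in>?I. (if c = a then 0 else d a \<cdot> (e n c a * x * e n a c))) =
    (\<Sum>c\<in>?I. \<Sum>a\<in>?I. (if c = a then 0 else d a \<cdot> (e n c a * x * e n a c)))"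
    by (rule sum.swap)
  also have "(\<Sum>c\<in>?I. \<Sum>a\<in>?I. if a = c then d a \<cdot> (e n c a * x * e n a c) else 0) + \<dots> = \<tau> n x"
    unfolding \<tau>_def sum.distrib[symmetric] by (intro sum.cong refl) auto
  finally show ?thesis .
qed

fun Xs :: "'r \<Rightarrow> nat \<Rightarrow> 'r" where
  "Xs x 0 = x"
| "Xs x (Suc i) = R i * Xs x i * ginv i"

lemma markov:
  assumes "x \<in> lev 1"
    and "\<And>n a b. a \<notin> {1..N} \<or> b \<notin> {1..N} \<Longrightarrow> e n a b = 0"
    and "\<And>j. (R 0 + inverse t \<cdot> 1) * ((x + s j \<cdot> 1) * (Xs x 1 + s (Suc j) \<cdot> 1)) * (R 0 - t \<cdot> 1) = 0"
  shows "markov_tower sc t R (Xs x) lev \<tau> s \<delta>"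
proof unfold_locales
  have "R (Suc i) * x = x * R (Suc i)" for i
    unfolding R_def sum_distrib_left sum_distrib_right
    by (intro sum.cong refl) (simp add: mult.assoc levD_left[OF assms(1)] levD[OF assms(1)])
  then show "R (Suc i) * Xs x 0 = Xs x 0 * R (Suc i)" for i by simp
  show "\<tau> n y \<in> lev n" if "y \<in> lev (Suc n)" for n y
    using that by (rule \<tau>_lev) (rule assms(2))
qed (use assms(1,3) in \<open>simp_all add: R_lev \<tau>_add \<tau>_sc \<tau>_left \<tau>_right \<tau>_one \<tau>_R \<tau>_conj \<tau>_cyclic
    lev_add lev_mult lev_sc\<close>, auto simp: lev_def)

end

section \<open>Quotient rings and operators on tensor powers\<close>

definition tsideal :: "'f::ring_1 set \<Rightarrow> bool" where
  "tsideal I \<longleftrightarrow> 0 \<in> I \<and> (\<forall>x\<in>I. \<forall>y\<in>I. x + y \<in> I) \<and> (\<forall>x\<in>I. \<forall>a. a * x \<in> I \<and> x * a \<in> I)"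

lemma tsidealD:
  assumes "tsideal I"
  shows "0 \<in> I" "x \<in> I \<Longrightarrow> y \<in> I \<Longrightarrow> x + y \<in> I" "x \<in> I \<Longrightarrow> a * x \<in> I" "x \<in> I \<Longrightarrow> x * a \<in> I"
    "x \<in> I \<Longrightarrow> - x \<in> I"
proof -
  show "x \<in> I \<Longrightarrow> - x \<in> I"
    using assms by (metis mult_minus1 tsideal_def)
qed (use assms in \<open>auto simp: tsideal_def\<close>)

(* The product, over all two-sided ideals I, of the quotients by I.  The type is independent of the
   ideal, so that quotients by ideals that depend on parameters become subrings of one type. *)
quotient_type (overloaded) 'f quotients = "'f::ring_1 set \<Rightarrow> 'f" / "\<lambda>f h. \<forall>I. tsideal I \<longrightarrow> f I - h I \<in> I"
proof (rule equivpI)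
  show "reflp (\<lambda>f h :: 'f set \<Rightarrow> 'f. \<forall>I. tsideal I \<longrightarrow> f I - h I \<in> I)"
    by (intro reflpI allI impI) (simp add: tsidealD(1))
  show "symp (\<lambda>f h :: 'f set \<Rightarrow> 'f. \<forall>I. tsideal I \<longrightarrow> f I - h I \<in> I)"
  proof (intro sympI allI impI)
    fix f h :: "'f set \<Rightarrow> 'f" and I :: "'f set"
    assume "\<forall>I. tsideal I \<longrightarrow> f I - h I \<in> I" "tsideal I"
    then have "- (f I - h I) \<in> I" by (intro tsidealD) auto
    then show "h I - f I \<in> I" by simp
  qed
  show "transp (\<lambda>f h :: 'f set \<Rightarrow> 'f. \<forall>I. tsideal I \<longrightarrow> f I - h I \<in> I)"
  proof (intro transpI allI impI)
    fix f g h :: "'f set \<Rightarrow> 'f" and I :: "'f set"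
    assume "\<forall>I. tsideal I \<longrightarrow> f I - g I \<in> I" "\<forall>I. tsideal I \<longrightarrow> g I - h I \<in> I" "tsideal I"
    then have "(f I - g I) + (g I - h I) \<in> I" by (intro tsidealD) auto
    then show "f I - h I \<in> I" by simp
  qed
qed

instantiation quotients :: (ring_1) ring_1
begin

lift_definition zero_quotients :: "'a quotients" is "\<lambda>_. 0" .
lift_definition one_quotients :: "'a quotients" is "\<lambda>_. 1" .
lift_definition plus_quotients :: "'a quotients \<Rightarrow> 'a quotients \<Rightarrow> 'a quotients" is "\<lambda>f h I. f I + h I"
proof goal_cases
  case (1 f f' h h' I)
  then have "(f I - f' I) + (h I - h' I) \<in> I" by (intro tsidealD) auto
  then show "f I + h I - (f' I + h' I) \<in> I" by (simp add: algebra_simps)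
qed
lift_definition times_quotients :: "'a quotients \<Rightarrow> 'a quotients \<Rightarrow> 'a quotients" is "\<lambda>f h I. f I * h I"
proof goal_cases
  case (1 f f' h h' I)
  then have "(f I - f' I) * h I + f' I * (h I - h' I) \<in> I" by (intro tsidealD) auto
  then show "f I * h I - f' I * h' I \<in> I" by (simp add: algebra_simps)
qed
lift_definition uminus_quotients :: "'a quotients \<Rightarrow> 'a quotients" is "\<lambda>f I. - f I"
proof goal_cases
  case (1 f f' I)
  then have "- (f I - f' I) \<in> I" by (intro tsidealD) auto
  then show "- f I - - f' I \<in> I" by simp
qed
definition minus_quotients :: "'a quotients \<Rightarrow> 'a quotients \<Rightarrow> 'a quotients" where
  "minus_quotients x y = x + - y"

instance
proof
  \<comment> \<open>The component at the zero ideal is the ring itself, although other components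
    may be trivial.\<close>
  show "0 \<noteq> (1 :: 'a quotients)"
  proof
    assume "0 = (1 :: 'a quotients)"
    moreover have "tsideal {0 :: 'a}" by (simp add: tsideal_def)
    ultimately have "0 - 1 \<in> {0 :: 'a}" by transfer blast
    then show False by simp
  qed
qed (unfold minus_quotients_def, (transfer, simp add: algebra_simps tsidealD(1))+)

end

(* The homomorphism \<epsilon> fills the components other than I, so that the map into the product is unital. *)
definition quotient_at :: "'f::ring_1 set \<Rightarrow> ('f \<Rightarrow> 'f) \<Rightarrow> 'f \<Rightarrow> 'f quotients" where
  "quotient_at I \<epsilon> p = abs_quotients (\<lambda>J. if J = I then p else \<epsilon> p)"

lemma quotient_at_eqD:
  assumes "tsideal I" "quotient_at I \<epsilon> p = quotient_at I \<epsilon> p'"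
  shows "p - p' \<in> I"
  using assms by (auto simp: quotient_at_def quotients.abs_eq_iff dest!: spec[of _ I])

lemma quotient_at_zero:
  assumes "tsideal I" "p \<in> I" "\<epsilon> p = 0"
  shows "quotient_at I \<epsilon> p = 0"
  using assms by (auto simp: quotient_at_def zero_quotients_def quotients.abs_eq_iff tsidealD)

lemma quotient_at_hom:
  shows "\<epsilon> (p + p') = \<epsilon> p + \<epsilon> p' \<Longrightarrow> quotient_at I \<epsilon> (p + p') = quotient_at I \<epsilon> p + quotient_at I \<epsilon> p'"
    and "\<epsilon> (p * p') = \<epsilon> p * \<epsilon> p' \<Longrightarrow> quotient_at I \<epsilon> (p * p') = quotient_at I \<epsilon> p * quotient_at I \<epsilon> p'"
    and "\<epsilon> 1 = 1 \<Longrightarrow> quotient_at I \<epsilon> 1 = 1"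
  by (auto simp: quotient_at_def plus_quotients.abs_eq times_quotients.abs_eq one_quotients_def
      intro!: arg_cong[of _ _ abs_quotients])

text \<open>As \<open>\<epsilon>\<close> fixes \<open>z\<close>, every component of the family is
  \<open>z\<close>, so it commutes in all components.\<close>

lemma quotient_at_central:
  assumes "\<And>p. z * p = p * z" "\<epsilon> z = z"
  shows "quotient_at I \<epsilon> z * x = x * quotient_at I \<epsilon> z"
proof -
  have "quotient_at I \<epsilon> z = abs_quotients (\<lambda>_. z)"
    unfolding quotient_at_def assms(2) if_cancel ..
  then show ?thesis using assms(1)
    by (induction x rule: quotients.abs_induct) (simp add: times_quotients.abs_eq)
qed

(* Additive endomorphisms of the space of functions (nat => nat) => 'a, an infinite tensor power of
   countably generated free modules; a tensor factor is a coordinate of the argument. *)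
typedef (overloaded) 'a endo = "{f :: ((nat \<Rightarrow> nat) \<Rightarrow> 'a::ring_1) \<Rightarrow> (nat \<Rightarrow> nat) \<Rightarrow> 'a.
    (\<forall>x y. f (\<lambda>J. x J + y J) = (\<lambda>J. f x J + f y J)) \<and> (\<forall>x a. f (\<lambda>J. x J * a) = (\<lambda>J. f x J * a))}"
  by (intro exI[of _ id]) simp

setup_lifting type_definition_endo

instantiation endo :: (ring_1) ring_1
begin

lift_definition zero_endo :: "'a endo" is "\<lambda>_ _. 0" by simp
lift_definition one_endo :: "'a endo" is "\<lambda>x. x" by simp
lift_definition plus_endo :: "'a endo \<Rightarrow> 'a endo \<Rightarrow> 'a endo" is "\<lambda>f h x J. f x J + h x J" by (simp add: algebra_simps)
lift_definition times_endo :: "'a endo \<Rightarrow> 'a endo \<Rightarrow> 'a endo" is "\<lambda>f h x. f (h x)" by simp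
lift_definition uminus_endo :: "'a endo \<Rightarrow> 'a endo" is "\<lambda>f x J. - f x J" by simp
definition minus_endo :: "'a endo \<Rightarrow> 'a endo \<Rightarrow> 'a endo" where
  "minus_endo x y = x + - y"

instance
proof
  show "0 \<noteq> (1 :: 'a endo)"
  proof transfer
    show "(\<lambda>(x :: (nat \<Rightarrow> nat) \<Rightarrow> 'a) (J :: nat \<Rightarrow> nat). 0) \<noteq> (\<lambda>x. x)"
      using fun_cong[OF fun_cong, of "\<lambda>_ _. 0" "\<lambda>x. x" "\<lambda>_. 1 :: 'a"] by auto
  qed
qed (unfold minus_endo_def, (transfer, simp add: fun_eq_iff algebra_simps)+)

end

lift_definition lmult :: "'a::ring_1 \<Rightarrow> 'a endo" is "\<lambda>a x J. a * x J"
  by (simp add: distrib_left mult.assoc)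

lemma lmult_hom: "lmult (a + b) = lmult a + lmult b" "lmult (a * b) = lmult a * lmult b" "lmult 1 = 1"
    "lmult 0 = 0" "lmult (- a) = - lmult a"
  by (transfer, simp add: distrib_right mult.assoc)+

lemma lmult_inj: "lmult a = lmult b \<Longrightarrow> a = b"
proof transfer
  fix a b :: 'a
  assume "(\<lambda>x J. a * x J) = (\<lambda>(x :: (nat \<Rightarrow> nat) \<Rightarrow> 'a) J. b * x J)"
  from fun_cong[OF fun_cong[OF this, of "\<lambda>_. 1"]] show "a = b" by simp
qed

(* In the n-th factor, the index j stands for the basis vector number j mod N + 1, with multiplicity
   label j div N. *)
lift_definition eunit :: "nat \<Rightarrow> nat \<Rightarrow> nat \<Rightarrow> nat \<Rightarrow> 'a::ring_1 endo" is
  "\<lambda>N n a b x J. if a \<in> {1..N} \<and> b \<in> {1..N} \<and> J n mod N = a - 1 then x (J(n := J n div N * N + (b - 1))) else 0"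
  by auto

lemma eunit_out: "a \<notin> {1..N} \<or> b \<notin> {1..N} \<Longrightarrow> eunit N n a b = 0"
  by transfer auto

lemma eunit_same: "b \<in> {1..N} \<Longrightarrow> eunit N n a b * eunit N n b c = eunit N n a c"
proof (transfer, intro ext)
  fix N b n a c :: nat and x :: "(nat \<Rightarrow> nat) \<Rightarrow> 'a" and J :: "nat \<Rightarrow> nat"
  assume b: "b \<in> {1..N}"
  then have "b - 1 < N" by simp linarith
  then have "(J n div N * N + (b - 1)) mod N = b - 1" "(J n div N * N + (b - 1)) div N = J n div N"
    by (simp_all only: mod_mult_self3 mod_less div_mult_self3 div_less add_0_right)
  then show "(if a \<in> {1..N} \<and> b \<in> {1..N} \<and> J n mod N = a - 1
        then if b \<in> {1..N} \<and> c \<in> {1..N} \<and> (J(n := J n div N * N + (b - 1))) n mod N = b - 1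
          then x ((J(n := J n div N * N + (b - 1)))(n := (J(n := J n div N * N + (b - 1))) n div N * N + (c - 1)))
          else 0 else 0) =
      (if a \<in> {1..N} \<and> c \<in> {1..N} \<and> J n mod N = a - 1 then x (J(n := J n div N * N + (c - 1))) else 0)"
    using b by (simp only: fun_upd_same fun_upd_upd simp_thms)
      (cases "a \<in> {1..N} \<and> J n mod N = a - 1"; cases "c \<in> {1..N}"; simp only: simp_thms if_True if_False)
qed

lemma eunit_diff: "b \<noteq> b' \<Longrightarrow> eunit N n a b * eunit N n b' c = 0"
proof (transfer, intro ext)
  fix b b' N n a c :: nat and x :: "(nat \<Rightarrow> nat) \<Rightarrow> 'a" and J :: "nat \<Rightarrow> nat"
  assume "b \<noteq> b'"
  then have "\<not> (J n div N * N + (b - 1)) mod N = b' - 1" if "b \<in> {1..N}" "b' \<in> {1..N}"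
  proof -
    have "b - 1 < N" using that by auto
    then have "(J n div N * N + (b - 1)) mod N = b - 1" by (simp only: mod_mult_self3 mod_less)
    moreover have "b - 1 \<noteq> b' - 1" using that \<open>b \<noteq> b'\<close> by (simp add: eq_diff_iff)
    ultimately show ?thesis by (simp only: not_False_eq_True)
  qed
  then show "(if a \<in> {1..N} \<and> b \<in> {1..N} \<and> J n mod N = a - 1
        then if b' \<in> {1..N} \<and> c \<in> {1..N} \<and> (J(n := J n div N * N + (b - 1))) n mod N = b' - 1
          then x ((J(n := J n div N * N + (b - 1)))(n := (J(n := J n div N * N + (b - 1))) n div N * N + (c - 1)))
          else 0 else 0) = 0"
    by (simp only: fun_upd_same split: if_split) blast
qed

lemma eunit_comm: "m \<noteq> n \<Longrightarrow> eunit N m a b * eunit N n c d = eunit N n c d * eunit N m a b"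
  by (transfer, intro ext) (simp add: fun_upd_twist)

lemma eunit_lmult: "eunit N n a b * lmult (x :: 'a::ring_1) = lmult x * eunit N n a b"
  by (transfer, intro ext) simp

lemma Rep_endo_sum: "Rep_endo (\<Sum>a\<in>A. f a) x J = (\<Sum>a\<in>A. Rep_endo (f a) x J)"
  by (induction A rule: infinite_finite_induct) (simp_all add: zero_endo.rep_eq plus_endo.rep_eq)

lemma eunit_sum:
  assumes "N \<ge> 1"
  shows "(\<Sum>a\<in>{1..N}. eunit N n a a) = (1 :: 'a::ring_1 endo)"
proof -
  have "Rep_endo (\<Sum>a\<in>{1..N}. eunit N n a a) x J = Rep_endo 1 x J" for x J
  proof -
    have "Rep_endo (\<Sum>a\<in>{1..N}. eunit N n a a) x J = (\<Sum>a\<in>{1..N}. if a = J n mod N + 1 then x J else 0)"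
      unfolding Rep_endo_sum by (intro sum.cong refl) (auto simp: eunit.rep_eq)
    then show ?thesis using assms by (simp add: one_endo.rep_eq Suc_leI)
  qed
  then show ?thesis by (intro iffD1[OF Rep_endo_inject] ext)
qed

text \<open>Elements of \<open>endo\<close> are compatible with right multiplications, and left
  multiplication by a central \<open>z\<close> is one of these.\<close>

lemma lmult_central:
  assumes "\<And>y. z * y = y * z"
  shows "lmult z * x = x * lmult z"
proof -
  have "Rep_endo x (\<lambda>J. v J * z) = (\<lambda>J. Rep_endo x v J * z)" for v
    using Rep_endo[of x] by blast
  then have "Rep_endo (lmult z * x) v = Rep_endo (x * lmult z) v" for v
    unfolding times_endo.rep_eq lmult.rep_eq assms by simp
  then show ?thesis by (intro iffD1[OF Rep_endo_inject] ext) simp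
qed

section \<open>Linear extension from monomials\<close>

abbreviation "keys \<equiv> Poly_Mapping.keys"
abbreviation "lookup \<equiv> Poly_Mapping.lookup"

lemma single_induct [case_names zero add]:
  assumes "P 0" and "\<And>a c p. P p \<Longrightarrow> P (Poly_Mapping.single a c + p)"
  shows "P (p :: 'm \<Rightarrow>\<^sub>0 'k::ab_group_add)"
proof (induction "card (keys p)" arbitrary: p)
  case 0
  then have "p = 0" by simp
  then show ?case using assms(1) by simp
next
  case (Suc n)
  then obtain a where a: "a \<in> keys p" by fastforce
  let ?p = "p - Poly_Mapping.single a (lookup p a)"
  have "keys ?p = keys p - {a}"
    by (auto simp: in_keys_iff lookup_minus lookup_single when_def split: if_splits)
  then have "P ?p" using Suc a by (intro Suc(1)) simp
  from assms(2)[OF this, of a "lookup p a"] show ?case by simp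
qed

text \<open>One construction for several maps: substitution in polynomials, restriction and
  augmentation of free algebras, and evaluation of Hecke words. It is multiplicative when
  \<open>F\<close> is and \<open>c\<close> embeds the scalars centrally.\<close>

definition plin :: "('k::comm_ring_1 \<Rightarrow> 'r::ring_1) \<Rightarrow> ('m::monoid_add \<Rightarrow> 'r) \<Rightarrow> ('m \<Rightarrow>\<^sub>0 'k) \<Rightarrow> 'r" where
  "plin c F p = (\<Sum>w\<in>keys p. c (lookup p w) * F w)"

locale central_hom =
  fixes c :: "'k::comm_ring_1 \<Rightarrow> 'r::ring_1"
  assumes c_add: "c (x + y) = c x + c y"
    and c_mult: "c (x * y) = c x * c y"
    and c_one: "c 1 = 1"
    and c_central: "c x * z = z * c x"
begin

lemma c_zero: "c 0 = 0"
  using c_add[of 0 0] by simp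

lemma c_minus: "c (- x) = - c x"
  using c_add[of x "- x"] by (simp add: c_zero eq_neg_iff_add_eq_0 add.commute)

lemma plin_superset:
  "finite A \<Longrightarrow> keys p \<subseteq> A \<Longrightarrow> plin c F p = (\<Sum>w\<in>A. c (lookup p w) * F w)"
  unfolding plin_def by (intro sum.mono_neutral_left) (auto simp: in_keys_iff c_zero)

lemma plin_add: "plin c F (p + p') = plin c F p + plin c F p'"
proof -
  let ?A = "keys p \<union> keys p'"
  have "keys (p + p') \<subseteq> ?A" by (rule Poly_Mapping.keys_add)
  then show ?thesis
    by (simp add: plin_superset[of ?A] lookup_add c_add distrib_right sum.distrib)
qed

lemma plin_single: "plin c F (Poly_Mapping.single a x) = c x * F a"
  by (subst plin_superset[of "{a}"]) auto

lemma plin_zero: "plin c F 0 = 0"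
  by (simp add: plin_def)

lemma plin_mult:
  assumes "\<And>a b. F (a + b) = F a * F b"
  shows "plin c F (p * p') = plin c F p * plin c F p'"
proof (induction p rule: single_induct)
  case (add a x p)
  have "plin c F (Poly_Mapping.single a x * p') = c x * F a * plin c F p'"
  proof (induction p' rule: single_induct)
    case (add b y p')
    have "c (x * y) * (F a * F b) = (c x * F a) * (c y * F b)"
      by (metis c_central c_mult mult.assoc)
    then show ?case using add by (simp add: distrib_left plin_add plin_single mult_single assms)
  qed (simp add: plin_zero)
  then show ?case using add by (simp add: distrib_right plin_add plin_single)
qed (simp add: plin_zero)

lemma plin_one: "F 0 = 1 \<Longrightarrow> plin c F 1 = 1"
  using plin_single[of F 0 1] by (simp add: c_one)

end

lemma scal_add: "scal (a + b) = scal a + scal b"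
  and scal_mult: "scal (a * b) = scal a * (scal b :: 'm::monoid_add \<Rightarrow>\<^sub>0 'k::comm_ring_1)"
  and scal_one: "scal 1 = (1 :: 'm \<Rightarrow>\<^sub>0 'k)"
  and scal_zero: "scal 0 = (0 :: 'm \<Rightarrow>\<^sub>0 'k)"
  by (simp_all add: scal_def single_add mult_single)

lemma scal_central: "scal a * p = p * (scal a :: 'm::monoid_add \<Rightarrow>\<^sub>0 'k::comm_ring_1)"
  by (induction p rule: single_induct) (simp_all add: scal_def distrib_left distrib_right mult_single mult.commute)

interpretation scal: central_hom "scal :: 'k::comm_ring_1 \<Rightarrow> 'm::monoid_add \<Rightarrow>\<^sub>0 'k"
  by unfold_locales (rule scal_add scal_mult scal_one scal_central)+

lemma psubst_alt:
  "psubst \<sigma> = plin scal (\<lambda>\<mu>. \<Prod>i\<in>keys \<mu>. \<sigma> i ^ lookup \<mu> i)"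
  by (simp add: psubst_def plin_def fun_eq_iff)

lemma monomial_superset:
  "finite A \<Longrightarrow> keys \<mu> \<subseteq> A \<Longrightarrow> (\<Prod>i\<in>keys \<mu>. \<sigma> i ^ lookup \<mu> i) = (\<Prod>i\<in>A. \<sigma> i ^ lookup \<mu> i)"
  for \<sigma> :: "nat \<Rightarrow> 'a::comm_monoid_mult"
  by (intro prod.mono_neutral_left) (auto simp: in_keys_iff)

lemma monomial_add:
  "(\<Prod>i\<in>keys (\<mu> + \<nu>). \<sigma> i ^ lookup (\<mu> + \<nu>) i) =
     (\<Prod>i\<in>keys \<mu>. \<sigma> i ^ lookup \<mu> i) * (\<Prod>i\<in>keys \<nu>. \<sigma> i ^ lookup \<nu> i)"
  for \<sigma> :: "nat \<Rightarrow> 'a::comm_monoid_mult" and \<mu> \<nu> :: "nat \<Rightarrow>\<^sub>0 nat"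
proof -
  let ?A = "keys \<mu> \<union> keys \<nu>"
  have "keys (\<mu> + \<nu>) \<subseteq> ?A" by (rule Poly_Mapping.keys_add)
  then show ?thesis
    using monomial_superset[of ?A "\<mu> + \<nu>" \<sigma>] monomial_superset[of ?A \<mu> \<sigma>] monomial_superset[of ?A \<nu> \<sigma>]
    by (simp add: lookup_add power_add prod.distrib)
qed

lemma psubst_hom:
  shows psubst_add: "psubst \<sigma> (p + p') = psubst \<sigma> p + psubst \<sigma> p'"
    and psubst_mult: "psubst \<sigma> (p * p') = psubst \<sigma> p * psubst \<sigma> p'"
    and psubst_one: "psubst \<sigma> 1 = 1"
    and psubst_scal: "psubst \<sigma> (scal a) = scal a"
    and psubst_Var: "psubst \<sigma> (Var i) = \<sigma> i"
  using scal.plin_single[of "\<lambda>\<mu>. \<Prod>i\<in>keys \<mu>. \<sigma> i ^ lookup \<mu> i" 0 a, folded scal_def]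
  by (simp_all add: psubst_alt scal.plin_add scal.plin_mult monomial_add scal.plin_one scal.plin_single Var_def scal_one)

section \<open>Presented algebras\<close>

text \<open>This kills the words with letters outside X. Being a ring homomorphism on the whole
  type, it pulls ideals of the carrier \<open>free_alg X\<close> back to two-sided ideals of the
  type.\<close>

definition restr :: "'x set \<Rightarrow> ('x, 'k::comm_ring_1) falg \<Rightarrow> ('x, 'k) falg" where
  "restr X = plin scal (\<lambda>w. if w \<in> lists X then Poly_Mapping.single w 1 else 0)"

lemma restr_hom: "restr X (p + p') = restr X p + restr X p'" "restr X (p * p') = restr X p * restr X p'"
proof -
  show "restr X (p * p') = restr X p * restr X p'"
    unfolding restr_def by (rule scal.plin_mult) (auto simp: mult_single plus_list_def)
qed (simp add: restr_def scal.plin_add)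

lemma restr_keys: "keys (restr X p) \<subseteq> lists X"
proof (induction p rule: single_induct)
  case (add a c p)
  have "keys (restr X (Poly_Mapping.single a c)) \<subseteq> lists X"
    by (auto simp: restr_def scal.plin_single scal_def mult_single dest: subsetD[OF keys_mult])
  with add show ?case unfolding restr_hom by (intro order.trans[OF Poly_Mapping.keys_add] Un_least)
qed (simp add: restr_def scal.plin_zero)

lemma restr_id: "keys p \<subseteq> lists X \<Longrightarrow> restr X p = p"
proof -
  assume "keys p \<subseteq> lists X"
  then have "restr X p = plin scal (\<lambda>w. Poly_Mapping.single w 1) p"
    unfolding restr_def plin_def by (intro sum.cong refl) auto
  also have "\<dots> = p"
    by (induction p rule: single_induct)
      (simp_all add: scal.plin_zero scal.plin_add scal.plin_single, simp add: scal_def mult_single)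
  finally show ?thesis .
qed

text \<open>The constant term. It is the homomorphism that fills the other components of
  \<open>quotient_at\<close>, which is why the relations of a \<open>presentation\<close> have
  constant term 0.\<close>

definition augm :: "('x, 'k::comm_ring_1) falg \<Rightarrow> ('x, 'k) falg" where
  "augm = plin scal (\<lambda>w. if w = [] then 1 else 0)"

lemma augm_hom: "augm (p + p') = augm p + augm p'" "augm (p * p') = augm p * augm p'" "augm 1 = 1"
    "augm (scal a) = scal a" "augm (gen x) = 0"
proof -
  show "augm (p * p') = augm p * augm p'"
    unfolding augm_def by (rule scal.plin_mult) (auto simp: plus_list_def)
  show "augm (scal a) = scal a"
    unfolding augm_def scal_def[of a] scal.plin_single by (simp add: scal_def zero_list_def)
qed (simp_all add: augm_def scal.plin_add scal.plin_one gen_def scal.plin_single zero_list_def)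

locale presentation =
  fixes X :: "'x set" and S :: "('x, 'k::field) falg set"
  assumes S_carrier: "S \<subseteq> carrier (free_alg X)"
    and S_augm: "p \<in> S \<Longrightarrow> augm p = 0"
begin

lemma carrier_iff: "p \<in> carrier (free_alg X) \<longleftrightarrow> keys p \<subseteq> lists X"
  by (simp add: free_alg_def ring_on_def)

sublocale free: ring "free_alg X :: ('x, 'k) falg ring"
  by (rule ring_free_alg)

definition \<J> where "\<J> = genideal (free_alg X) S"

sublocale rels: ideal \<J> "free_alg X"
  unfolding \<J>_def by (rule free.genideal_ideal) (rule S_carrier)

lemma free_ops [simp]: "x \<otimes>\<^bsub>free_alg X\<^esub> y = x * y" "x \<oplus>\<^bsub>free_alg X\<^esub> y = x + y"
    "\<zero>\<^bsub>free_alg X\<^esub> = 0" "\<one>\<^bsub>free_alg X\<^esub> = 1" for x y :: "('x, 'k) falg"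
  by (simp_all add: free_alg_def ring_on_def)

lemma carrier_closed:
  "x \<in> carrier (free_alg X) \<Longrightarrow> y \<in> carrier (free_alg X) \<Longrightarrow> x + y \<in> carrier (free_alg X)"
  "x \<in> carrier (free_alg X) \<Longrightarrow> y \<in> carrier (free_alg X) \<Longrightarrow> x * y \<in> carrier (free_alg X)"
  "scal a \<in> carrier (free_alg X)" "(1 :: ('x, 'k) falg) \<in> carrier (free_alg X)"
  "(0 :: ('x, 'k) falg) \<in> carrier (free_alg X)"
  "i \<in> X \<Longrightarrow> (gen i :: ('x, 'k) falg) \<in> carrier (free_alg X)" for x y :: "('x, 'k) falg"
  using free.a_closed[of x y] free.m_closed[of x y] free.one_closed
  by (simp_all add: carrier_iff scal_def gen_def zero_list_def)

definition classof :: "('x, 'k) falg \<Rightarrow> ('x, 'k) falg set" where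
  "classof = pres_class X S"

definition \<I> :: "('x, 'k) falg set" where
  "\<I> = {p. restr X p \<in> \<J>}"

lemma J_add: "p \<in> \<J> \<Longrightarrow> p' \<in> \<J> \<Longrightarrow> p + p' \<in> \<J>"
  using rels.a_closed[of p p'] by simp

lemma tsideal_\<I>: "tsideal \<I>"
proof -
  have "restr X a * y \<in> \<J>" "y * restr X a \<in> \<J>" if "y \<in> \<J>" for a :: "('x, 'k) falg" and y
    using rels.I_l_closed[OF that, of "restr X a"] rels.I_r_closed[OF that, of "restr X a"] restr_keys[of X a]
    by (simp_all add: carrier_iff)
  moreover have "restr X (0 :: ('x, 'k) falg) \<in> \<J>"
    using rels.zero_closed by (simp add: restr_def scal.plin_zero)
  ultimately show ?thesis
    by (auto simp: tsideal_def \<I>_def restr_hom J_add)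
qed

text \<open>The passage from words to operators. It kills the relations (\<open>\<eta>_S\<close>),
  and words with equal operators have equal classes (\<open>\<eta>_eq_classof\<close>), so
  computations in the presented algebra take place in a type of class \<open>ring_1\<close>.\<close>

definition \<eta> :: "('x, 'k) falg \<Rightarrow> ('x, 'k) falg quotients endo" where
  "\<eta> p = lmult (quotient_at \<I> augm p)"

lemma \<eta>_hom: "\<eta> (p + p') = \<eta> p + \<eta> p'" "\<eta> (p * p') = \<eta> p * \<eta> p'" "\<eta> 1 = 1"
  by (simp_all add: \<eta>_def quotient_at_hom augm_hom lmult_hom)

lemma \<eta>_zero [simp]: "\<eta> 0 = 0"
  using \<eta>_hom(1)[of 0 0] by simp

lemma \<eta>_minus: "\<eta> (- p) = - \<eta> p"
  using \<eta>_hom(1)[of p "- p"] by (simp add: eq_neg_iff_add_eq_0 add.commute)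

lemma \<eta>_diff: "\<eta> (p - p') = \<eta> p - \<eta> p'"
  using \<eta>_hom(1)[of p "- p'"] by (simp add: \<eta>_minus)

lemma \<eta>_sum: "\<eta> (\<Sum>i\<in>A. f i) = (\<Sum>i\<in>A. \<eta> (f i))"
  by (induction A rule: infinite_finite_induct) (simp_all add: \<eta>_hom)

lemma \<eta>_S: "p \<in> S \<Longrightarrow> \<eta> p = 0"
proof -
  assume p: "p \<in> S"
  then have "p \<in> \<I>" using S_carrier free.genideal_self[OF S_carrier]
    by (auto simp: \<I>_def \<J>_def carrier_iff subset_iff restr_id)
  then show ?thesis unfolding \<eta>_def using quotient_at_zero[OF tsideal_\<I>, of p augm] S_augm[OF p]
    by (simp add: lmult_hom)
qed

lemma \<eta>_central: "\<eta> (scal a) * x = x * \<eta> (scal a)"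
  unfolding \<eta>_def by (intro lmult_central quotient_at_central scal_central augm_hom)

lemma diff_J_classof:
  assumes "p \<in> carrier (free_alg X)" "p' \<in> carrier (free_alg X)" "p - p' \<in> \<J>"
  shows "classof p = classof p'"
proof -
  have neg: "- x \<in> \<J>" if "x \<in> \<J>" for x
  proof -
    have "- 1 \<in> carrier (free_alg X)" using carrier_closed(4) by (simp add: carrier_iff)
    from rels.I_l_closed[OF that this] show ?thesis by simp
  qed
  have *: "classof x = {h + x | h. h \<in> \<J>}" for x
    unfolding classof_def pres_class_def \<J>_def[symmetric] a_r_coset_def r_coset_def
    by (auto simp: free_alg_def ring_on_def)
  have sub: "{h + x | h. h \<in> \<J>} \<subseteq> {h + y | h. h \<in> \<J>}" if "x - y \<in> \<J>" for x y
  proof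
    fix z assume "z \<in> {h + x | h. h \<in> \<J>}"
    then obtain h where "z = h + x" "h \<in> \<J>" by auto
    then have "z = (h + (x - y)) + y" "h + (x - y) \<in> \<J>" using that by (auto intro: J_add)
    then show "z \<in> {h + y | h. h \<in> \<J>}" by blast
  qed
  have "p' - p \<in> \<J>" using neg[OF assms(3)] by simp
  then show ?thesis unfolding * using sub[of p p'] sub[of p' p] assms(3) by blast
qed

lemma \<eta>_eq_classof:
  assumes "p \<in> carrier (free_alg X)" "p' \<in> carrier (free_alg X)" "\<eta> p = \<eta> p'"
  shows "classof p = classof p'"
proof -
  have "quotient_at \<I> augm p = quotient_at \<I> augm p'"
    by (rule lmult_inj) (use assms(3) in \<open>simp add: \<eta>_def\<close>)
  then have "p - p' \<in> \<I>" by (rule quotient_at_eqD[OF tsideal_\<I>])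
  moreover have "p - p' \<in> carrier (free_alg X)"
    using assms(1,2) keys_diff[of p p'] by (auto simp: carrier_iff)
  ultimately have "p - p' \<in> \<J>" by (simp add: \<I>_def carrier_iff restr_id)
  with assms(1,2) show ?thesis by (rule diff_J_classof)
qed

lemma classof_ring_hom: "classof \<in> ring_hom (free_alg X) (pres_alg X S)"
  unfolding classof_def pres_class_def[abs_def] pres_alg_def \<J>_def[symmetric]
  by (rule rels.rcos_ring_hom)

lemma carrier_pres: "carrier (pres_alg X S) = classof ` carrier (free_alg X)"
  by (auto simp: pres_alg_def FactRing_def A_RCOSETS_def' classof_def pres_class_def)

definition central :: "('x, 'k) falg \<Rightarrow> bool" where
  "central p \<longleftrightarrow> p \<in> carrier (free_alg X) \<and> (\<forall>i\<in>X. \<eta> p * \<eta> (gen i) = \<eta> (gen i) * \<eta> p)"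

lemma \<eta>_single: "\<eta> (Poly_Mapping.single w c) = \<eta> (scal c) * prod_list (map (\<lambda>i. \<eta> (gen i)) w)"
proof (induction w arbitrary: c rule: rev_induct)
  case Nil
  then show ?case by (simp add: scal_def zero_list_def)
next
  case (snoc x w)
  have "Poly_Mapping.single (w @ [x]) c = Poly_Mapping.single w c * gen x"
    by (simp add: gen_def mult_single plus_list_def)
  then show ?case using snoc by (simp add: \<eta>_hom mult.assoc)
qed

lemma central_commute:
  assumes "central p" "r \<in> carrier (free_alg X)"
  shows "\<eta> p * \<eta> r = \<eta> r * \<eta> p"
proof -
  have w: "\<eta> p * prod_list (map (\<lambda>i. \<eta> (gen i)) w) = prod_list (map (\<lambda>i. \<eta> (gen i)) w) * \<eta> p"
    if "w \<in> lists X" for w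
    using that
  proof (induction w)
    case (Cons i w)
    then have "\<eta> p * \<eta> (gen i) = \<eta> (gen i) * \<eta> p" using assms(1) by (auto simp: central_def)
    then have "\<eta> p * (\<eta> (gen i) * y) = \<eta> (gen i) * (\<eta> p * y)" for y by (simp flip: mult.assoc)
    then show ?case using Cons by (simp add: mult.assoc)
  qed simp
  have s: "\<eta> p * \<eta> (Poly_Mapping.single w c) = \<eta> (Poly_Mapping.single w c) * \<eta> p" if "w \<in> lists X" for w c
  proof -
    have "\<eta> p * \<eta> (Poly_Mapping.single w c) = \<eta> (scal c) * (\<eta> p * prod_list (map (\<lambda>i. \<eta> (gen i)) w))"
      by (simp only: \<eta>_single mult.assoc[symmetric] \<eta>_central[of c "\<eta> p"])
    then show ?thesis unfolding w[OF that] by (simp add: \<eta>_single mult.assoc)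
  qed
  have r: "r = (\<Sum>w\<in>keys r. Poly_Mapping.single w (lookup r w))"
    by (intro poly_mapping_eqI) (simp add: lookup_sum lookup_single when_def in_keys_iff)
  have "\<eta> p * \<eta> r = (\<Sum>w\<in>keys r. \<eta> p * \<eta> (Poly_Mapping.single w (lookup r w)))"
    by (subst r) (simp only: \<eta>_sum sum_distrib_left)
  also have "\<dots> = (\<Sum>w\<in>keys r. \<eta> (Poly_Mapping.single w (lookup r w)) * \<eta> p)"
    using assms(2) by (intro sum.cong refl s) (auto simp: carrier_iff)
  also have "\<dots> = \<eta> r * \<eta> p"
    by (subst (2) r) (simp only: \<eta>_sum sum_distrib_right)
  finally show ?thesis .
qed

lemma central_closed:
  "central p \<Longrightarrow> central p' \<Longrightarrow> central (p + p')"
  "central p \<Longrightarrow> central p' \<Longrightarrow> central (p * p')"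
  "central (scal a)"
proof -
  assume c: "central p" "central p'"
  then show "central (p + p')"
    by (auto simp: central_def carrier_closed \<eta>_hom distrib_left distrib_right)
  have "\<eta> p * \<eta> p' * \<eta> (gen i) = \<eta> (gen i) * (\<eta> p * \<eta> p')" if "i \<in> X" for i
  proof -
    have "\<eta> p * \<eta> p' * \<eta> (gen i) = \<eta> p * (\<eta> (gen i) * \<eta> p')"
      using c(2) that by (simp add: central_def mult.assoc)
    also have "\<dots> = (\<eta> (gen i) * \<eta> p) * \<eta> p'"
      using c(1) that by (simp add: central_def flip: mult.assoc)
    finally show ?thesis by (simp only: mult.assoc)
  qed
  then show "central (p * p')"
    using c by (auto simp: central_def carrier_closed \<eta>_hom)
next
  show "central (scal a)"
    unfolding central_def by (intro conjI ballI carrier_closed \<eta>_central)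
qed

lemma classof_mult_eq:
  "p \<in> carrier (free_alg X) \<Longrightarrow> r \<in> carrier (free_alg X) \<Longrightarrow>
     classof p \<otimes>\<^bsub>pres_alg X S\<^esub> classof r = classof (p * r)"
  using ring_hom_mult[OF classof_ring_hom, of p r] by simp

lemma classof_center: "central p \<Longrightarrow> classof p \<in> carrier (center_ring (pres_alg X S))"
proof -
  assume p: "central p"
  then have pc: "p \<in> carrier (free_alg X)" by (simp add: central_def)
  have "classof p \<otimes>\<^bsub>pres_alg X S\<^esub> classof r = classof r \<otimes>\<^bsub>pres_alg X S\<^esub> classof p"
    if "r \<in> carrier (free_alg X)" for r
    unfolding classof_mult_eq[OF pc that] classof_mult_eq[OF that pc]
    using pc that central_commute[OF p that] by (intro \<eta>_eq_classof) (auto simp: carrier_closed \<eta>_hom)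
  then show ?thesis using pc by (auto simp: center_ring_def carrier_pres)
qed

lemma center_hom:
  assumes h: "h \<in> ring_hom (center_ring (pres_alg X S)) (sym_ring N)" and c: "central p" "central p'"
  shows "h (classof (p + p')) = h (classof p) + h (classof p')"
    and "h (classof (p * p')) = h (classof p) * h (classof p')"
proof -
  have car: "p \<in> carrier (free_alg X)" "p' \<in> carrier (free_alg X)" using c by (auto simp: central_def)
  have "classof (p * p') = classof p \<otimes>\<^bsub>center_ring (pres_alg X S)\<^esub> classof p'"
    "classof (p + p') = classof p \<oplus>\<^bsub>center_ring (pres_alg X S)\<^esub> classof p'"
    using ring_hom_mult[OF classof_ring_hom car] ring_hom_add[OF classof_ring_hom car] by (simp_all add: center_ring_def)
  then show "h (classof (p + p')) = h (classof p) + h (classof p')"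
    and "h (classof (p * p')) = h (classof p) * h (classof p')"
    using ring_hom_mult[OF h] ring_hom_add[OF h] classof_center c by (simp_all add: sym_ring_def ring_on_def)
qed

end

section \<open>Multi-indices\<close>

lemma finite_midx [simp]: "finite (midx N m)"
  by (simp add: midx_def finite_PiE)

lemma midx_in: "I \<in> midx N m \<Longrightarrow> 1 \<le> k \<Longrightarrow> k \<le> m \<Longrightarrow> I k \<in> {1..N}"
  by (auto simp: midx_def PiE_iff)

lemma midx_ext: "I \<in> midx N m \<Longrightarrow> J \<in> midx N m \<Longrightarrow> (\<And>k. k \<in> {1..m} \<Longrightarrow> I k = J k) \<Longrightarrow> I = J"
  unfolding midx_def by (rule PiE_ext)

lemma midx_update: "I \<in> midx N m \<Longrightarrow> k \<in> {1..m} \<Longrightarrow> a \<in> {1..N} \<Longrightarrow> I(k := a) \<in> midx N m"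
  by (auto simp: midx_def PiE_iff extensional_def)

lemma midx_0: "midx N 0 = {\<lambda>_. undefined}"
  by (simp add: midx_def)

lemma sum_midx_Suc:
  "(\<Sum>I\<in>midx N (Suc m). f I) = (\<Sum>J\<in>midx N m. \<Sum>a\<in>{1..N}. f (J(Suc m := a)))"
proof -
  have "midx N (Suc m) = (\<lambda>(a, J). J(Suc m := a)) ` ({1..N} \<times> midx N m)"
    by (simp add: midx_def atLeastAtMostSuc_conv PiE_insert_eq)
  moreover have "inj_on (\<lambda>(a, J). J(Suc m := a)) ({1..N} \<times> midx N m)"
    unfolding midx_def by (rule inj_combinator) simp
  ultimately have "(\<Sum>I\<in>midx N (Suc m). f I) = (\<Sum>(a, J)\<in>{1..N} \<times> midx N m. f (J(Suc m := a)))"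
    by (simp only: sum.reindex) (simp add: case_prod_unfold o_def)
  also have "\<dots> = (\<Sum>a\<in>{1..N}. \<Sum>J\<in>midx N m. f (J(Suc m := a)))"
    by (rule sum.cartesian_product[symmetric])
  also have "\<dots> = (\<Sum>J\<in>midx N m. \<Sum>a\<in>{1..N}. f (J(Suc m := a)))" by (rule sum.swap)
  finally show ?thesis .
qed

lemma sum_midx_update:
  assumes J: "J \<in> midx N m" and k: "k \<in> {1..m}"
  shows "(\<Sum>I\<in>midx N m. if \<forall>l\<in>{1..m} - {k}. I l = J l then f I else 0) = (\<Sum>a\<in>{1..N}. f (J(k := a)))"
proof -
  have "(\<Sum>a\<in>{1..N}. f (J(k := a))) = (\<Sum>I\<in>(\<lambda>a. J(k := a)) ` {1..N}. f I)"
    by (subst sum.reindex) (auto intro!: inj_onI dest: fun_upd_eqD)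
  also have "\<dots> = (\<Sum>I\<in>{I \<in> midx N m. \<forall>l\<in>{1..m} - {k}. I l = J l}. f I)"
  proof (rule sum.cong)
    show "(\<lambda>a. J(k := a)) ` {1..N} = {I \<in> midx N m. \<forall>l\<in>{1..m} - {k}. I l = J l}"
    proof (intro equalityI subsetI)
      fix I assume I: "I \<in> {I \<in> midx N m. \<forall>l\<in>{1..m} - {k}. I l = J l}"
      moreover have "I k \<in> {1..N}" using I k midx_in[of I N m k] by auto
      ultimately have "I = J(k := I k)"
        using k J by (intro midx_ext[of I N m] midx_update) auto
      with \<open>I k \<in> {1..N}\<close> show "I \<in> (\<lambda>a. J(k := a)) ` {1..N}" by blast
    qed (use midx_update[OF J k] in \<open>auto split: if_splits\<close>)
  qed simp
  finally show ?thesis by (simp add: sum.If_cases Int_def)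
qed

lemma sum_midx_update2:
  assumes J: "J \<in> midx N m" and k: "k \<in> {1..m}" and k': "k' \<in> {1..m}" "k \<noteq> k'"
  shows "(\<Sum>I\<in>midx N m. if \<forall>l\<in>{1..m} - {k, k'}. I l = J l then f I else 0) =
    (\<Sum>a\<in>{1..N}. \<Sum>b\<in>{1..N}. f (J(k := a, k' := b)))"
proof -
  have "(\<Sum>a\<in>{1..N}. \<Sum>b\<in>{1..N}. f (J(k := a, k' := b))) =
     (\<Sum>a\<in>{1..N}. \<Sum>I\<in>midx N m. if \<forall>l\<in>{1..m} - {k'}. I l = (J(k := a)) l then f I else 0)"
    using assms by (intro sum.cong refl sum_midx_update[symmetric] midx_update) auto
  also have "\<dots> = (\<Sum>I\<in>midx N m. \<Sum>a\<in>{1..N}. if \<forall>l\<in>{1..m} - {k'}. I l = (J(k := a)) l then f I else 0)"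
    by (rule sum.swap)
  also have "\<dots> = (\<Sum>I\<in>midx N m. \<Sum>a\<in>{1..N}. if a = I k then if \<forall>l\<in>{1..m} - {k, k'}. I l = J l then f I else 0 else 0)"
    using k k' by (intro sum.cong refl) auto
  also have "\<dots> = (\<Sum>I\<in>midx N m. if \<forall>l\<in>{1..m} - {k, k'}. I l = J l then f I else 0)"
    using midx_in[of _ N m k] k by (intro sum.cong refl) auto
  finally show ?thesis ..
qed

section \<open>Matrix products over multi-indices\<close>

lemma tend_simps:
  "A \<otimes>\<^bsub>tend N m\<^esub> B = (\<lambda>I J. \<Sum>K\<in>midx N m. A I K * B K J)"
  "\<one>\<^bsub>tend N m\<^esub> = (\<lambda>I J. if I \<in> midx N m \<and> I = J then 1 else 0)"
  "A \<oplus>\<^bsub>tend N m\<^esub> B = (\<lambda>I J. A I J + B I J)"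
  by (simp_all add: tend_def)

lemma tprod_simps: "tprod N m [] = \<one>\<^bsub>tend N m\<^esub>" "tprod N m (A # As) = A \<otimes>\<^bsub>tend N m\<^esub> tprod N m As"
  by (simp_all add: tprod_def)

lemma (in central_hom) c_sum: "c (\<Sum>i\<in>A. f i) = (\<Sum>i\<in>A. c (f i))"
  by (induction A rule: infinite_finite_induct) (simp_all add: c_zero c_add)

lemma lift_mult: "lift (A \<otimes>\<^bsub>tend N m\<^esub> B) = lift A \<otimes>\<^bsub>tend N m\<^esub> lift B"
  for A B :: "'k::comm_ring_1 tmat"
  by (simp add: tend_simps lift_def scal.c_sum scal.c_mult)

lemma lift_one: "lift (\<one>\<^bsub>tend N m\<^esub> :: 'k::comm_ring_1 tmat) = \<one>\<^bsub>tend N m\<^esub>"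
  by (auto simp: tend_simps lift_def scal.c_one scal.c_zero fun_eq_iff)

lemma lift_tprod: "lift (tprod N m As) = tprod N m (map lift As)"
  for As :: "'k::comm_ring_1 tmat list"
  by (induction As) (simp_all add: tprod_simps lift_mult lift_one)

section \<open>Matrices over a presented algebra as operators\<close>

locale tensor_algebra = presentation "gl_gens N" S for N and S :: "(nat \<times> nat, 'k::field) falg set" +
  fixes t :: 'k
  assumes N_pos: "N \<ge> 1" and t_nz: "t \<noteq> 0" and qn_t_nz: "qn t (Suc n) \<noteq> 0"
begin

abbreviation sc :: "'k \<Rightarrow> (nat \<times> nat, 'k) falg quotients endo \<Rightarrow> (nat \<times> nat, 'k) falg quotients endo" (infixr "\<cdot>" 75) where
  "b \<cdot> x \<equiv> \<eta> (scal b) * x"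

abbreviation e :: "nat \<Rightarrow> nat \<Rightarrow> nat \<Rightarrow> (nat \<times> nat, 'k) falg quotients endo" where
  "e \<equiv> eunit N"

sublocale matrix_units "\<lambda>b x. b \<cdot> x" t N e
proof -
  have "algebra_ring (\<lambda>b x. b \<cdot> x)"
  proof
    show "x * (b \<cdot> y) = b \<cdot> (x * y)" for b x y
      using \<eta>_central[of b x] by (simp flip: mult.assoc)
  qed (simp_all add: scal_add scal_mult scal_one \<eta>_hom distrib_left distrib_right mult.assoc)
  then show "matrix_units (\<lambda>b x. b \<cdot> x) t N e"
    by (rule matrix_units.intro)
      (unfold_locales, auto simp: t_nz qn_t_nz eunit_same eunit_diff eunit_sum[OF N_pos, unfolded One_nat_def] eunit_comm)
qed

lemma \<eta>_e: "e n a b * \<eta> p = \<eta> p * e n a b"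
  unfolding \<eta>_def by (rule eunit_lmult)

lemma \<eta>_e_left: "e n a b * (\<eta> p * x) = \<eta> p * (e n a b * x)"
  by (simp only: \<eta>_e mult.assoc[symmetric])

lemma \<eta>_lev: "\<eta> p \<in> lev n"
  by (simp add: lev_def \<eta>_e)

text \<open>The matrix unit of the m-th tensor power in row I and column J; multi-indices count the
  factors from 1, the operators from 0.\<close>

fun u :: "nat \<Rightarrow> (nat \<Rightarrow> nat) \<Rightarrow> (nat \<Rightarrow> nat) \<Rightarrow> (nat \<times> nat, 'k) falg quotients endo" where
  "u 0 I J = 1"
| "u (Suc m) I J = u m I J * e m (I (Suc m)) (J (Suc m))"

lemma u_lev: "u m I J \<in> lev m"
proof (induction m)
  case (Suc m)
  have "u m I J \<in> lev (Suc m)" using Suc by (simp add: lev_def)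
  then show ?case by (simp add: lev_mult e_lev)
qed (simp add: lev_def)

lemma \<eta>_u: "u m I J * \<eta> p = \<eta> p * u m I J"
proof (induction m)
  case (Suc m)
  have "u (Suc m) I J * \<eta> p = u m I J * \<eta> p * e m (I (Suc m)) (J (Suc m))" by (simp add: \<eta>_e mult.assoc)
  then show ?case using Suc by (simp add: mult.assoc)
qed simp

lemma u_cong: "(\<And>k. k \<in> {1..m} \<Longrightarrow> I k = I' k) \<Longrightarrow> (\<And>k. k \<in> {1..m} \<Longrightarrow> J k = J' k) \<Longrightarrow> u m I J = u m I' J'"
  by (induction m) auto

lemma e_u:
  assumes "k < m" "J (Suc k) \<in> {1..N}"
  shows "e k a b * u m J K = (if b = J (Suc k) then u m (J(Suc k := a)) K else 0)"
  using assms(1)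
proof (induction m)
  case (Suc m)
  show ?case
  proof (cases "k = m")
    case True
    have "e k a b * u (Suc m) J K = u m J K * (e m a b * e m (J (Suc m)) (K (Suc m)))"
      using levD[OF u_lev, of m m a b J K] True by (simp flip: mult.assoc)
    also have "e m a b * e m (J (Suc m)) (K (Suc m)) = (if b = J (Suc m) then e m a (K (Suc m)) else 0)"
      using assms(2) True by (auto simp: e_same e_diff)
    also have "u m J K = u m (J(Suc k := a)) K" using True by (intro u_cong) auto
    finally show ?thesis using True by (cases "b = J (Suc m)") simp_all
  next
    case False
    then have "e k a b * u m J K = (if b = J (Suc k) then u m (J(Suc k := a)) K else 0)" using Suc by simp
    then show ?thesis using False by (cases "b = J (Suc k)") (simp_all flip: mult.assoc)
  qed
qed simp

lemma u_mult:
  assumes "\<And>k. k \<in> {1..m} \<Longrightarrow> J k \<in> {1..N}"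
  shows "u m I J * u m J' K = (if \<forall>k\<in>{1..m}. J k = J' k then u m I K else 0)"
  using assms
proof (induction m)
  case (Suc m)
  have "u (Suc m) I J * u (Suc m) J' K = u m I J * u m J' K * (e m (I (Suc m)) (J (Suc m)) * e m (J' (Suc m)) (K (Suc m)))"
    using levD_left[OF u_lev, of m m "I (Suc m)" "J (Suc m)" J' K] by (simp add: mult.assoc)
  also have "e m (I (Suc m)) (J (Suc m)) * e m (J' (Suc m)) (K (Suc m)) =
     (if J (Suc m) = J' (Suc m) then e m (I (Suc m)) (K (Suc m)) else 0)"
    using Suc.prems[of "Suc m"] by (auto simp: e_mult)
  finally show ?case using Suc by (auto simp: atLeastAtMostSuc_conv)
qed simp

lemma u_mult_midx:
  assumes "J \<in> midx N m" "J' \<in> midx N m"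
  shows "u m I J * u m J' K = (if J = J' then u m I K else 0)"
proof -
  have "(\<forall>k\<in>{1..m}. J k = J' k) \<longleftrightarrow> J = J'" using midx_ext[OF assms] by blast
  then show ?thesis using u_mult[of m J I J' K] midx_in[OF assms(1)] by auto
qed

lemma u_sum: "(\<Sum>I\<in>midx N m. u m I I) = 1"
proof (induction m)
  case (Suc m)
  have "(\<Sum>a\<in>{1..N}. u (Suc m) (J(Suc m := a)) (J(Suc m := a))) = u m J J * (\<Sum>a\<in>{1..N}. e m a a)" for J
    unfolding sum_distrib_left by (intro sum.cong refl) (auto intro!: arg_cong2[of _ _ _ _ "(*)"] u_cong)
  then show ?case using Suc unfolding sum_midx_Suc e_sum by simp
qed (simp add: midx_0)

lemma ket_ext_u:
  assumes "\<And>J. J \<in> midx N m \<Longrightarrow> x * u m J J = y * u m J J"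
  shows "x = y"
proof -
  have "x * (\<Sum>J\<in>midx N m. u m J J) = y * (\<Sum>J\<in>midx N m. u m J J)"
    unfolding sum_distrib_left by (intro sum.cong assms refl)
  then show ?thesis by (simp add: u_sum)
qed

text \<open>A homomorphism from matrices to operators. The images of \<open>at1\<close> and
  \<open>at2\<close> do not depend on m, which brings all tensor powers into one tower.\<close>

definition \<Phi> :: "nat \<Rightarrow> (nat \<times> nat, 'k) falg tmat \<Rightarrow> (nat \<times> nat, 'k) falg quotients endo" where
  "\<Phi> m A = (\<Sum>I\<in>midx N m. \<Sum>J\<in>midx N m. \<eta> (A I J) * u m I J)"

lemma \<Phi>_u:
  assumes "J \<in> midx N m"
  shows "\<Phi> m A * u m J K = (\<Sum>I\<in>midx N m. \<eta> (A I J) * u m I K)"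
proof -
  have "\<Phi> m A * u m J K = (\<Sum>I\<in>midx N m. \<Sum>J'\<in>midx N m. if J' = J then \<eta> (A I J) * u m I K else 0)"
    unfolding \<Phi>_def sum_distrib_right
    by (intro sum.cong refl) (auto simp: mult.assoc u_mult_midx[OF _ assms])
  then show ?thesis using assms by simp
qed

lemma \<Phi>_mult: "\<Phi> m (A \<otimes>\<^bsub>tend N m\<^esub> B) = \<Phi> m A * \<Phi> m B"
proof (rule ket_ext_u)
  fix J assume J: "J \<in> midx N m"
  have "\<Phi> m A * \<Phi> m B * u m J J = (\<Sum>K\<in>midx N m. \<Phi> m A * (\<eta> (B K J) * u m K J))"
    by (simp add: mult.assoc \<Phi>_u[OF J] sum_distrib_left)
  also have "\<dots> = (\<Sum>K\<in>midx N m. \<Phi> m A * u m K J * \<eta> (B K J))"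
    by (simp only: \<eta>_u mult.assoc)
  also have "\<dots> = (\<Sum>K\<in>midx N m. \<Sum>I\<in>midx N m. \<eta> (A I K) * \<eta> (B K J) * u m I J)"
    by (intro sum.cong refl) (simp only: \<Phi>_u sum_distrib_right mult.assoc \<eta>_u)
  also have "\<dots> = (\<Sum>I\<in>midx N m. \<Sum>K\<in>midx N m. \<eta> (A I K) * \<eta> (B K J) * u m I J)"
    by (rule sum.swap)
  also have "\<dots> = \<Phi> m (A \<otimes>\<^bsub>tend N m\<^esub> B) * u m J J"
    unfolding \<Phi>_u[OF J] tend_simps \<eta>_sum \<eta>_hom sum_distrib_right ..
  finally show "\<Phi> m (A \<otimes>\<^bsub>tend N m\<^esub> B) * u m J J = \<Phi> m A * \<Phi> m B * u m J J" ..
qed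

lemma \<Phi>_one: "\<Phi> m \<one>\<^bsub>tend N m\<^esub> = 1"
proof -
  have "\<Phi> m \<one>\<^bsub>tend N m\<^esub> = (\<Sum>I\<in>midx N m. \<Sum>J\<in>midx N m. if J = I then u m I I else 0)"
    unfolding \<Phi>_def by (intro sum.cong refl) (auto simp: tend_simps \<eta>_hom)
  then show ?thesis by (simp add: u_sum)
qed

lemma \<Phi>_tprod: "\<Phi> m (tprod N m As) = prod_list (map (\<Phi> m) As)"
  by (induction As) (simp_all add: tprod_simps \<Phi>_one \<Phi>_mult)

lemma \<Phi>_at1:
  assumes "k < m"
  shows "\<Phi> m (at1 N m (Suc k) K) = (\<Sum>a\<in>{1..N}. \<Sum>b\<in>{1..N}. \<eta> (K a b) * e k a b)"
proof (rule ket_ext_u)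
  fix J assume J: "J \<in> midx N m"
  have Jk: "J (Suc k) \<in> {1..N}" using assms J midx_in by simp
  have "\<Phi> m (at1 N m (Suc k) K) * u m J J = (\<Sum>I\<in>midx N m. if \<forall>l\<in>{1..m} - {Suc k}. I l = J l then \<eta> (K (I (Suc k)) (J (Suc k))) * u m I J else 0)"
    unfolding \<Phi>_u[OF J] using J by (intro sum.cong refl) (auto simp: at1_def)
  also have "\<dots> = (\<Sum>a\<in>{1..N}. \<eta> (K a (J (Suc k))) * u m (J(Suc k := a)) J)"
    using assms by (subst sum_midx_update[OF J]) auto
  also have "\<dots> = (\<Sum>a\<in>{1..N}. \<Sum>b\<in>{1..N}. if b = J (Suc k) then \<eta> (K a b) * u m (J(Suc k := a)) J else 0)"
    using Jk by simp
  also have "\<dots> = (\<Sum>a\<in>{1..N}. \<Sum>b\<in>{1..N}. \<eta> (K a b) * e k a b) * u m J J"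
    unfolding sum_distrib_right using assms Jk by (intro sum.cong refl) (simp add: mult.assoc e_u)
  finally show "\<Phi> m (at1 N m (Suc k) K) * u m J J = \<dots>" .
qed

lemma \<Phi>_at2:
  assumes "Suc k < m"
  shows "\<Phi> m (lift (at2 N m (Suc k) B)) =
    (\<Sum>a\<in>{1..N}. \<Sum>b\<in>{1..N}. \<Sum>c\<in>{1..N}. \<Sum>d\<in>{1..N}. B (a, b) (c, d) \<cdot> (e k a c * e (Suc k) b d))"
proof (rule ket_ext_u)
  fix J assume J: "J \<in> midx N m"
  let ?k = "Suc k" and ?l = "Suc (Suc k)" and ?I = "{1..N}"
  have Jk: "J ?k \<in> ?I" "J ?l \<in> ?I" using assms J midx_in by simp_all
  have "\<Phi> m (lift (at2 N m ?k B)) * u m J J = (\<Sum>I\<in>midx N m. if \<forall>l\<in>{1..m} - {?k, ?l}. I l = J l then B (I ?k, I ?l) (J ?k, J ?l) \<cdot> u m I J else 0)"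
    unfolding \<Phi>_u[OF J] using J by (intro sum.cong refl) (auto simp: at2_def lift_def scal.c_zero)
  also have "\<dots> = (\<Sum>a\<in>?I. \<Sum>b\<in>?I. B (a, b) (J ?k, J ?l) \<cdot> u m (J(?k := a, ?l := b)) J)"
    using assms by (subst sum_midx_update2[OF J]) auto
  also have "\<dots> = (\<Sum>a\<in>?I. \<Sum>b\<in>?I. \<Sum>c\<in>?I. \<Sum>d\<in>?I. if d = J ?l then if c = J ?k then B (a, b) (J ?k, J ?l) \<cdot> u m (J(?k := a, ?l := b)) J else 0 else 0)"
    using Jk by simp
  also have "\<dots> = (\<Sum>a\<in>?I. \<Sum>b\<in>?I. \<Sum>c\<in>?I. \<Sum>d\<in>?I. B (a, b) (c, d) \<cdot> (e k a c * e (Suc k) b d)) * u m J J"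
    unfolding sum_distrib_right
  proof (intro sum.cong refl)
    fix a b c d assume "a \<in> ?I" "b \<in> ?I" "c \<in> ?I" "d \<in> ?I"
    have "e k a c * e (Suc k) b d * u m J J = (if d = J ?l then if c = J ?k then u m (J(?k := a, ?l := b)) J else 0 else 0)"
      using assms Jk by (simp add: mult.assoc e_u fun_upd_twist[of ?l ?k])
    then show "(if d = J ?l then if c = J ?k then B (a, b) (J ?k, J ?l) \<cdot> u m (J(?k := a, ?l := b)) J else 0 else 0) =
      (B (a, b) (c, d) \<cdot> (e k a c * e (Suc k) b d)) * u m J J"
      by (auto simp: mult.assoc)
  qed
  finally show "\<Phi> m (lift (at2 N m ?k B)) * u m J J = \<dots>" .
qed

lemma \<eta>_scal_inj: "\<eta> (scal b) = 0 \<Longrightarrow> b = 0"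
proof (rule ccontr)
  assume "\<eta> (scal b) = 0" "b \<noteq> 0"
  then have "\<eta> (scal (inverse b * b)) = 1" by (simp add: scal_one \<eta>_hom)
  with \<open>\<eta> (scal b) = 0\<close> show False by (simp only: scal_mult \<eta>_hom) simp
qed

text \<open>Multiplication by matrix units on both sides isolates an entry as a scalar times
  \<open>u m K K\<close>; the sum over K leaves the scalar, and scalars embed. This carries
  identities of scalar matrices back from the operators, for the inverse of R and for
  \<open>rho\<close>.\<close>

lemma \<Phi>_lift_inj:
  assumes "A \<in> carrier (tend N m)" "B \<in> carrier (tend N m)" "\<Phi> m (lift A) = \<Phi> m (lift B)"
  shows "A = B"
proof (intro ext)
  fix I J
  show "A I J = B I J"
  proof (cases "I \<in> midx N m \<and> J \<in> midx N m")
    case True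
    have "\<Phi> m (lift C) * u m J I = (\<Sum>K\<in>midx N m. C K J \<cdot> u m K I)" for C
      using True by (simp add: \<Phi>_u lift_def)
    then have 1: "u m K I * (\<Phi> m (lift C) * u m J I) = C I J \<cdot> u m K I" for C K
      using True by (simp add: sum_distrib_left u_mult_midx if_distrib[of "\<lambda>x. _ * x"] sum.delta cong: if_cong)
    have 2: "u m K I * (C I J \<cdot> u m I K) = C I J \<cdot> u m K K" for C :: "'k tmat" and K
      using True by (simp add: u_mult_midx)
    have "A I J \<cdot> u m K K = B I J \<cdot> u m K K" if K: "K \<in> midx N m" for K
    proof -
      have "(A I J \<cdot> u m K I) * u m I K = (B I J \<cdot> u m K I) * u m I K"
        unfolding 1[symmetric] assms(3) ..
      then show ?thesis using True by (simp add: mult.assoc u_mult_midx)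
    qed
    then have "A I J \<cdot> 1 = B I J \<cdot> 1"
      unfolding u_sum[symmetric, of m] sc_sum_right by (intro sum.cong refl)
    then have "\<eta> (scal (A I J - B I J)) = 0"
      by (simp add: scal.c_add[of _ "- _", simplified] scal.c_minus \<eta>_diff)
    then show ?thesis using \<eta>_scal_inj by force
  next
    case False
    then show ?thesis using assms(1,2) by (auto simp: tend_def)
  qed
qed

end

section \<open>The field C(q) and its quantum integers\<close>

lemma q_power: "q ^ k = Fract ([:0, 1:] ^ k) 1"
  by (induction k) (simp_all add: q_def One_fract_def)

lemma q_nz [simp]: "q \<noteq> 0"
  by (simp add: q_def Zero_fract_def eq_fract)

lemma q_power_ne_1: "k > 0 \<Longrightarrow> q ^ k \<noteq> 1"
proof
  assume k: "k > 0" and "q ^ k = 1"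
  then have "([:0, 1:] :: complex poly) ^ k = 1"
    by (simp add: q_power One_fract_def eq_fract)
  then have "degree (([:0, 1:] :: complex poly) ^ k) = 0" by simp
  then show False using k by (simp add: degree_power_eq)
qed

lemma inverse_q_power_ne_1: "k > 0 \<Longrightarrow> inverse q ^ k \<noteq> 1"
  using q_power_ne_1[of k] by (simp add: power_inverse)

lemma q_diff_nz: "q - inverse q \<noteq> 0"
proof
  assume "q - inverse q = 0"
  then have "q = inverse q" by simp
  then have "q ^ 2 = 1" unfolding power2_eq_square by (metis q_nz right_inverse)
  then show False using q_power_ne_1[of 2] by simp
qed

lemma qn_geometric: "(1 - inverse t ^ 2) * qn t n = 1 - inverse t ^ (2 * n)"
  by (induction n) (simp_all add: qn_Suc distrib_left, simp add: algebra_simps power2_eq_square)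

lemma qn_q_nz: "qn q (Suc n) \<noteq> 0"
  using qn_geometric[of q "Suc n"] inverse_q_power_ne_1[of "2 * Suc n"] by auto

lemma qnum_eq: "qnum (int n) = qn q n"
proof -
  have *: "q powi (- 2 * int n) = inverse q ^ (2 * n)" "q powi (- 2) = inverse q ^ 2"
  proof -
    have "- 2 * int n = - int (2 * n)" "- 2 = - int 2" by simp_all
    then show "q powi (- 2 * int n) = inverse q ^ (2 * n)" "q powi (- 2) = inverse q ^ 2"
      by (simp_all only: power_int_minus power_int_of_nat power_inverse)
  qed
  show ?thesis
    unfolding qnum_def * qn_geometric[symmetric] using inverse_q_power_ne_1[of 2] by simp
qed

text \<open>Used with a = 1 / (q - 1/q) and b a power of q^2: it turns L plus its shift into a
  multiple of M minus that power.\<close>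

lemma (in algebra_ring) sc_shift: "a \<cdot> (1 - x) + (a * (b - 1)) \<cdot> 1 = (- a) \<cdot> (x + (- b) \<cdot> 1)"
  by (simp add: sc_distrib right_diff_distrib)

lemma (in algebra_ring) sc_sandwich: "p * ((a \<cdot> x) * (b \<cdot> y)) * z = (a * b) \<cdot> (p * (x * y) * z)"
  by (simp add: mult.commute)

context hecke
begin

text \<open>Put x' = g x g^(-1). By the reflection equation g commutes with x x', so the quadratic
  term dies between \<open>?P\<close> and \<open>?Q\<close>, as does the constant one. On the linear
  terms, P x' Q = - t^2 P x Q, and they cancel because the second shift is t^2 times the
  first.\<close>

lemma absorb_of_reflection:
  assumes "g i * x * g i * x = x * g i * x * g i"
  shows "(g i + inverse t \<cdot> 1) * ((x + b \<cdot> 1) * (g i * x * ginv i + (t * t * b) \<cdot> 1)) * (g i - t \<cdot> 1) = 0"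
proof -
  let ?P = "g i + inverse t \<cdot> 1" and ?Q = "g i - t \<cdot> 1" and ?x' = "g i * x * ginv i"
  have Pg: "?P * g i = t \<cdot> ?P" and PQ: "?P * ?Q = 0"
    using g_sq[of i] by (simp_all add: algebra_simps sc_distrib)
  have "g i * ?Q = - (inverse t \<cdot> ?Q)"
    using g_sq[of i] by (simp add: algebra_simps sc_distrib)
  then have "t \<cdot> (ginv i * (g i * ?Q)) = - (ginv i * ?Q)" by simp
  then have gQ: "ginv i * ?Q = - (t \<cdot> ?Q)" by simp
  have "g i * (x * ?x') = (g i * x * g i * x) * ginv i" by (simp add: mult.assoc)
  also have "\<dots> = (x * ?x') * g i" unfolding assms by (simp add: mult.assoc)
  finally have "?P * (x * ?x') = (x * ?x') * ?P" by (simp add: algebra_simps)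
  then have 1: "?P * (x * ?x') * ?Q = 0" by (simp add: mult.assoc PQ)
  have "?P * ?x' * ?Q = (?P * g i) * x * (ginv i * ?Q)" by (simp add: mult.assoc)
  then have 2: "?P * ?x' * ?Q = - ((t * t) \<cdot> (?P * x * ?Q))" unfolding Pg gQ by simp
  have "?P * ((x + b \<cdot> 1) * (?x' + (t * t * b) \<cdot> 1)) * ?Q =
      ?P * (x * ?x') * ?Q + b \<cdot> (?P * ?x' * ?Q) + (t * t * b) \<cdot> (?P * x * ?Q) + (b * (t * t * b)) \<cdot> (?P * ?Q)"
    by (simp only: distrib_left distrib_right sc_mult_left sc_mult_right sc_sc mult_1_left mult_1_right mult.assoc add.assoc sc_add_right mult.left_commute)
  also have "\<dots> = 0" unfolding 1 2 PQ by (simp add: mult_ac)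
  finally show ?thesis .
qed

end

lemma (in central_hom) c_diff: "c (x - y) = c x - c y"
  using c_add[of x "- y"] by (simp add: c_minus)

section \<open>Representatives in the free algebra and the quantum trace\<close>

definition entries_in :: "'x set \<Rightarrow> ('x, 'k::comm_ring_1) falg tmat \<Rightarrow> bool" where
  "entries_in X A \<longleftrightarrow> (\<forall>I J. A I J \<in> carrier (free_alg X))"

lemma free_alg_closed:
  fixes x y :: "('x, 'k::comm_ring_1) falg"
  shows "x \<in> carrier (free_alg X) \<Longrightarrow> y \<in> carrier (free_alg X) \<Longrightarrow> x + y \<in> carrier (free_alg X)"
    and "x \<in> carrier (free_alg X) \<Longrightarrow> y \<in> carrier (free_alg X) \<Longrightarrow> x - y \<in> carrier (free_alg X)"
    and "x \<in> carrier (free_alg X) \<Longrightarrow> y \<in> carrier (free_alg X) \<Longrightarrow> x * y \<in> carrier (free_alg X)"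
    and "scal a \<in> carrier (free_alg X :: ('x, 'k) falg ring)"
    and "0 \<in> carrier (free_alg X :: ('x, 'k) falg ring)"
    and "1 \<in> carrier (free_alg X :: ('x, 'k) falg ring)"
    and "(\<And>i. i \<in> A \<Longrightarrow> f i \<in> carrier (free_alg X)) \<Longrightarrow> (\<Sum>i\<in>A. f i :: ('x, 'k) falg) \<in> carrier (free_alg X)"
    and "i \<in> X \<Longrightarrow> (gen i :: ('x, 'k) falg) \<in> carrier (free_alg X)"
proof -
  interpret ring "free_alg X :: ('x, 'k) falg ring" by (rule ring_free_alg)
  have c: "p \<in> carrier (free_alg X) \<longleftrightarrow> keys p \<subseteq> lists X" for p :: "('x, 'k) falg"
    by (simp add: free_alg_def ring_on_def)
  show add: "x + y \<in> carrier (free_alg X)" if "x \<in> carrier (free_alg X)" "y \<in> carrier (free_alg X)" for x y :: "('x, 'k) falg"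
    using a_closed[OF that] by (simp add: free_alg_def ring_on_def)
  show "x \<in> carrier (free_alg X) \<Longrightarrow> y \<in> carrier (free_alg X) \<Longrightarrow> x - y \<in> carrier (free_alg X)"
    using keys_diff[of x y] unfolding c by blast
  show "x \<in> carrier (free_alg X) \<Longrightarrow> y \<in> carrier (free_alg X) \<Longrightarrow> x * y \<in> carrier (free_alg X)"
    using m_closed[of x y] by (simp add: free_alg_def ring_on_def)
  show z: "0 \<in> carrier (free_alg X :: ('x, 'k) falg ring)" by (simp add: c)
  show "(\<And>i. i \<in> A \<Longrightarrow> f i \<in> carrier (free_alg X)) \<Longrightarrow> (\<Sum>i\<in>A. f i :: ('x, 'k) falg) \<in> carrier (free_alg X)"
    by (induction A rule: infinite_finite_induct) (simp_all add: z add)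
qed (simp_all add: free_alg_def ring_on_def scal_def gen_def zero_list_def)

lemma entries_in_mult: "entries_in X A \<Longrightarrow> entries_in X B \<Longrightarrow> entries_in X (A \<otimes>\<^bsub>tend N m\<^esub> B)"
  by (simp add: entries_in_def tend_simps free_alg_closed)

lemma entries_in_tprod: "(\<And>A. A \<in> set As \<Longrightarrow> entries_in X A) \<Longrightarrow> entries_in X (tprod N m As)"
  by (induction As) (simp_all add: tprod_simps entries_in_mult, simp add: entries_in_def tend_simps free_alg_closed)

lemma entries_in_lift: "entries_in X (lift A)"
  by (simp add: entries_in_def lift_def free_alg_closed)

lemma entries_in_at1:
  "(\<And>a b. a \<in> {1..N} \<Longrightarrow> b \<in> {1..N} \<Longrightarrow> K a b \<in> carrier (free_alg X)) \<Longrightarrow> k \<in> {1..m} \<Longrightarrow> entries_in X (at1 N m k K)"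
  using midx_in by (auto simp: entries_in_def at1_def free_alg_closed)

lemma entries_in_kbar:
  assumes "\<And>a b. a \<in> {1..N} \<Longrightarrow> b \<in> {1..N} \<Longrightarrow> K a b \<in> carrier (free_alg X)" "Suc n \<le> m"
  shows "entries_in X (kbar N m K (Suc n))"
  using assms(2)
proof (induction n)
  case 0
  then show ?case using assms(1) by (auto intro: entries_in_at1)
next
  case (Suc n)
  then show ?case by (auto intro!: entries_in_tprod entries_in_lift)
qed

lemma qtrace_carrier: "entries_in X A \<Longrightarrow> qtrace N m A \<in> carrier (free_alg X)"
proof -
  assume "entries_in X A"
  then have "entries_in X (tprod N m (map (\<lambda>k. lift (at1 N m k (Dmat N))) [1..<Suc m]) \<otimes>\<^bsub>tend N m\<^esub> A)"
    by (intro entries_in_mult entries_in_tprod) (auto intro: entries_in_lift)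
  then show ?thesis by (auto simp: qtrace_def ttrace_def entries_in_def intro: free_alg_closed)
qed

lemma qtrace_eq: "qtrace N m A = (\<Sum>I\<in>midx N m. scal (\<Prod>k\<in>{1..m}. Dmat N (I k) (I k)) * A I I)"
proof -
  obtain diag :: "((nat \<Rightarrow> nat) \<Rightarrow> Cq) \<Rightarrow> ('a, Cq) falg tmat"
    where diag: "\<And>f I J. diag f I J = (if I \<in> midx N m \<and> I = J then scal (f I) else 0)"
    by (rule that[of "\<lambda>f I J. if I \<in> midx N m \<and> I = J then scal (f I) else 0"]) simp
  have D: "lift (at1 N m k (Dmat N)) = diag (\<lambda>I. Dmat N (I k) (I k))" if "k \<in> {1..m}" for k
  proof (intro ext)
    fix I J
    show "lift (at1 N m k (Dmat N)) I J = diag (\<lambda>I. Dmat N (I k) (I k)) I J"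
    proof (cases "I \<in> midx N m \<and> J \<in> midx N m \<and> (\<forall>l\<in>{1..m} - {k}. I l = J l)")
      case True
      then have "I = J" if "I k = J k" using that by (intro midx_ext[of I N m J]) auto
      then show ?thesis using True by (auto simp: lift_def at1_def Dmat_def scal_zero diag)
    qed (auto simp: lift_def at1_def scal_zero diag)
  qed
  have mult: "diag f \<otimes>\<^bsub>tend N m\<^esub> diag h = diag (\<lambda>I. f I * h I)" for f h
  proof (intro ext)
    fix I J
    have "(diag f \<otimes>\<^bsub>tend N m\<^esub> diag h) I J = (\<Sum>K\<in>midx N m. if K = I then diag (\<lambda>I. f I * h I) I J else 0)"
      unfolding tend_simps by (intro sum.cong refl) (auto simp: scal_mult diag)
    then show "(diag f \<otimes>\<^bsub>tend N m\<^esub> diag h) I J = diag (\<lambda>I. f I * h I) I J" by (auto simp: diag)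
  qed
  have "tprod N m (map (\<lambda>k. lift (at1 N m k (Dmat N))) ks) = diag (\<lambda>I. \<Prod>k\<leftarrow>ks. Dmat N (I k) (I k))"
    if "set ks \<subseteq> {1..m}" for ks
    using that
  proof (induction ks)
    case (Cons k ks)
    then have "k \<in> {1..m}" "set ks \<subseteq> {1..m}" by auto
    then show ?case by (simp only: list.map tprod_simps D Cons.IH mult prod_list.Cons)
  qed (simp add: tprod_simps tend_simps(2) scal_one diag fun_eq_iff)
  from this[of "[1..<Suc m]"]
  have T: "tprod N m (map (\<lambda>k. lift (at1 N m k (Dmat N))) [1..<Suc m]) = diag (\<lambda>I. \<Prod>k\<in>{1..m}. Dmat N (I k) (I k))"
    by (simp add: prod.distinct_set_conv_list[symmetric] atLeastLessThanSuc_atLeastAtMost del: upt_Suc)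
  show ?thesis unfolding qtrace_def ttrace_def T
  proof (intro sum.cong refl)
    fix I assume I: "I \<in> midx N m"
    let ?f = "\<lambda>I. \<Prod>k\<in>{1..m}. Dmat N (I k) (I k)"
    have "(diag ?f \<otimes>\<^bsub>tend N m\<^esub> A) I I = (\<Sum>K\<in>midx N m. if K = I then scal (?f I) * A I I else 0)"
      unfolding tend_simps using I by (intro sum.cong refl) (auto simp: diag)
    then show "(diag ?f \<otimes>\<^bsub>tend N m\<^esub> A) I I = scal (?f I) * A I I"
      using I by simp
  qed
qed

lemma presentation_re: "presentation (gl_gens N) (re_rels N)"
proof
  let ?R = "lift (Rop N 2 1) :: (nat \<times> nat, Cq) falg tmat" and ?M = "at1 N 2 1 Mmat"
  have M: "entries_in (gl_gens N) ?M"
    by (rule entries_in_at1) (auto simp: Mmat_def gl_gens_def intro: free_alg_closed)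
  have "entries_in (gl_gens N) (tprod N 2 [?R, ?M, ?R, ?M])" "entries_in (gl_gens N) (tprod N 2 [?M, ?R, ?M, ?R])"
    by (rule entries_in_tprod, simp only: list.set, blast intro: M entries_in_lift)+
  then show "re_rels N \<subseteq> carrier (free_alg (gl_gens N))"
    by (auto simp: re_rels_def Let_def entries_in_def intro: free_alg_closed)
  have sum: "augm (\<Sum>i\<in>A. f i) = (\<Sum>i\<in>A. augm (f i :: (nat \<times> nat, Cq) falg))" for A :: "(nat \<Rightarrow> nat) set" and f
    using augm_hom(1)[of "0 :: (nat \<times> nat, Cq) falg" 0] by (induction A rule: infinite_finite_induct) (simp_all add: augm_hom)
  have "augm (0 :: (nat \<times> nat, Cq) falg) = 0"
    using augm_hom(1)[of "0 :: (nat \<times> nat, Cq) falg" 0] by simp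
  \<comment> \<open>Both sides of every relation contain the matrix M, whose entries have no
    constant term.\<close>
  then have "augm (?M I J) = 0" for I J
    by (simp add: at1_def Mmat_def augm_hom)
  then have "augm (tprod N 2 (?M # As) I J) = 0" for As I J
    by (simp add: tprod_simps tend_simps(1) sum augm_hom)
  moreover from this have "augm (tprod N 2 (A # ?M # As) I J) = 0" for A As I J
    by (subst tprod_simps) (simp add: tend_simps(1) sum augm_hom)
  moreover have "augm (x - y) = augm x - augm y" for x y :: "(nat \<times> nat, Cq) falg"
    using augm_hom(1)[of "x - y" y] by (simp add: eq_diff_eq)
  ultimately show "augm p = 0" if "p \<in> re_rels N" for p
    using that by (auto simp: re_rels_def Let_def)
qed

section \<open>Traces of operators given by matrices\<close>

locale tensor_tower = tensor_algebra N S t + markov_tower "\<lambda>b x. \<eta> (scal b) * x" t R X lev \<tau> a \<delta>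
  for N and S :: "(nat \<times> nat, 'k::field) falg set" and t :: 'k and X :: "nat \<Rightarrow> (nat \<times> nat, 'k::field) falg quotients endo" and a
begin

lemma \<tau>_e: "\<tau> m (e m i j) = (if i = j \<and> i \<in> {1..N} then d i \<cdot> 1 else 0)"
proof -
  have "\<tau> m (e m i j) = (\<Sum>y\<in>{1..N}. \<Sum>x\<in>{1..N}. if x = i then if i = j then d i \<cdot> e m y y else 0 else 0)"
    unfolding \<tau>_def
  proof (intro sum.cong refl)
    fix x y assume "x \<in> {1..N}" "y \<in> {1..N}"
    then show "d x \<cdot> (e m y x * e m i j * e m x y) = (if x = i then if i = j then d i \<cdot> e m y y else 0 else 0)"
      by (cases "j = x") (auto simp: e_mult e_mult_left mult.assoc e_diff)
  qed
  also have "\<dots> = (\<Sum>y\<in>{1..N}. if i = j \<and> i \<in> {1..N} then d i \<cdot> e m y y else 0)"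
    by (intro sum.cong refl) simp
  also have "\<dots> = (if i = j \<and> i \<in> {1..N} then d i \<cdot> (\<Sum>y\<in>{1..N}. e m y y) else 0)"
    by (cases "i = j"; cases "j \<in> {1..N}"; simp only: simp_thms if_True if_False sum.neutral_const sum_distrib_left)
  finally show ?thesis by (simp only: e_sum)
qed

lemma tr_zero: "tr m 0 = 0"
  using tr_add[of m 0 0] by simp

lemma tr_u: "tr m (u m I J) = (if \<forall>k\<in>{1..m}. I k = J k \<and> I k \<in> {1..N} then (\<Prod>k\<in>{1..m}. d (I k)) \<cdot> 1 else 0)"
proof (induction m)
  case (Suc m)
  have "tr (Suc m) (u (Suc m) I J) = tr m (u m I J * \<tau> m (e m (I (Suc m)) (J (Suc m))))"
    by (simp add: \<tau>_left[OF u_lev])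
  also have "\<dots> = (if I (Suc m) = J (Suc m) \<and> I (Suc m) \<in> {1..N} then d (I (Suc m)) \<cdot> tr m (u m I J) else 0)"
    by (simp add: \<tau>_e tr_sc[of _ "d _" "u m I J", symmetric] \<eta>_u tr_zero)
  finally show ?case using Suc by (auto simp: atLeastAtMostSuc_conv scal_mult \<eta>_hom mult.assoc)
qed (simp add: scal_one \<eta>_hom)

lemma tr_sum: "tr m (\<Sum>i\<in>A. f i) = (\<Sum>i\<in>A. tr m (f i))"
  by (induction A rule: infinite_finite_induct) (simp_all add: tr_add tr_zero)

lemma tr_\<eta>: "tr m (\<eta> p * x) = \<eta> p * tr m x"
  by (induction m arbitrary: x) (simp_all add: \<tau>_left[OF \<eta>_lev])

lemma tr_\<Phi>: "tr m (\<Phi> m A) = (\<Sum>I\<in>midx N m. \<eta> (A I I) * ((\<Prod>k\<in>{1..m}. d (I k)) \<cdot> 1))"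
proof -
  have "tr m (\<Phi> m A) = (\<Sum>I\<in>midx N m. \<Sum>J\<in>midx N m. if J = I then \<eta> (A I I) * ((\<Prod>k\<in>{1..m}. d (I k)) \<cdot> 1) else 0)"
    unfolding \<Phi>_def tr_sum tr_\<eta> tr_u
  proof (intro sum.cong refl)
    fix I J assume IJ: "I \<in> midx N m" "J \<in> midx N m"
    then have "(\<forall>k\<in>{1..m}. I k = J k \<and> I k \<in> {1..N}) \<longleftrightarrow> J = I"
      using midx_ext[OF IJ] midx_in[OF IJ(1)] by auto
    then show "\<eta> (A I J) * (if \<forall>k\<in>{1..m}. I k = J k \<and> I k \<in> {1..N} then (\<Prod>k\<in>{1..m}. d (I k)) \<cdot> 1 else 0) =
      (if J = I then \<eta> (A I I) * ((\<Prod>k\<in>{1..m}. d (I k)) \<cdot> 1) else 0)" by auto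
  qed
  then show ?thesis by simp
qed

end

lemma Rmat_eq:
  assumes "a \<in> {1..N}" "b \<in> {1..N}" "c \<in> {1..N}" "d \<in> {1..N}"
  shows "Rmat N (a, b) (c, d) = (if a = c \<and> b = d then if a = b then q else if a < b then q - inverse q else 0
     else if a = d \<and> b = c then 1 else 0)"
proof -
  have 1: "(\<Sum>i\<in>{1..N}. munit i i a c * munit i i b d) = (if a = b \<and> a = c \<and> b = d then 1 else 0 :: Cq)"
  proof -
    have "(\<Sum>i\<in>{1..N}. munit i i a c * munit i i b d) = (\<Sum>i\<in>{1..N}. if i = a then if a = b \<and> a = c \<and> b = d then 1 else 0 else 0 :: Cq)"
      by (intro sum.cong) (auto simp: munit_def)
    then show ?thesis using assms by simp
  qed
  have 2: "(\<Sum>i\<in>{1..N}. \<Sum>j\<in>{1..N} - {i}. munit i j a c * munit j i b d) = (if a \<noteq> c \<and> a = d \<and> b = c then 1 else 0 :: Cq)"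
  proof -
    have "(\<Sum>i\<in>{1..N}. \<Sum>j\<in>{1..N} - {i}. munit i j a c * munit j i b d) =
       (\<Sum>i\<in>{1..N}. if i = a then \<Sum>j\<in>{1..N} - {i}. if j = c then if a = d \<and> b = c then 1 else 0 else 0 else 0 :: Cq)"
    proof (rule sum.cong[OF refl])
      fix i
      have "munit i j a c * munit j i b d = (if i = a then if j = c then if a = d \<and> b = c then 1 else 0 else 0 else 0 :: Cq)" for j
        by (simp add: munit_def)
      then show "(\<Sum>j\<in>{1..N} - {i}. munit i j a c * munit j i b d) =
          (if i = a then \<Sum>j\<in>{1..N} - {i}. if j = c then if a = d \<and> b = c then 1 else 0 else 0 else 0 :: Cq)"
        by (cases "i = a") (simp_all only: simp_thms if_True if_False sum.neutral_const)
    qed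
    then show ?thesis using assms by auto
  qed
  have 3: "(\<Sum>i\<in>{1..N}. \<Sum>j\<in>{i<..N}. munit i i a c * munit j j b d) = (if a < b \<and> a = c \<and> b = d then 1 else 0 :: Cq)"
  proof -
    have "(\<Sum>i\<in>{1..N}. \<Sum>j\<in>{i<..N}. munit i i a c * munit j j b d) =
       (\<Sum>i\<in>{1..N}. if i = a then \<Sum>j\<in>{i<..N}. if j = b then if a = c \<and> b = d then 1 else 0 else 0 else 0 :: Cq)"
    proof (rule sum.cong[OF refl])
      fix i
      have "munit i i a c * munit j j b d = (if i = a then if j = b then if a = c \<and> b = d then 1 else 0 else 0 else 0 :: Cq)" for j
        by (simp add: munit_def)
      then show "(\<Sum>j\<in>{i<..N}. munit i i a c * munit j j b d) =
          (if i = a then \<Sum>j\<in>{i<..N}. if j = b then if a = c \<and> b = d then 1 else 0 else 0 else 0 :: Cq)"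
        by (cases "i = a") (simp_all only: simp_thms if_True if_False sum.neutral_const)
    qed
    then show ?thesis using assms by auto
  qed
  consider "c = a" "d = b" | "c = b" "d = a" "a \<noteq> b" | "\<not> (a = c \<and> b = d)" "\<not> (a = d \<and> b = c)" by blast
  then show ?thesis unfolding Rmat_def prod.case 1 2 3
  proof cases
    case 3
    then have "\<not> (a = b \<and> a = c \<and> b = d)" "\<not> (a \<noteq> c \<and> a = d \<and> b = c)" "\<not> (a < b \<and> a = c \<and> b = d)" by blast+
    with 3 show "q * (if a = b \<and> a = c \<and> b = d then 1 else 0) + (if a \<noteq> c \<and> a = d \<and> b = c then 1 else 0) +
      (q - inverse q) * (if a < b \<and> a = c \<and> b = d then 1 else 0) =
      (if a = c \<and> b = d then if a = b then q else if a < b then q - inverse q else 0 else if a = d \<and> b = c then 1 else 0)"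
      by (simp only: if_False mult_zero_right add_0)
  qed simp_all
qed

section \<open>The reflection equation algebra\<close>

locale quantum =
  fixes N :: nat
  assumes N1: "N \<ge> 1"
begin

sublocale tensor_algebra N "re_rels N" q
  by (intro tensor_algebra.intro tensor_algebra_axioms.intro presentation_re N1 q_nz qn_q_nz)

notation sc (infixr "\<cdot>" 75)

abbreviation \<kappa> :: Cq where "\<kappa> \<equiv> q - inverse q"

lemma \<Phi>_R:
  assumes "Suc k < m"
  shows "\<Phi> m (lift (Rop N m (Suc k))) = R k"
  unfolding Rop_def \<Phi>_at2[OF assms] R_def by (intro sum.cong refl) (simp only: Rmat_eq r_def)

lemma \<Phi>_R':
  assumes "1 \<le> i" "i < m"
  shows "\<Phi> m (lift (Rop N m i)) = R (i - 1)"
  using \<Phi>_R[of "i - 1" m] assms by simp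

definition Mel where "Mel = (\<Sum>a\<in>{1..N}. \<Sum>b\<in>{1..N}. \<eta> (Mmat a b) * e 0 a b)"
definition Lel where "Lel = (\<Sum>a\<in>{1..N}. \<Sum>b\<in>{1..N}. \<eta> (Lmat a b) * e 0 a b)"

lemma Mel_lev: "Mel \<in> lev 1"
  unfolding Mel_def by (intro lev_sum lev_mult \<eta>_lev e_lev) simp

lemma Lel_eq: "Lel = (1 / \<kappa>) \<cdot> (1 - Mel)"
proof -
  have "Lel = (\<Sum>a\<in>{1..N}. \<Sum>b\<in>{1..N}. (1 / \<kappa>) \<cdot> ((if b = a then e 0 a a else 0) - \<eta> (Mmat a b) * e 0 a b))"
    unfolding Lel_def Lmat_def by (intro sum.cong refl) (auto simp: \<eta>_hom \<eta>_diff mult.assoc left_diff_distrib)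
  also have "\<dots> = (1 / \<kappa>) \<cdot> ((\<Sum>a\<in>{1..N}. \<Sum>b\<in>{1..N}. if b = a then e 0 a a else 0) - Mel)"
    unfolding Mel_def sum_subtractf[symmetric] sum_distrib_left ..
  also have "(\<Sum>a\<in>{1..N}. \<Sum>b\<in>{1..N}. if b = a then e 0 a a else 0) = 1"
    using e_sum by simp
  finally show ?thesis .
qed

lemma reflection: "R 0 * Mel * R 0 * Mel = Mel * R 0 * Mel * R 0"
proof -
  let ?R = "lift (Rop N 2 1)" and ?M = "at1 N 2 1 Mmat"
  have "\<Phi> 2 (tprod N 2 [?R, ?M, ?R, ?M]) = \<Phi> 2 (tprod N 2 [?M, ?R, ?M, ?R])"
    unfolding \<Phi>_def
  proof (intro sum.cong refl)
    fix I J assume "I \<in> midx N 2" "J \<in> midx N 2"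
    then have "tprod N 2 [?R, ?M, ?R, ?M] I J - tprod N 2 [?M, ?R, ?M, ?R] I J \<in> re_rels N"
      unfolding re_rels_def Let_def by blast
    from \<eta>_S[OF this]
    show "\<eta> (tprod N 2 [?R, ?M, ?R, ?M] I J) * u 2 I J = \<eta> (tprod N 2 [?M, ?R, ?M, ?R] I J) * u 2 I J"
      by (simp add: \<eta>_diff)
  qed
  moreover have "\<Phi> 2 ?R = R 0" using \<Phi>_R[of 0 2] by simp
  moreover have "\<Phi> 2 ?M = Mel" using \<Phi>_at1[of 0 2 Mmat] by (simp add: Mel_def)
  ultimately show ?thesis by (simp add: \<Phi>_tprod mult.assoc)
qed

text \<open>The tower of M, with all shifts 0, serves the p_k and their centrality; the averages
  belong to the tower of L. The partial traces are the same in both.\<close>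

sublocale M: tensor_tower N "re_rels N" q "Xs Mel" "\<lambda>_. 0"
proof (intro tensor_tower.intro tensor_algebra_axioms markov Mel_lev)
  show "e n a b = 0" if "a \<notin> {1..N} \<or> b \<notin> {1..N}" for n a b
    using that by (rule eunit_out)
  show "(R 0 + inverse q \<cdot> 1) * ((Mel + 0 \<cdot> 1) * (Xs Mel 1 + 0 \<cdot> 1)) * (R 0 - q \<cdot> 1) = 0"
    using absorb_of_reflection[OF reflection, of 0] by simp
qed

text \<open>With this choice L plus \<open>shift j\<close> is a multiple of M - q^(2j), so that
  consecutive shifts fit \<open>absorb_of_reflection\<close>. The limit at q = 1 is the classical
  shift j.\<close>

definition shift :: "nat \<Rightarrow> Cq" where
  "shift j = (q ^ (2 * j) - 1) / \<kappa>"

sublocale L: tensor_tower N "re_rels N" q "Xs Lel" shift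
proof (intro tensor_tower.intro tensor_algebra_axioms markov)
  show "Lel \<in> lev 1"
  proof -
    have "1 - Mel \<in> lev 1" using Mel_lev by (simp add: lev_def left_diff_distrib right_diff_distrib)
    then show ?thesis unfolding Lel_eq by (rule lev_sc)
  qed
  show "e n a b = 0" if "a \<notin> {1..N} \<or> b \<notin> {1..N}" for n a b
    using that by (rule eunit_out)
  fix j
  let ?P = "R 0 + inverse q \<cdot> 1" and ?Q = "R 0 - q \<cdot> 1"
  have sh: "shift j = inverse \<kappa> * (q ^ (2 * j) - 1)" for j by (simp add: shift_def divide_inverse)
  have \<kappa>: "1 / \<kappa> = inverse \<kappa>" by (simp add: divide_inverse)
  have "Lel + shift j \<cdot> 1 = (- (1 / \<kappa>)) \<cdot> (Mel + (- (q ^ (2 * j))) \<cdot> 1)"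
    unfolding Lel_eq sh \<kappa> by (rule sc_shift)
  moreover have "Xs Lel 1 + shift (Suc j) \<cdot> 1 = (- (1 / \<kappa>)) \<cdot> (R 0 * Mel * ginv 0 + (q * q * (- (q ^ (2 * j)))) \<cdot> 1)"
  proof -
    have "Xs Lel 1 = inverse \<kappa> \<cdot> (R 0 * (1 - Mel) * ginv 0)"
      unfolding Lel_eq One_nat_def Xs.simps sc_mult_right sc_mult_left \<kappa> ..
    also have "R 0 * (1 - Mel) * ginv 0 = 1 - R 0 * Mel * ginv 0"
      by (simp add: right_diff_distrib left_diff_distrib)
    finally have X: "Xs Lel 1 = inverse \<kappa> \<cdot> (1 - R 0 * Mel * ginv 0)" .
    have "q * q * (- (q ^ (2 * j))) = - (q ^ (2 * Suc j))" by simp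
    then show ?thesis unfolding X sh \<kappa> by (simp only: sc_shift)
  qed
  ultimately show "?P * ((Lel + shift j \<cdot> 1) * (Xs Lel 1 + shift (Suc j) \<cdot> 1)) * ?Q = 0"
    by (simp only: sc_sandwich absorb_of_reflection[OF reflection] mult_zero_right)
qed

lemma Dmat_eq: "Dmat N a a = d a"
proof -
  have "2 * int a - 1 - 2 * int N = int (2 * a) - int (2 * N + 1)" by simp
  then show ?thesis
    by (simp only: Dmat_def d_def power_int_diff power_int_of_nat q_nz power_inverse divide_inverse if_True simp_thms)
qed

lemma \<eta>_qtrace: "\<eta> (qtrace N m A) = M.tr m (\<Phi> m A)"
  unfolding M.tr_\<Phi> qtrace_eq Dmat_eq \<eta>_sum \<eta>_hom
  using \<eta>_central by (intro sum.cong refl) simp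

lemma Rop_carrier: "Rop N m i \<in> carrier (tend N m)"
  by (simp add: Rop_def at2_def tend_def)

text \<open>By the quadratic relation the inverse is R minus a scalar; this is checked on operators
  and carried back by \<open>\<Phi>_lift_inj\<close>.\<close>

lemma inv_Rop:
  assumes "Suc k < m"
  shows "\<Phi> m (lift (inv\<^bsub>tend N m\<^esub> (Rop N m (Suc k)))) = ginv k"
proof -
  interpret T: ring "tend N m :: Cq tmat ring" by (rule ring_tend)
  let ?R = "Rop N m (Suc k)" and ?one = "\<one>\<^bsub>tend N m\<^esub> :: Cq tmat"
  define B where "B = (\<lambda>I J. ?R I J - \<kappa> * ?one I J)"
  have B: "B \<in> carrier (tend N m)"
    using Rop_carrier[of m "Suc k"] by (auto simp: B_def tend_def)
  have \<Phi>B: "\<Phi> m (lift B) = ginv k"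
  proof -
    have "\<Phi> m (lift B) = \<Phi> m (lift ?R) - \<kappa> \<cdot> \<Phi> m (lift ?one)"
      unfolding \<Phi>_def sum_distrib_left sum_subtractf[symmetric] B_def lift_def
      by (intro sum.cong refl) (simp only: scal.c_diff scal_mult \<eta>_hom(2) \<eta>_diff left_diff_distrib mult.assoc)
    then show ?thesis by (simp only: \<Phi>_R[OF assms] lift_one \<Phi>_one ginv_def)
  qed
  have "?R \<otimes>\<^bsub>tend N m\<^esub> B = ?one"
    by (rule \<Phi>_lift_inj[of _ m]) (simp_all add: T.m_closed T.one_closed B Rop_carrier lift_mult lift_one \<Phi>_mult \<Phi>_one \<Phi>B \<Phi>_R[OF assms])
  moreover have "B \<otimes>\<^bsub>tend N m\<^esub> ?R = ?one"
    by (rule \<Phi>_lift_inj[of _ m]) (simp_all add: T.m_closed T.one_closed B Rop_carrier lift_mult lift_one \<Phi>_mult \<Phi>_one \<Phi>B \<Phi>_R[OF assms])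
  ultimately have "inv\<^bsub>tend N m\<^esub> ?R = B" by (intro T.inv_char Rop_carrier B)
  then show ?thesis by (simp add: \<Phi>B)
qed

lemma \<Phi>_kbar:
  assumes "Suc n \<le> m"
  shows "\<Phi> m (kbar N m K (Suc n)) = Xs (\<Sum>a\<in>{1..N}. \<Sum>b\<in>{1..N}. \<eta> (K a b) * e 0 a b) n"
  using assms
proof (induction n)
  case 0
  then show ?case using \<Phi>_at1[of 0 m K] by simp
next
  case (Suc n)
  then show ?case by (simp add: \<Phi>_tprod \<Phi>_R inv_Rop mult.assoc)
qed

lemma prod_kbar: "prod_list (map (\<Phi> m) (map (kbar N m K) [1..<Suc m])) =
    M.asc (Xs (\<Sum>a\<in>{1..N}. \<Sum>b\<in>{1..N}. \<eta> (K a b) * e 0 a b)) 0 m"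
proof -
  have "map (\<Phi> m) (map (kbar N m K) [1..<Suc m]) = map (\<lambda>n. \<Phi> m (kbar N m K (Suc n))) [0..<m]"
    by (simp add: map_Suc_upt[symmetric] o_def del: upt_Suc)
  also have "\<dots> = map (Xs (\<Sum>a\<in>{1..N}. \<Sum>b\<in>{1..N}. \<eta> (K a b) * e 0 a b)) [0..<m]"
    by (intro map_cong refl \<Phi>_kbar) simp
  finally show ?thesis by (simp add: M.asc_def)
qed

definition psum_rep where
  "psum_rep k = qtrace N k (tprod N k (map (kbar N k Mmat) [1..<Suc k] @ map (\<lambda>i. lift (Rop N k i)) (rev [1..<k])))"

lemma psum_classof: "psum N k = classof (psum_rep k)"
  by (simp add: psum_def psum_rep_def classof_def)

lemma Mmat_carrier: "a \<in> {1..N} \<Longrightarrow> b \<in> {1..N} \<Longrightarrow> Mmat a b \<in> carrier (free_alg (gl_gens N))"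
  by (auto simp: Mmat_def gl_gens_def intro: free_alg_closed)

lemma entries_in_kbar':
  assumes "\<And>a b. a \<in> {1..N} \<Longrightarrow> b \<in> {1..N} \<Longrightarrow> K a b \<in> carrier (free_alg X)" "k \<in> set [1..<Suc m]"
  shows "entries_in X (kbar N m K k)"
  using entries_in_kbar[of N K X "k - 1" m] assms by auto

lemma psum_rep_carrier: "psum_rep k \<in> carrier (free_alg (gl_gens N))"
  unfolding psum_rep_def
  by (intro qtrace_carrier entries_in_tprod)
    (auto intro: entries_in_lift entries_in_kbar'[OF Mmat_carrier])

lemma desc_map: "prod_list (map (\<lambda>i. R (i - 1)) (rev [1..<Suc k])) = M.desc 0 k"
  by (induction k) simp_all

lemma \<eta>_psum:
  assumes "k \<ge> 1"
  shows "\<eta> (psum_rep k) = \<tau> 0 (Mel ^ k)"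
proof -
  obtain j where j: "k = Suc j" using assms by (cases k) auto
  have "map (\<Phi> k) (map (\<lambda>i. lift (Rop N k i)) (rev [1..<k])) = map (\<lambda>i. R (i - 1)) (rev [1..<k])"
    unfolding map_map o_def by (intro map_cong refl \<Phi>_R') auto
  then have P: "prod_list (map (\<Phi> k) (map (\<lambda>i. lift (Rop N k i)) (rev [1..<k]))) = M.desc 0 j"
    by (simp only: desc_map j)
  have "\<Phi> k (tprod N k (map (kbar N k Mmat) [1..<Suc k] @ map (\<lambda>i. lift (Rop N k i)) (rev [1..<k]))) =
      M.asc (Xs Mel) 0 k * M.desc 0 j"
    unfolding \<Phi>_tprod map_append prod_list.append prod_kbar Mel_def[symmetric] P ..
  then have "\<eta> (psum_rep k) = M.tr (Suc j) (M.asc (Xs Mel) 0 (Suc j) * M.desc 0 j)"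
    by (simp add: psum_rep_def \<eta>_qtrace j del: M.tr.simps)
  also have "\<dots> = \<tau> 0 (Mel ^ Suc j)"
    unfolding M.tr_asc_desc by simp
  finally show ?thesis by (simp only: j)
qed

end

section \<open>The quantum weight system\<close>

context markov_tower
begin

text \<open>By g = g^(-1) + (t - 1/t) this conjugate differs from the one in
  \<open>\<tau>_conj\<close> by a multiple of g x - x g, whose partial trace is x - x.\<close>

lemma \<tau>_conj_inv:
  assumes x: "x \<in> lev (Suc n)"
  shows "\<tau> (Suc n) (ginv n * x * g n) = \<tau> n x"
proof -
  let ?l = "t - inverse t"
  have g: "g n = ginv n + ?l \<cdot> 1" by (simp add: ginv_def)
  have 1: "\<tau> (Suc n) (g n * x) = x" using \<tau>_right[OF x, of "g n"] by (simp add: \<tau>_g)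
  have 2: "\<tau> (Suc n) (x * g n) = x" using \<tau>_left[OF x, of "g n"] by (simp add: \<tau>_g)
  have 3: "\<tau> (Suc n) x = \<delta> \<cdot> x" using \<tau>_left[OF x, of 1] by (simp add: \<tau>_one)
  have m: "\<tau> k (y - z) = \<tau> k y - \<tau> k z" for k y z
    using \<tau>_add[of k "y - z" z] by (simp add: eq_diff_eq)
  have "ginv n * x * g n = g n * x * ginv n + (?l \<cdot> (g n * x) - ?l \<cdot> (x * g n))"
    by (simp add: ginv_def algebra_simps)
  then show ?thesis by (simp only: \<tau>_add m \<tau>_sc 1 2 \<tau>_conj[OF x]) simp
qed

lemma hs_1: "hs (Suc 0) = 1"
  by (simp add: hs.simps(2) qn_Suc)

end

context tensor_algebra
begin

lemma entry_extract:
  assumes "a \<in> {1..N}" "b \<in> {1..N}"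
  shows "(\<Sum>c\<in>{1..N}. e n c a * (\<Sum>i\<in>{1..N}. \<Sum>j\<in>{1..N}. \<eta> (K i j) * e n i j) * e n b c) = \<eta> (K a b)"
proof -
  have *: "e n c a * (\<eta> (K i j) * e n i j) * e n b c = (if i = a then if j = b then \<eta> (K a b) * e n c c else 0 else 0)"
    if "i \<in> {1..N}" "j \<in> {1..N}" for c i j
  proof -
    have "e n c a * (\<eta> (K i j) * e n i j) * e n b c = \<eta> (K i j) * (e n c a * (e n i j * e n b c))"
      by (simp only: \<eta>_e_left mult.assoc)
    then show ?thesis using that assms by (auto simp: e_mult)
  qed
  have "e n c a * (\<Sum>i\<in>{1..N}. \<Sum>j\<in>{1..N}. \<eta> (K i j) * e n i j) * e n b c = \<eta> (K a b) * e n c c" for c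
  proof -
    have "e n c a * (\<Sum>i\<in>{1..N}. \<Sum>j\<in>{1..N}. \<eta> (K i j) * e n i j) * e n b c =
      (\<Sum>i\<in>{1..N}. \<Sum>j\<in>{1..N}. if i = a then if j = b then \<eta> (K a b) * e n c c else 0 else 0)"
      unfolding sum_distrib_left sum_distrib_right by (intro sum.cong refl *)
    also have "\<dots> = (\<Sum>i\<in>{1..N}. if i = a then \<Sum>j\<in>{1..N}. if j = b then \<eta> (K a b) * e n c c else 0 else 0)"
      by (intro sum.cong refl) simp
    finally show ?thesis using assms by simp
  qed
  then have "(\<Sum>c\<in>{1..N}. e n c a * (\<Sum>i\<in>{1..N}. \<Sum>j\<in>{1..N}. \<eta> (K i j) * e n i j) * e n b c) = \<eta> (K a b) * (\<Sum>c\<in>{1..N}. e n c c)"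
    by (simp only: sum_distrib_left)
  then show ?thesis by (simp only: e_sum mult_1_right)
qed

text \<open>Matrix units on both sides extract each generator from the matrix of all generators, so
  it suffices to commute with that matrix.\<close>

lemma central_of_commute:
  assumes z: "\<eta> p \<in> lev 0" and p: "p \<in> carrier (free_alg (gl_gens N))"
    and c: "\<eta> p * (\<Sum>i\<in>{1..N}. \<Sum>j\<in>{1..N}. \<eta> (gen (i, j)) * e 0 i j) = (\<Sum>i\<in>{1..N}. \<Sum>j\<in>{1..N}. \<eta> (gen (i, j)) * e 0 i j) * \<eta> p"
  shows "central p"
  unfolding central_def
proof (intro conjI ballI p)
  fix x assume "x \<in> gl_gens N"
  then obtain a b where x: "x = (a, b)" and ab: "a \<in> {1..N}" "b \<in> {1..N}" by (auto simp: gl_gens_def)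
  define X where "X = (\<Sum>i\<in>{1..N}. \<Sum>j\<in>{1..N}. \<eta> (gen (i, j)) * e 0 i j)"
  have *: "\<eta> p * (e 0 c a * X * e 0 b c) = (e 0 c a * X * e 0 b c) * \<eta> p" for c
  proof -
    have "\<eta> p * (e 0 c a * X * e 0 b c) = e 0 c a * (\<eta> p * X) * e 0 b c"
      using levD[OF z, of 0 c a] by (simp only: mult.assoc[symmetric])
    also have "\<dots> = e 0 c a * X * (\<eta> p * e 0 b c)"
      by (simp only: c[folded X_def] mult.assoc)
    also have "\<eta> p * e 0 b c = e 0 b c * \<eta> p" using levD[OF z, of 0 b c] by simp
    finally show ?thesis by (simp only: mult.assoc)
  qed
  have "\<eta> p * (\<Sum>c\<in>{1..N}. e 0 c a * X * e 0 b c) = (\<Sum>c\<in>{1..N}. e 0 c a * X * e 0 b c) * \<eta> p"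
    by (simp only: sum_distrib_left sum_distrib_right *)
  then show "\<eta> p * \<eta> (gen x) = \<eta> (gen x) * \<eta> p"
    unfolding X_def entry_extract[OF ab, of 0 "\<lambda>i j. gen (i, j)"] x .
qed

end

context quantum
begin

interpretation cs: central_hom "\<lambda>b. \<eta> (scal b)"
  by unfold_locales (simp only: scal_add \<eta>_hom(1), simp only: scal_mult \<eta>_hom(2), simp only: scal_one \<eta>_hom(3), rule \<eta>_central)

section \<open>The Hecke algebra acting through R\<close>

definition ev :: "(nat, Cq) falg \<Rightarrow> (nat \<times> nat, Cq) falg quotients endo" where
  "ev = plin (\<lambda>b. \<eta> (scal b)) (\<lambda>w. prod_list (map (\<lambda>i. R (i - 1)) w))"

lemma ev_hom: "ev (p + p') = ev p + ev p'" "ev (p * p') = ev p * ev p'" "ev 1 = 1" "ev 0 = 0"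
    "ev (scal a) = \<eta> (scal a)" "ev (gen i) = R (i - 1)"
proof -
  show "ev (p * p') = ev p * ev p'"
    unfolding ev_def by (rule cs.plin_mult) (simp add: plus_list_def)
  show "ev (scal a) = \<eta> (scal a)"
    unfolding ev_def scal_def[where 'm = "nat list"] by (subst cs.plin_single) (simp add: zero_list_def)
  show "ev (gen i) = R (i - 1)"
    unfolding ev_def gen_def by (subst cs.plin_single) (simp add: scal_one \<eta>_hom)
  show "ev (p + p') = ev p + ev p'" "ev 0 = 0" by (simp_all only: ev_def cs.plin_add cs.plin_zero)
  show "ev 1 = 1" unfolding ev_def by (rule cs.plin_one) (simp add: zero_list_def)
qed

lemma ev_diff: "ev (p - p') = ev p - ev p'"
  using ev_hom(1)[of "p - p'" p'] by (simp add: eq_diff_eq)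

lemma tprod_Rop_carrier: "tprod N m (map (Rop N m) w) \<in> carrier (tend N m)"
proof -
  interpret T: ring "tend N m :: Cq tmat ring" by (rule ring_tend)
  show ?thesis by (induction w) (simp_all add: tprod_simps(1) tprod_simps(2) Rop_carrier)
qed

lemma \<Phi>_rho_rep:
  assumes "keys p \<subseteq> lists {1..<m}"
  shows "\<Phi> m (lift (rho_rep N m p)) = ev p"
proof -
  have w: "\<Phi> m (lift (tprod N m (map (Rop N m) w))) = prod_list (map (\<lambda>i. R (i - 1)) w)" if "w \<in> lists {1..<m}" for w
  proof -
    have "map (\<Phi> m) (map lift (map (Rop N m) w)) = map (\<lambda>i. R (i - 1)) w"
      unfolding map_map o_def by (rule map_cong[OF refl], rule \<Phi>_R') (use that in auto)
    then show ?thesis by (simp only: lift_tprod \<Phi>_tprod)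
  qed
  have "\<Phi> m (lift (rho_rep N m p)) = (\<Sum>I\<in>midx N m. \<Sum>J\<in>midx N m. \<Sum>w\<in>keys p.
      \<eta> (scal (lookup p w)) * (\<eta> (scal (tprod N m (map (Rop N m) w) I J)) * u m I J))"
    unfolding \<Phi>_def lift_def rho_rep_def
    by (simp only: scal.c_sum scal_mult \<eta>_sum \<eta>_hom(2) sum_distrib_right mult.assoc)
  also have "\<dots> = (\<Sum>I\<in>midx N m. \<Sum>w\<in>keys p. \<Sum>J\<in>midx N m.
      \<eta> (scal (lookup p w)) * (\<eta> (scal (tprod N m (map (Rop N m) w) I J)) * u m I J))"
    by (intro sum.cong refl sum.swap)
  also have "\<dots> = (\<Sum>w\<in>keys p. \<Sum>I\<in>midx N m. \<Sum>J\<in>midx N m.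
      \<eta> (scal (lookup p w)) * (\<eta> (scal (tprod N m (map (Rop N m) w) I J)) * u m I J))"
    by (rule sum.swap)
  also have "\<dots> = (\<Sum>w\<in>keys p. \<eta> (scal (lookup p w)) * \<Phi> m (lift (tprod N m (map (Rop N m) w))))"
    by (simp only: \<Phi>_def lift_def sum_distrib_left)
  also have "\<dots> = ev p"
    unfolding ev_def plin_def by (intro sum.cong refl arg_cong2[of _ _ _ _ "(*)"] w) (rule subsetD[OF assms])
  finally show ?thesis .
qed

lemma hecke_rels_carrier: "hecke_rels m \<subseteq> carrier (free_alg {1..<m})"
  by (auto simp: hecke_rels_def intro!: free_alg_closed)

lemma ev_hecke_rels: "p \<in> hecke_rels m \<Longrightarrow> ev p = 0"
  unfolding hecke_rels_def
proof (elim UnE CollectE exE conjE)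
  fix i j assume p: "p = gen i * gen j - gen j * gen i" and ij: "i \<in> {1..<m}" "j \<in> {1..<m}" "\<bar>int i - int j\<bar> > 1"
  then have "Suc (i - 1) < j - 1 \<or> Suc (j - 1) < i - 1" by auto
  then have "R (i - 1) * R (j - 1) = R (j - 1) * R (i - 1)" using R_far by metis
  then show "ev p = 0" unfolding p ev_diff ev_hom by simp
next
  fix i assume p: "p = gen i * gen (Suc i) * gen i - gen (Suc i) * gen i * gen (Suc i)" and i: "i \<in> {1..<m}"
  then have "Suc (i - 1) = i" by simp
  then have "R (i - 1) * (R i * R (i - 1)) = R i * (R (i - 1) * R i)" using R_braid[of "i - 1"] by simp
  then show "ev p = 0" unfolding p ev_diff ev_hom by (simp add: mult.assoc)
next
  fix i assume p: "p = gen i * gen i - (1 + scal (q - inverse q) * gen i)"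
  show "ev p = 0" unfolding p ev_diff ev_hom R_sq by simp
qed

text \<open>The kernel of \<open>ev\<close> is an ideal that contains the relations.\<close>

lemma ev_genideal:
  assumes "p \<in> genideal (free_alg {1..<m}) (hecke_rels m)"
  shows "ev p = 0" "p \<in> carrier (free_alg {1..<m})"
proof -
  let ?F = "free_alg {1..<m} :: (nat, Cq) falg ring"
  interpret F: ring ?F by (rule ring_free_alg)
  let ?K = "{p \<in> carrier ?F. ev p = 0}"
  have ops: "x \<otimes>\<^bsub>free_alg A\<^esub> y = x * y" "x \<oplus>\<^bsub>free_alg A\<^esub> y = x + y" "\<zero>\<^bsub>free_alg A\<^esub> = 0"
    for A :: "nat set" and x y :: "(nat, Cq) falg"
    by (simp_all add: free_alg_def ring_on_def)
  have "ideal ?K ?F"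
  proof (rule idealI)
    show "ring ?F" by (rule ring_free_alg)
    show "subgroup ?K (add_monoid ?F)"
    proof (rule F.add.subgroupI)
      show "?K \<noteq> {}" using free_alg_closed(5) ev_hom(4) by blast
      fix x assume x: "x \<in> ?K"
      then have "\<ominus>\<^bsub>?F\<^esub> x = - x"
      proof (intro F.minus_equality)
        have "0 - x \<in> carrier ?F" using x by (intro free_alg_closed) auto
        then show "- x \<in> carrier ?F" by simp
      qed (use x in \<open>auto simp: ops\<close>)
      moreover have "0 - x \<in> carrier ?F" using x by (intro free_alg_closed) auto
      ultimately show "\<ominus>\<^bsub>?F\<^esub> x \<in> ?K" using x ev_diff[of 0 x] by (simp add: ev_hom)
    qed (auto simp: ops ev_hom intro: free_alg_closed)
  qed (auto simp: ops ev_hom intro: free_alg_closed)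
  moreover have "hecke_rels m \<subseteq> ?K" using hecke_rels_carrier ev_hecke_rels by auto
  ultimately have "genideal ?F (hecke_rels m) \<subseteq> ?K" by (rule F.genideal_minimal)
  then show "ev p = 0" "p \<in> carrier ?F" using assms by auto
qed

lemma hsym_rep_carrier: "hsym_rep (Suc n) \<in> carrier (free_alg {1..<Suc n})"
proof (induction n)
  case (Suc n)
  have "lists {1..<Suc n} \<subseteq> lists {1..<Suc (Suc n)}" by (rule lists_mono) auto
  then have "carrier (free_alg {1..<Suc n}) \<subseteq> carrier (free_alg {1..<Suc (Suc n)} :: (nat, Cq) falg ring)"
    unfolding free_alg_def ring_on_def by (simp only: partial_object.simps) blast
  then have "hsym_rep (Suc n) \<in> carrier (free_alg {1..<Suc (Suc n)})" using Suc by blast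
  then show ?case unfolding hsym_rep.simps Let_def by (intro free_alg_closed) auto
qed (simp add: free_alg_closed)

lemma ev_hsym_rep: "ev (hsym_rep (Suc n)) = hs (Suc n)"
proof (induction n)
  case 0
  then show ?case by (simp add: ev_hom M.hs_1)
next
  case (Suc n)
  have 1: "qnum (int (Suc (Suc n))) = qn q (Suc (Suc n))" "qnum (int (Suc (Suc n)) - 1) = qn q (Suc n)"
    using qnum_eq[of "Suc n"] qnum_eq[of "Suc (Suc n)"] by simp_all
  have 2: "q powi (2 - 2 * int (Suc (Suc n))) = inverse q ^ (2 * Suc n)"
  proof -
    have "2 - 2 * int (Suc (Suc n)) = - int (2 * Suc n)" by simp
    then show ?thesis by (simp only: power_int_minus power_int_of_nat power_inverse)
  qed
  show ?case
    unfolding hsym_rep.simps Let_def ev_hom Suc 1 2 hs.simps(2)[of "Suc n"] inverse_eq_divide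
    by (simp only: mult.assoc mult_1_right diff_Suc_1)
qed

text \<open>\<open>rho\<close> takes the common value on a coset, which must first be shown to
  exist: representatives differ by an element of the kernel of \<open>ev\<close>, and a scalar
  matrix is determined by its operator.\<close>

lemma rho_hsym:
  assumes "m \<ge> 1"
  shows "\<Phi> m (lift (rho N m (hsym m))) = hs m" and "rho N m (hsym m) \<in> carrier (tend N m)"
proof -
  obtain n where m: "m = Suc n" using assms by (cases m) auto
  let ?rep = "hsym_rep m"
  have rep: "?rep \<in> carrier (free_alg {1..<m})" using hsym_rep_carrier m by simp
  have car: "rho_rep N m p \<in> carrier (tend N m)" for p
    using tprod_Rop_carrier[of m] unfolding rho_rep_def by (auto simp: tend_def)
  have hsym: "hsym m = {h + ?rep | h. h \<in> genideal (free_alg {1..<m}) (hecke_rels m)}"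
    unfolding hsym_def pres_class_def a_r_coset_def r_coset_def by (auto simp: free_alg_def ring_on_def)
  have keys: "p \<in> carrier (free_alg {1..<m}) \<Longrightarrow> keys p \<subseteq> lists {1..<m}" for p :: "(nat, Cq) falg"
    by (simp add: free_alg_def ring_on_def)
  have const: "rho_rep N m p = rho_rep N m ?rep" if "p \<in> hsym m" for p
  proof -
    from that obtain h where p: "p = h + ?rep" and h: "h \<in> genideal (free_alg {1..<m}) (hecke_rels m)"
      unfolding hsym by blast
    have "p \<in> carrier (free_alg {1..<m})" unfolding p by (intro free_alg_closed ev_genideal(2)[OF h] rep)
    then show ?thesis
      using ev_genideal(1)[OF h] by (intro \<Phi>_lift_inj[of _ m] car) (simp only: \<Phi>_rho_rep[OF keys[OF rep]] \<Phi>_rho_rep[OF keys] p ev_hom add_0_left)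
  qed
  have "hsym m \<noteq> {}"
  proof -
    interpret F: ring "free_alg {1..<m} :: (nat, Cq) falg ring" by (rule ring_free_alg)
    interpret I: ideal "genideal (free_alg {1..<m}) (hecke_rels m)" "free_alg {1..<m} :: (nat, Cq) falg ring"
      by (rule F.genideal_ideal) (rule hecke_rels_carrier)
    show ?thesis unfolding hsym using I.zero_closed by blast
  qed
  then have "rho N m (hsym m) = rho_rep N m ?rep"
    unfolding rho_def by (rule the_elem_image_unique) (rule const)
  then show "\<Phi> m (lift (rho N m (hsym m))) = hs m" "rho N m (hsym m) \<in> carrier (tend N m)"
    using keys[OF rep] car by (simp_all add: \<Phi>_rho_rep ev_hsym_rep m)
qed

definition Omega_rep where
  "Omega_rep m = qtrace N m (tprod N m (map (kbar N m Lmat) [1..<Suc m]) \<otimes>\<^bsub>tend N m\<^esub> lift (rho N m (hsym m)))"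

lemma Omega_classof: "Omega N m = classof (Omega_rep m)"
  by (simp add: Omega_def omega_def Omega_rep_def classof_def)

lemma Omega_rep_carrier: "Omega_rep m \<in> carrier (free_alg (gl_gens N))"
proof -
  have "Lmat a b \<in> carrier (free_alg (gl_gens N))" if "a \<in> {1..N}" "b \<in> {1..N}" for a b
  proof -
    have "(if a = b then 1 else 0 :: (nat \<times> nat, Cq) falg) \<in> carrier (free_alg (gl_gens N))"
      by (simp add: free_alg_closed)
    then show ?thesis unfolding Lmat_def using that by (intro free_alg_closed(2,3,4) Mmat_carrier)
  qed
  then show ?thesis unfolding Omega_rep_def
    by (intro qtrace_carrier entries_in_mult entries_in_tprod entries_in_lift) (auto intro: entries_in_kbar')
qed

lemma \<eta>_Omega:
  assumes "m \<ge> 1"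
  shows "\<eta> (Omega_rep m) = L.\<Omega> m"
proof -
  have "\<eta> (Omega_rep m) = M.tr m (M.asc (Xs Lel) 0 m * hs m)"
    unfolding Omega_rep_def \<eta>_qtrace \<Phi>_mult \<Phi>_tprod prod_kbar rho_hsym[OF assms] Lel_def[symmetric] ..
  \<comment> \<open>The symmetrizer stands on the right in \<open>omega\<close> and on the left in
    \<open>L.\<Omega>\<close>; it may be moved around the trace.\<close>
  also have "\<dots> = M.tr m (hs m * M.asc (Xs Lel) 0 m)"
    by (rule L.cycD[symmetric, OF L.cyc_hs[OF order.refl]]) (rule L.asc_X_lev, simp)
  finally show ?thesis by (simp only: L.\<Omega>_def)
qed

text \<open>The reflection equation extends to powers: R M R commutes with M^k. Cancelling R on each
  side gives M (R M^k R^(-1)) = (R^(-1) M^k R) M. Under the partial trace over the second factor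
  both conjugates become the trace of M^k, which therefore commutes with M.\<close>

lemma central_psum:
  assumes "k \<ge> 1"
  shows "central (psum_rep k)"
proof (rule central_of_commute)
  let ?z = "\<tau> 0 (Mel ^ k)"
  have Mk: "Mel ^ k \<in> lev (Suc 0)" for k
    using Mel_lev by (induction k) (simp_all add: lev_mult M.lev_one)
  show "\<eta> (psum_rep k) \<in> lev 0" unfolding \<eta>_psum[OF assms] by (rule M.\<tau>_lev[OF Mk])
  have "R 0 * Mel * R 0 * Mel ^ k = Mel ^ k * (R 0 * Mel * R 0)" for k
  proof (induction k)
    case (Suc k)
    have "R 0 * Mel * R 0 * Mel ^ Suc k = (R 0 * Mel * R 0 * Mel) * Mel ^ k" by (simp add: mult.assoc)
    also have "\<dots> = Mel * (R 0 * Mel * R 0 * Mel ^ k)" unfolding reflection by (simp add: mult.assoc)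
    finally show ?case unfolding Suc by (simp add: mult.assoc)
  qed simp
  then have "ginv 0 * (R 0 * Mel * R 0 * Mel ^ k) * ginv 0 = ginv 0 * (Mel ^ k * (R 0 * Mel * R 0)) * ginv 0" by simp
  then have "Mel * (R 0 * Mel ^ k * ginv 0) = (ginv 0 * Mel ^ k * R 0) * Mel" by (simp add: mult.assoc)
  then have "\<tau> (Suc 0) (Mel * (R 0 * Mel ^ k * ginv 0)) = \<tau> (Suc 0) ((ginv 0 * Mel ^ k * R 0) * Mel)" by simp
  then have "?z * Mel = Mel * ?z"
    using M.\<tau>_left[OF Mk[of 1], of "R 0 * Mel ^ k * ginv 0"] M.\<tau>_right[OF Mk[of 1], of "ginv 0 * Mel ^ k * R 0"]
      M.\<tau>_conj[OF Mk[of k]] M.\<tau>_conj_inv[OF Mk[of k]] by simp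
  then show "\<eta> (psum_rep k) * (\<Sum>i\<in>{1..N}. \<Sum>j\<in>{1..N}. \<eta> (gen (i, j)) * e 0 i j) =
      (\<Sum>i\<in>{1..N}. \<Sum>j\<in>{1..N}. \<eta> (gen (i, j)) * e 0 i j) * \<eta> (psum_rep k)"
    unfolding \<eta>_psum[OF assms] Mel_def Mmat_def .
qed (rule psum_rep_carrier)

end

section \<open>The classical weight system\<close>

lemma qn_1: "qn 1 n = of_nat n"
  by (induction n) (simp_all add: qn_Suc)

lemma presentation_gl: "presentation (gl_gens N) (gl_rels N)"
proof
  show "gl_rels N \<subseteq> carrier (free_alg (gl_gens N))"
    by (auto simp: gl_rels_def gl_gens_def intro!: free_alg_closed)
  show "augm p = 0" if "p \<in> gl_rels N" for p
  proof -
    have d: "augm (x - y) = augm x - augm y" for x y :: "(nat \<times> nat, complex) falg"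
      using augm_hom(1)[of "x - y" y] by (simp add: eq_diff_eq)
    then have "augm (0 :: (nat \<times> nat, complex) falg) = 0" using d[of 0 0] by simp
    then show ?thesis using that by (auto simp: gl_rels_def d augm_hom)
  qed
qed

locale classical =
  fixes N :: nat
  assumes N1: "N \<ge> 1"
begin

sublocale tensor_algebra N "gl_rels N" 1
  by (intro tensor_algebra.intro tensor_algebra_axioms.intro presentation_gl N1)
    (simp_all add: qn_1 del: of_nat_Suc)

notation sc (infixr "\<cdot>" 75)

definition E :: "nat \<Rightarrow> (nat \<times> nat, complex) falg quotients endo" where
  "E k = (\<Sum>a\<in>{1..N}. \<Sum>b\<in>{1..N}. \<eta> (gen (a, b)) * e k a b)"

lemma ginv_R: "ginv i = R i"
  by (simp add: ginv_def scal_zero)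

lemma R_R: "R i * R i = 1" and R_R_left: "R i * (R i * x) = x"
  using g_ginv[of i] g_ginv_left[of i x] by (simp_all add: ginv_R)

lemma R_ket1:
  assumes "a \<in> {1..N}" "b \<in> {1..N}"
  shows "R i * (e i a x * (e (Suc i) b y * z)) = e i b x * (e (Suc i) a y * z)"
  using R_ket[OF assms, of i x y z] by (simp add: scal_one scal_zero \<eta>_hom)

lemma R_u:
  assumes "Suc k < m" "K \<in> midx N m"
  shows "R k * u m K J = u m (K(Suc k := K (Suc (Suc k)), Suc (Suc k) := K (Suc k))) J"
proof -
  let ?c = "K (Suc k)" and ?d = "K (Suc (Suc k))"
  have cd: "?c \<in> {1..N}" "?d \<in> {1..N}" using assms midx_in by simp_all
  have "u m K J = e k ?c ?c * (e (Suc k) ?d ?d * u m K J)"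
    using assms(1) cd by (simp add: e_u)
  then have "R k * u m K J = e k ?d ?c * (e (Suc k) ?c ?d * u m K J)"
    using R_ket1[OF cd, of k ?c ?d "u m K J"] by simp
  also have "\<dots> = u m (K(Suc (Suc k) := ?c, Suc k := ?d)) J"
    using assms(1) cd by (simp add: e_u)
  also have "K(Suc (Suc k) := ?c, Suc k := ?d) = K(Suc k := ?d, Suc (Suc k) := ?c)"
    by (rule fun_upd_twist) simp
  finally show ?thesis .
qed

text \<open>At t = 1 the operator \<open>R k\<close> is the flip of the factors k and k + 1.\<close>

lemma E_Suc: "E (Suc k) = R k * E k * R k"
proof -
  have "R k * e k a b * R k = e (Suc k) a b" if ab: "a \<in> {1..N}" "b \<in> {1..N}" for a b
  proof (rule ket_ext[of _ k], rule ket_ext[of _ "Suc k"])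
    fix c d assume cd: "c \<in> {1..N}" "d \<in> {1..N}"
    have "R k * e k a b * R k * e k c c * e (Suc k) d d = R k * (e k a b * (R k * (e k c c * (e (Suc k) d d * 1))))"
      by (simp add: mult.assoc)
    also have "\<dots> = (if b = d then R k * (e k a c * (e (Suc k) c d * 1)) else 0)"
      using cd ab by (auto simp: R_ket1[of c d k c d 1, simplified] e_mult_left)
    also have "\<dots> = (if b = d then e k c c * e (Suc k) a d else 0)"
      using cd ab R_ket1[of a c k c d 1] by simp
    also have "\<dots> = e (Suc k) a b * e k c c * e (Suc k) d d"
      using cd ab by (simp add: e_swap mult.assoc e_mult)
    finally show "R k * e k a b * R k * e k c c * e (Suc k) d d = e (Suc k) a b * e k c c * e (Suc k) d d" .
  qed
  note conj = this
  have comm: "R k * \<eta> p = \<eta> p * R k" for p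
  proof -
    have "(e k a c * e (Suc k) b d) * \<eta> p = \<eta> p * (e k a c * e (Suc k) b d)" for a b c d
      by (simp only: mult.assoc \<eta>_e \<eta>_e_left)
    moreover have "(\<eta> (scal s) * K) * \<eta> p = \<eta> p * (\<eta> (scal s) * K)" if K: "K * \<eta> p = \<eta> p * K" for K s
    proof -
      have "(\<eta> (scal s) * K) * \<eta> p = (\<eta> (scal s) * \<eta> p) * K" by (simp only: K mult.assoc)
      also have "\<dots> = \<eta> p * (\<eta> (scal s) * K)" by (simp only: \<eta>_central[of s "\<eta> p"] mult.assoc)
      finally show ?thesis .
    qed
    ultimately have "(r a b c d \<cdot> (e k a c * e (Suc k) b d)) * \<eta> p = \<eta> p * (r a b c d \<cdot> (e k a c * e (Suc k) b d))" for a b c d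
      by blast
    then show ?thesis unfolding R_def sum_distrib_left sum_distrib_right by (intro sum.cong refl) auto
  qed
  have "R k * (\<eta> p * e k a b) * R k = \<eta> p * e (Suc k) a b" if "a \<in> {1..N}" "b \<in> {1..N}" for a b p
  proof -
    have "R k * (\<eta> p * e k a b) * R k = (R k * \<eta> p) * e k a b * R k" by (simp only: mult.assoc)
    also have "\<dots> = \<eta> p * (R k * e k a b * R k)" by (simp only: comm mult.assoc)
    finally show ?thesis using conj[OF that] by simp
  qed
  then show ?thesis unfolding E_def sum_distrib_left sum_distrib_right by (intro sum.cong refl) simp
qed

lemma Xs_E: "Xs (E 0) k = E k"
  by (induction k) (simp_all add: E_Suc ginv_R)

lemma E_lev: "E k \<in> lev (Suc k)"
  unfolding E_def by (intro lev_sum lev_mult \<eta>_lev e_lev) simp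

lemma \<eta>_rel:
  assumes "i \<in> {1..N}" "j \<in> {1..N}" "k \<in> {1..N}" "l \<in> {1..N}"
  shows "\<eta> (gen (i, j)) * \<eta> (gen (k, l)) = \<eta> (gen (k, l)) * \<eta> (gen (i, j)) +
    ((if j = k then \<eta> (gen (i, l)) else 0) - (if i = l then \<eta> (gen (k, j)) else 0))"
proof -
  have "gen (i, j) * gen (k, l) - gen (k, l) * gen (i, j)
       - ((if j = k then gen (i, l) else 0) - (if i = l then gen (k, j) else 0)) \<in> gl_rels N"
    unfolding gl_rels_def using assms by blast
  from \<eta>_S[OF this] show ?thesis
    by (auto simp: \<eta>_diff \<eta>_hom algebra_simps split: if_splits)
qed

text \<open>The matrix form of the defining relations: on basis vectors, the commutators of the
  entries reassemble into \<open>E 0 - E 1\<close> times the flip.\<close>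

lemma E_commutator: "E 0 * E 1 = E 1 * E 0 + (E 0 - E 1) * R 0"
proof (rule ket_ext[of _ 0], rule ket_ext[of _ "Suc 0"])
  fix c d assume cd: "c \<in> {1..N}" "d \<in> {1..N}"
  let ?k = "\<lambda>a b. e 0 a c * e (Suc 0) b d" and ?I = "{1..N}"
  have E0: "E 0 * (\<eta> p * (e 0 x c * z)) = (\<Sum>a\<in>?I. \<eta> (gen (a, x)) * (\<eta> p * (e 0 a c * z)))" if "x \<in> ?I" for p x z
  proof -
    have "E 0 * (\<eta> p * (e 0 x c * z)) = (\<Sum>a\<in>?I. \<Sum>b\<in>?I. if b = x then \<eta> (gen (a, x)) * (\<eta> p * (e 0 a c * z)) else 0)"
      unfolding E_def sum_distrib_right
    proof (intro sum.cong refl)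
      fix a b assume "b \<in> ?I"
      have "\<eta> (gen (a, b)) * e 0 a b * (\<eta> p * (e 0 x c * z)) = \<eta> (gen (a, b)) * (\<eta> p * (e 0 a b * (e 0 x c * z)))"
        by (simp only: \<eta>_e_left mult.assoc)
      then show "\<eta> (gen (a, b)) * e 0 a b * (\<eta> p * (e 0 x c * z)) = (if b = x then \<eta> (gen (a, x)) * (\<eta> p * (e 0 a c * z)) else 0)"
        using \<open>b \<in> ?I\<close> by (simp add: e_mult_left)
    qed
    then show ?thesis using that by simp
  qed
  have E1: "E 1 * (\<eta> p * (e 0 x c * e (Suc 0) y d)) = (\<Sum>b\<in>?I. \<eta> (gen (b, y)) * (\<eta> p * (e 0 x c * e (Suc 0) b d)))" if "y \<in> ?I" for p x y
  proof -
    have "E 1 * (\<eta> p * (e 0 x c * e (Suc 0) y d)) = (\<Sum>a\<in>?I. \<Sum>b\<in>?I. if b = y then \<eta> (gen (a, y)) * (\<eta> p * (e 0 x c * e (Suc 0) a d)) else 0)"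
      unfolding E_def sum_distrib_right One_nat_def
    proof (intro sum.cong refl)
      fix a b assume "b \<in> {Suc 0..N}"
      have "\<eta> (gen (a, b)) * e (Suc 0) a b * (\<eta> p * (e 0 x c * e (Suc 0) y d)) = \<eta> (gen (a, b)) * (\<eta> p * (e (Suc 0) a b * (e 0 x c * e (Suc 0) y d)))"
        by (simp only: \<eta>_e_left mult.assoc)
      then show "\<eta> (gen (a, b)) * e (Suc 0) a b * (\<eta> p * (e 0 x c * e (Suc 0) y d)) =
          (if b = y then \<eta> (gen (a, y)) * (\<eta> p * (e 0 x c * e (Suc 0) a d)) else 0)"
        using \<open>b \<in> {Suc 0..N}\<close> by (simp add: e_swap_left e_mult)
    qed
    then show ?thesis using that by simp
  qed
  have o: "x = \<eta> 1 * x" for x by (simp add: \<eta>_hom)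
  have E0': "E 0 * (e 0 x c * z) = (\<Sum>a\<in>?I. \<eta> (gen (a, x)) * (e 0 a c * z))" if "x \<in> ?I" for x z
    using E0[OF that, of 1 z] by (simp add: \<eta>_hom)
  have E1': "E 1 * (e 0 x c * e (Suc 0) y d) = (\<Sum>b\<in>?I. \<eta> (gen (b, y)) * (e 0 x c * e (Suc 0) b d))" if "y \<in> ?I" for x y
    using E1[OF that, of 1 x] by (simp add: \<eta>_hom)
  have "E 0 * (E 1 * ?k c d) = (\<Sum>b\<in>?I. \<Sum>a\<in>?I. \<eta> (gen (a, c)) * \<eta> (gen (b, d)) * ?k a b)"
    by (simp only: E1'[OF cd(2)] sum_distrib_left E0[OF cd(1)] mult.assoc)
  also have "\<dots> = (\<Sum>b\<in>?I. \<Sum>a\<in>?I. \<eta> (gen (b, d)) * \<eta> (gen (a, c)) * ?k a b +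
      ((if b = c then \<eta> (gen (a, d)) * ?k a c else 0) - (if a = d then \<eta> (gen (b, c)) * ?k d b else 0)))"
    using cd by (intro sum.cong refl) (auto simp: \<eta>_rel[OF _ cd(1) _ cd(2)] distrib_right left_diff_distrib)
  also have "\<dots> = (\<Sum>b\<in>?I. \<Sum>a\<in>?I. \<eta> (gen (b, d)) * \<eta> (gen (a, c)) * ?k a b) +
      ((\<Sum>b\<in>?I. \<Sum>a\<in>?I. if b = c then \<eta> (gen (a, d)) * ?k a c else 0) - (\<Sum>b\<in>?I. \<Sum>a\<in>?I. if a = d then \<eta> (gen (b, c)) * ?k d b else 0))"
    by (simp only: sum.distrib sum_subtractf)
  also have "(\<Sum>b\<in>?I. \<Sum>a\<in>?I. \<eta> (gen (b, d)) * \<eta> (gen (a, c)) * ?k a b) = (\<Sum>a\<in>?I. \<Sum>b\<in>?I. \<eta> (gen (b, d)) * \<eta> (gen (a, c)) * ?k a b)"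
    by (rule sum.swap)
  also have "\<dots> = E 1 * (E 0 * ?k c d)"
    by (simp only: E0'[OF cd(1)] sum_distrib_left E1[OF cd(2)] mult.assoc)
  also have "(\<Sum>b\<in>?I. \<Sum>a\<in>?I. if b = c then \<eta> (gen (a, d)) * ?k a c else 0) = (\<Sum>b\<in>?I. if b = c then \<Sum>a\<in>?I. \<eta> (gen (a, d)) * ?k a c else 0)"
    by (intro sum.cong refl) simp
  also have "\<dots> = E 0 * ?k d c"
    using cd E0'[OF cd(2), of "e (Suc 0) c d"] by simp
  also have "(\<Sum>b\<in>?I. \<Sum>a\<in>?I. if a = d then \<eta> (gen (b, c)) * ?k d b else 0) = E 1 * ?k d c"
    using cd E1'[OF cd(1), of d] by simp
  finally have main: "E 0 * (E 1 * ?k c d) = E 1 * (E 0 * ?k c d) + (E 0 * ?k d c - E 1 * ?k d c)" .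
  have "R 0 * ?k c d = ?k d c" using R_ket1[OF cd, of 0 c d 1] by simp
  then have "(E 1 * E 0 + (E 0 - E 1) * R 0) * ?k c d = E 1 * (E 0 * ?k c d) + (E 0 * ?k d c - E 1 * ?k d c)"
    by (simp add: distrib_right left_diff_distrib mult.assoc)
  with main have "E 0 * E 1 * ?k c d = (E 1 * E 0 + (E 0 - E 1) * R 0) * ?k c d" by (simp add: mult.assoc)
  then show "E 0 * E 1 * e 0 c c * e (Suc 0) d d = (E 1 * E 0 + (E 0 - E 1) * R 0) * e 0 c c * e (Suc 0) d d"
    by (simp only: mult.assoc)
qed

end

text \<open>As the second shift is larger by 1, the product Z and its conjugate p Z p differ by (x -
  y) (p + 1). Since p anticommutes with x - y, this is killed by p + 1 from the left, so (p + 1) Z =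
  (p + 1) Z p.\<close>

lemma (in algebra_ring) absorb_of_commutator:
  assumes "p * p = 1" "y = p * x * p" "x * y = y * x + (x - y) * p"
  shows "(p + 1) * ((x + a \<cdot> 1) * (y + (a + 1) \<cdot> 1)) * (p - 1) = 0"
proof -
  let ?Z = "(x + a \<cdot> 1) * (y + (a + 1) \<cdot> 1)"
  have pp: "p * (p * z) = z" for z using assms(1) by (simp flip: mult.assoc)
  have py: "p * y = x * p" and px: "p * x = y * p" by (simp_all add: assms(2) assms(1) pp mult.assoc)
  have pxy: "p * (y * z) = x * (p * z)" "p * (x * z) = y * (p * z)" for z
    using py px by (simp_all flip: mult.assoc)
  have "p * ?Z * p = (y + a \<cdot> 1) * (x + (a + 1) \<cdot> 1)"
    by (simp add: distrib_left distrib_right mult.assoc pxy pp py px assms(1) sc_add_left)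
  note Z = this
  have "?Z - p * ?Z * p = (x - y) * (p + 1)"
    unfolding Z using assms(3) by (simp add: algebra_simps sc_distrib)
  then have "(p + 1) * (?Z - p * ?Z * p) = (p + 1) * ((x - y) * (p + 1))" by simp
  also have "\<dots> = 0"
    by (simp add: algebra_simps pxy pp py px assms(1))
  finally have "(p + 1) * ?Z = (p + 1) * (p * ?Z * p)" by (simp add: right_diff_distrib)
  also have "\<dots> = (p + 1) * ?Z * p" by (simp add: distrib_right pp mult.assoc)
  finally show ?thesis by (simp add: right_diff_distrib)
qed

context classical
begin

sublocale C: tensor_tower N "gl_rels N" 1 "Xs (E 0)" of_nat
proof (intro tensor_tower.intro tensor_algebra_axioms markov E_lev)
  show "E 0 \<in> lev 1" using E_lev[of 0] by simp
  show "e n a b = 0" if "a \<notin> {1..N} \<or> b \<notin> {1..N}" for n a b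
    using that by (rule eunit_out)
  fix j
  have X1: "Xs (E 0) 1 = R 0 * E 0 * R 0" by (simp add: ginv_R)
  have 1: "inverse 1 \<cdot> 1 = 1" "1 \<cdot> 1 = 1" by (simp_all add: scal_one \<eta>_hom)
  have 2: "of_nat (Suc j) = (of_nat j + 1 :: complex)" by simp
  have "E 0 * (R 0 * E 0 * R 0) = (R 0 * E 0 * R 0) * E 0 + (E 0 - R 0 * E 0 * R 0) * R 0"
    using E_commutator E_Suc[of 0] by simp
  from absorb_of_commutator[OF R_R refl this, of "of_nat j"]
  show "(R 0 + inverse 1 \<cdot> 1) * ((E 0 + of_nat j \<cdot> 1) * (Xs (E 0) 1 + of_nat (Suc j) \<cdot> 1)) * (R 0 - 1 \<cdot> 1) = 0"
    unfolding X1 1 2 .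
qed

end

section \<open>Limits at q = 1\<close>

lemma eventually_poly_nz: "b \<noteq> 0 \<Longrightarrow> eventually (\<lambda>z. poly b z \<noteq> 0) (at (1 :: complex))"
proof -
  assume "b \<noteq> 0"
  then have fin: "finite ({z. poly b z = 0} - {1})" by (simp add: poly_roots_finite)
  have "open (- ({z. poly b z = 0} - {1}))"
    using finite_imp_closed[OF fin] by (rule open_Compl)
  then show ?thesis unfolding eventually_at_topological
    by (intro exI[of _ "- ({z. poly b z = 0} - {1})"] conjI) auto
qed

lemma tendsto_q1_const: "tendsto_q1 (Fract [:c:] 1) c"
  unfolding tendsto_q1_def by (intro exI[of _ "[:c:]"] exI[of _ 1]) simp

lemma tendsto_q1_0 [intro, simp]: "tendsto_q1 0 0"
  using tendsto_q1_const[of 0] by (simp add: Zero_fract_def)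

lemma tendsto_q1_1 [intro, simp]: "tendsto_q1 1 1"
  using tendsto_q1_const[of 1] by (simp add: One_fract_def one_pCons)

lemma tendsto_q1_q [intro, simp]: "tendsto_q1 q 1"
  unfolding tendsto_q1_def q_def by (intro exI[of _ "[:0, 1:]"] exI[of _ 1]) (simp add: tendsto_ident_at)

lemma tendsto_q1_add [intro]:
  assumes "tendsto_q1 f l" "tendsto_q1 f' l'"
  shows "tendsto_q1 (f + f') (l + l')"
proof -
  obtain a b where ab: "b \<noteq> 0" "f = Fract a b" "((\<lambda>z. poly a z / poly b z) \<longlongrightarrow> l) (at 1)"
    using assms(1) unfolding tendsto_q1_def by (elim exE conjE) (rule that)
  obtain a' b' where ab': "b' \<noteq> 0" "f' = Fract a' b'" "((\<lambda>z. poly a' z / poly b' z) \<longlongrightarrow> l') (at 1)"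
    using assms(2) unfolding tendsto_q1_def by (elim exE conjE) (rule that)
  have "eventually (\<lambda>z. poly a z / poly b z + poly a' z / poly b' z = poly (a * b' + a' * b) z / poly (b * b') z) (at 1)"
    using eventually_poly_nz[OF ab(1)] eventually_poly_nz[OF ab'(1)] by eventually_elim (simp add: field_simps)
  with tendsto_add[OF ab(3) ab'(3)] have "((\<lambda>z. poly (a * b' + a' * b) z / poly (b * b') z) \<longlongrightarrow> l + l') (at 1)"
    by (rule Lim_transform_eventually)
  then show ?thesis unfolding tendsto_q1_def using ab(1,2) ab'(1,2)
    by (intro exI[of _ "a * b' + a' * b"] exI[of _ "b * b'"]) simp
qed

lemma tendsto_q1_mult [intro]:
  assumes "tendsto_q1 f l" "tendsto_q1 f' l'"
  shows "tendsto_q1 (f * f') (l * l')"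
proof -
  obtain a b where ab: "b \<noteq> 0" "f = Fract a b" "((\<lambda>z. poly a z / poly b z) \<longlongrightarrow> l) (at 1)"
    using assms(1) unfolding tendsto_q1_def by (elim exE conjE) (rule that)
  obtain a' b' where ab': "b' \<noteq> 0" "f' = Fract a' b'" "((\<lambda>z. poly a' z / poly b' z) \<longlongrightarrow> l') (at 1)"
    using assms(2) unfolding tendsto_q1_def by (elim exE conjE) (rule that)
  show ?thesis unfolding tendsto_q1_def using ab(1,2) ab'(1,2) tendsto_mult[OF ab(3) ab'(3)]
    by (intro exI[of _ "a * a'"] exI[of _ "b * b'"]) simp
qed

lemma tendsto_q1_minus [intro]: "tendsto_q1 f l \<Longrightarrow> tendsto_q1 (- f) (- l)"
proof -
  have "tendsto_q1 (- 1) (- 1)"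
    using tendsto_q1_const[of "- 1"] by (simp add: One_fract_def one_pCons)
  then show "tendsto_q1 f l \<Longrightarrow> tendsto_q1 (- f) (- l)" using tendsto_q1_mult[of "- 1" "- 1" f l] by simp
qed

lemma tendsto_q1_diff [intro]: "tendsto_q1 f l \<Longrightarrow> tendsto_q1 f' l' \<Longrightarrow> tendsto_q1 (f - f') (l - l')"
  using tendsto_q1_add[of f l "- f'" "- l'"] tendsto_q1_minus[of f' l'] by simp

lemma tendsto_q1_inverse:
  assumes "tendsto_q1 f l" "l \<noteq> 0"
  shows "tendsto_q1 (inverse f) (inverse l)"
proof -
  obtain a b where ab: "b \<noteq> 0" "f = Fract a b" "((\<lambda>z. poly a z / poly b z) \<longlongrightarrow> l) (at 1)"
    using assms(1) unfolding tendsto_q1_def by (elim exE conjE) (rule that)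
  have "a \<noteq> 0"
  proof
    assume "a = 0"
    then have "l = 0" using ab(3) by (simp add: tendsto_const_iff)
    then show False using assms(2) by simp
  qed
  then show ?thesis unfolding tendsto_q1_def using ab(1,2) tendsto_inverse[OF ab(3) assms(2)]
    by (intro exI[of _ b] exI[of _ a]) simp
qed

lemma tendsto_q1_power [intro]: "tendsto_q1 f l \<Longrightarrow> tendsto_q1 (f ^ n) (l ^ n)"
  by (induction n) auto

lemma tendsto_q1_sum: "(\<And>i. i \<in> A \<Longrightarrow> tendsto_q1 (f i) (l i)) \<Longrightarrow> tendsto_q1 (\<Sum>i\<in>A. f i) (\<Sum>i\<in>A. l i)"
  by (induction A rule: infinite_finite_induct) auto

lemma tendsto_q1_prod: "(\<And>i. i \<in> A \<Longrightarrow> tendsto_q1 (f i) (l i)) \<Longrightarrow> tendsto_q1 (\<Prod>i\<in>A. f i) (\<Prod>i\<in>A. l i)"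
  by (induction A rule: infinite_finite_induct) auto

lemma tendsto_q1_inverse_q [simp]: "tendsto_q1 (inverse q) 1"
  using tendsto_q1_inverse[of q 1] by simp

lemma tendsto_q1_inverse_q_power: "tendsto_q1 (inverse q ^ n) 1"
  using tendsto_q1_power[OF tendsto_q1_inverse_q, of n] by simp

lemma tendsto_q1_qn: "tendsto_q1 (qn q n) (of_nat n)"
  using tendsto_q1_sum[of "{..<n}" "\<lambda>i. inverse q ^ (2 * i)" "\<lambda>_. 1"] tendsto_q1_inverse_q_power
  by (simp add: qn_def)

section \<open>Coefficientwise limits of polynomials\<close>

definition clim :: "('m \<Rightarrow>\<^sub>0 Cq) \<Rightarrow> ('m \<Rightarrow>\<^sub>0 complex) \<Rightarrow> bool" where
  "clim p P \<longleftrightarrow> (\<forall>\<mu>. tendsto_q1 (lookup p \<mu>) (lookup P \<mu>))"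

lemma clim_add [intro]: "clim p P \<Longrightarrow> clim p' P' \<Longrightarrow> clim (p + p') (P + P')"
  by (auto simp: clim_def lookup_add)

lemma clim_diff [intro]: "clim p P \<Longrightarrow> clim p' P' \<Longrightarrow> clim (p - p') (P - P')"
  by (auto simp: clim_def lookup_minus)

lemma clim_minus [intro]: "clim p P \<Longrightarrow> clim (- p) (- P)"
  by (auto simp: clim_def)

lemma clim_0 [simp, intro]: "clim 0 0"
  by (simp add: clim_def)

lemma clim_single: "tendsto_q1 a l \<Longrightarrow> clim (Poly_Mapping.single \<mu> a) (Poly_Mapping.single \<mu> l)"
  by (auto simp: clim_def lookup_single when_def)

lemma clim_scal: "tendsto_q1 a l \<Longrightarrow> clim (scal a) (scal l)"
  unfolding scal_def by (rule clim_single)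

lemma clim_1 [simp, intro]: "clim 1 (1 :: 'm::monoid_add \<Rightarrow>\<^sub>0 complex)"
proof -
  have "clim (scal 1) (scal 1 :: 'm \<Rightarrow>\<^sub>0 complex)" by (rule clim_scal) simp
  then show ?thesis by (simp only: scal_one)
qed

lemma clim_Var [simp, intro]: "clim (Var i) (Var i)"
  unfolding Var_def by (rule clim_single) simp

lemma clim_sum: "(\<And>i. i \<in> A \<Longrightarrow> clim (f i) (l i)) \<Longrightarrow> clim (\<Sum>i\<in>A. f i) (\<Sum>i\<in>A. l i)"
  by (induction A rule: infinite_finite_induct) auto

text \<open>The index sets may be larger than the supports: a limit can lose monomials, so a
  polynomial and its limit have to be expanded over common sets.\<close>

lemma mult_as_sum:
  fixes p p' :: "'m::monoid_add \<Rightarrow>\<^sub>0 'k::comm_ring_1"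
  assumes "finite A" "finite B" "keys p \<subseteq> A" "keys p' \<subseteq> B"
  shows "p * p' = (\<Sum>a\<in>A. \<Sum>b\<in>B. Poly_Mapping.single (a + b) (lookup p a * lookup p' b))"
proof -
  have *: "p = (\<Sum>a\<in>A. Poly_Mapping.single a (lookup p a))" if "finite A" "keys p \<subseteq> A" for A and p :: "'m \<Rightarrow>\<^sub>0 'k"
    using that by (intro poly_mapping_eqI) (auto simp: lookup_sum lookup_single when_def in_keys_iff)
  have "p * p' = (\<Sum>a\<in>A. Poly_Mapping.single a (lookup p a)) * (\<Sum>b\<in>B. Poly_Mapping.single b (lookup p' b))"
    by (intro arg_cong2[of _ _ _ _ "(*)"] * assms)
  then show ?thesis by (simp add: sum_product mult_single)
qed

lemma clim_mult [intro]:
  fixes P P' :: "'m::monoid_add \<Rightarrow>\<^sub>0 complex"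
  assumes "clim p P" "clim p' P'"
  shows "clim (p * p') (P * P')"
proof -
  let ?A = "keys p \<union> keys P" and ?B = "keys p' \<union> keys P'"
  have "p * p' = (\<Sum>a\<in>?A. \<Sum>b\<in>?B. Poly_Mapping.single (a + b) (lookup p a * lookup p' b))"
    "P * P' = (\<Sum>a\<in>?A. \<Sum>b\<in>?B. Poly_Mapping.single (a + b) (lookup P a * lookup P' b))"
    by (rule mult_as_sum, auto)+
  moreover have "tendsto_q1 (lookup p a) (lookup P a)" "tendsto_q1 (lookup p' a) (lookup P' a)" for a
    using assms by (simp_all add: clim_def)
  ultimately show ?thesis by (simp only:) (intro clim_sum clim_single tendsto_q1_mult)
qed

lemma clim_coeff_prod:
  assumes "\<And>i. i \<in> A \<Longrightarrow> clim (y i) (y' i)"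
  shows "clim (coeff (\<Prod>i\<in>A. [:1, - y i:]) k) (coeff (\<Prod>i\<in>A. [:1, - y' i:]) k :: complex mpol)"
  using assms
proof (induction A arbitrary: k rule: infinite_finite_induct)
  case (insert x A)
  have c: "coeff ([:1, - z:] * P) k = coeff P k - z * (case k of 0 \<Rightarrow> 0 | Suc l \<Rightarrow> coeff P l)" for z :: "'w::comm_ring_1" and P
    by (cases k) (simp_all add: coeff_pCons)
  have "clim (case k of 0 \<Rightarrow> 0 | Suc l \<Rightarrow> coeff (\<Prod>i\<in>A. [:1, - y i:]) l) (case k of 0 \<Rightarrow> 0 | Suc l \<Rightarrow> coeff (\<Prod>i\<in>A. [:1, - y' i:]) l)"
    using insert by (cases k) auto
  then show ?case unfolding prod.insert[OF insert(1,2)] c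
    using insert by (intro clim_diff clim_mult) auto
qed (auto simp: coeff_1)

lemma degree_prod_linear: "degree (\<Prod>i\<in>A. [:1, - y i:]) \<le> card A"
  for y :: "'i \<Rightarrow> 'a::comm_ring_1"
proof (induction A rule: infinite_finite_induct)
  case (insert x A)
  have "degree ([:1, - y x:] * (\<Prod>i\<in>A. [:1, - y i:])) \<le> 1 + card A"
    using degree_mult_le[of "[:1, - y x:]" "\<Prod>i\<in>A. [:1, - y i:]"] insert(3)
      degree_pCons_le[of 1 "[:- y x:]"] by simp
  then show ?case unfolding prod.insert[OF insert(1,2)] card_insert_disjoint[OF insert(1,2)] by simp
qed simp_all

lemma fps_of_poly_prod_linear:
  "fps_of_poly (\<Prod>i\<in>A. [:1, - y i:]) = (\<Prod>i\<in>A. 1 - fps_const (y i) * fps_X)"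
  for y :: "'i \<Rightarrow> 'a::comm_ring_1"
  unfolding fps_of_poly_prod by (intro prod.cong refl) (simp add: fps_of_poly_pCons fps_const_neg[symmetric] del: fps_const_neg)

lemma fps_compose_linear':
  fixes a :: "'a::idom"
  assumes "V $ 0 = 0"
  shows "(1 - fps_const a * fps_X) oo V = 1 - fps_const a * V"
proof -
  have "(1 + fps_const (- a) * fps_X) oo V = 1 + fps_const (- a) * V"
    unfolding fps_compose_add_distrib fps_compose_mult_distrib[OF assms] fps_const_compose
    using assms by (simp add: fps_X_fps_compose_startby0)
  then show ?thesis by (simp add: fps_const_neg[symmetric] del: fps_const_neg)
qed

text \<open>The substitution \<open>v = w / (w - \<epsilon>)\<close> turns the generating series of the moments of an operator
  \<open>M\<close> into that of the moments of \<open>(1 - M) / \<epsilon>\<close>.\<close>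
lemma moments_substitution:
  fixes p :: "nat \<Rightarrow> 'a::idom" and b :: 'a
  defines "u \<equiv> fps_const b * fps_X"
  defines "geo \<equiv> Abs_fps (\<lambda>n. b ^ n)"
  defines "V \<equiv> - (u * geo)"
  shows "(1 - u) * geo = 1" and "V $ 0 = 0"
    and "Abs_fps (\<lambda>k. b ^ k * (\<Sum>i\<le>k. of_nat (k choose i) * (- 1) ^ i * p i)) = geo * (Abs_fps p oo V)"
proof -
  show F: "(1 - u) * geo = 1"
  proof (rule fps_ext)
    fix n
    have "((1 - u) * geo) $ n = geo $ n - (fps_const b * (fps_X * geo)) $ n"
      by (simp add: u_def left_diff_distrib mult.assoc)
    then show "((1 - u) * geo) $ n = (1 :: 'a fps) $ n"
      by (cases n) (simp_all add: geo_def del: fps_mult_left_const_nth add: fps_mult_left_const_nth)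
  qed
  show V0: "V $ 0 = 0" by (simp add: V_def u_def)
  \<comment> \<open>Generating series of the binomial coefficients, with signs and powers of b; the
    recursion obtained from (1 - u) geo = 1 is Pascal's rule.\<close>
  have H: "(geo * V ^ i) $ n = b ^ n * (of_nat (n choose i) * (- 1) ^ i)" for i n
  proof (induction i arbitrary: n)
    case (Suc i)
    let ?H = "geo * V ^ Suc i"
    have "(1 - u) * ?H = ((1 - u) * geo) * V * V ^ i" by (simp add: mult_ac)
    also have "\<dots> = - (u * (geo * V ^ i))" unfolding F by (simp add: V_def mult_ac)
    finally have "?H = u * ?H - u * (geo * V ^ i)" by (simp add: left_diff_distrib algebra_simps)
    then have "?H = fps_const b * (fps_X * (?H - geo * V ^ i))"
      by (simp add: u_def right_diff_distrib mult.assoc)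
    then have rec: "?H $ n = b * ((fps_X * (?H - geo * V ^ i)) $ n)" for n
      by (metis fps_mult_left_const_nth)
    show ?case
    proof (induction n)
      case 0
      then show ?case using rec[of 0] by simp
    next
      case (Suc n)
      have "?H $ Suc n = b * (?H $ n - (geo * V ^ i) $ n)" using rec[of "Suc n"] by simp
      also have "\<dots> = b ^ Suc n * (of_nat (Suc n choose Suc i) * (- 1) ^ Suc i)"
        unfolding Suc \<open>\<And>n. (geo * V ^ i) $ n = _\<close> by (simp add: algebra_simps)
      finally show ?case .
    qed
  qed (simp add: geo_def)
  show "Abs_fps (\<lambda>k. b ^ k * (\<Sum>i\<le>k. of_nat (k choose i) * (- 1) ^ i * p i)) = geo * (Abs_fps p oo V)"
  proof (rule fps_ext)
    fix n
    have comp: "(Abs_fps p oo V) $ m = (\<Sum>i\<in>{0..n}. p i * (V ^ i) $ m)" if "m \<le> n" for m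
      unfolding fps_compose_nth using that startsby_zero_power_prefix[OF V0]
      by (intro sum.mono_neutral_cong_left) auto
    have "(geo * (Abs_fps p oo V)) $ n = (\<Sum>j\<in>{0..n}. geo $ j * (\<Sum>i\<in>{0..n}. p i * (V ^ i) $ (n - j)))"
      unfolding fps_mult_nth by (intro sum.cong refl) (simp add: comp)
    also have "\<dots> = (\<Sum>j\<in>{0..n}. \<Sum>i\<in>{0..n}. p i * (geo $ j * (V ^ i) $ (n - j)))"
      by (simp add: sum_distrib_left mult_ac)
    also have "\<dots> = (\<Sum>i\<in>{0..n}. \<Sum>j\<in>{0..n}. p i * (geo $ j * (V ^ i) $ (n - j)))" by (rule sum.swap)
    also have "\<dots> = (\<Sum>i\<in>{0..n}. p i * (geo * V ^ i) $ n)"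
      by (simp add: fps_mult_nth sum_distrib_left)
    also have "\<dots> = b ^ n * (\<Sum>i\<le>n. of_nat (n choose i) * (- 1) ^ i * p i)"
      unfolding H sum_distrib_left atLeast0AtMost by (intro sum.cong refl) (simp add: mult_ac)
    finally show "Abs_fps (\<lambda>k. b ^ k * (\<Sum>i\<le>k. of_nat (k choose i) * (- 1) ^ i * p i)) $ n = (geo * (Abs_fps p oo V)) $ n"
      by simp
  qed
qed

section \<open>Limits of the moments\<close>

abbreviation \<epsilon> :: Cq where "\<epsilon> \<equiv> q ^ 2 - 1"

lemma \<epsilon>_nz: "\<epsilon> \<noteq> 0"
  using q_power_ne_1[of 2] by simp

text \<open>This is the constant by which (1 - \<xi>_i) / (q^2 - 1) exceeds x_i. The factor q - 1
  cancels because q^2 - 1 = (q - 1) (q + 1).\<close>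

lemma tendsto_q1_offset:
  assumes "N \<ge> 1"
  shows "tendsto_q1 ((1 - q powi (1 - int N)) / \<epsilon>) ((of_nat N - 1) / 2)"
proof -
  have geo: "(q - 1) * (\<Sum>i<n. q ^ i) = q ^ n - 1" for n
    by (induction n) (simp_all add: algebra_simps)
  have q_minus: "q = - 1 \<Longrightarrow> \<epsilon> = 0" by (drule arg_cong[of _ _ "\<lambda>x. x ^ 2"]) simp
  have "q + 1 = 0 \<Longrightarrow> q = - 1" by (rule eq_neg_iff_add_eq_0[THEN iffD2])
  with q_minus have q_minus: "q + 1 = 0 \<Longrightarrow> \<epsilon> = 0" by blast
  have q1: "q - 1 \<noteq> 0" "q + 1 \<noteq> 0"
    using \<epsilon>_nz q_minus by auto
  have "1 - int N = - int (N - 1)" using assms by linarith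
  then have "q powi (1 - int N) = inverse q ^ (N - 1)"
    by (simp only: power_int_minus power_int_of_nat power_inverse)
  then have "(1 - q powi (1 - int N)) = inverse q ^ (N - 1) * (q ^ (N - 1) - 1)"
    by (simp add: right_diff_distrib flip: power_mult_distrib)
  also have "\<dots> = inverse q ^ (N - 1) * (\<Sum>i<N - 1. q ^ i) * (q - 1)"
    unfolding geo[symmetric] by (simp add: mult_ac)
  also have "\<dots> / \<epsilon> = inverse q ^ (N - 1) * (\<Sum>i<N - 1. q ^ i) * inverse (q + 1)"
  proof -
    have "\<epsilon> = (q - 1) * (q + 1)" by (simp add: power2_eq_square algebra_simps)
    then show ?thesis using q1 by (simp add: divide_inverse)
  qed
  finally have eq: "(1 - q powi (1 - int N)) / \<epsilon> = inverse q ^ (N - 1) * (\<Sum>i<N - 1. q ^ i) * inverse (q + 1)" .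
  have "tendsto_q1 (q + 1) (1 + 1)" by (intro tendsto_q1_add) simp_all
  then have "tendsto_q1 (inverse (q + 1)) (inverse (1 + 1))" by (rule tendsto_q1_inverse) simp
  then have "tendsto_q1 (inverse q ^ (N - 1) * (\<Sum>i<N - 1. q ^ i) * inverse (q + 1)) (1 * (\<Sum>i<N - 1. 1 ^ i) * inverse (1 + 1))"
    by (intro tendsto_q1_mult tendsto_q1_inverse_q_power tendsto_q1_sum tendsto_q1_power) simp_all
  moreover have "1 * (\<Sum>i<N - 1. 1 ^ i) * inverse (1 + 1) = (of_nat N - 1) / (2 :: complex)"
    unfolding power_one sum_constant card_lessThan of_nat_diff[OF assms] divide_inverse one_add_one
    by (simp only: mult_1_left mult_1_right of_nat_1)
  ultimately show ?thesis unfolding eq by metis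
qed

text \<open>The generating series \<open>K\<close> of the moments satisfies K D = - q W with
  polynomials \<open>D\<close> and \<open>W\<close> in the series variable w, where (w - \<epsilon>)
  W = H and the coefficients of \<open>H\<close> converge. As \<epsilon> tends to 0,
  \<open>W\<close> tends to H' / w, which is the classical formula. The moments are scaled by
  \<epsilon>, as the x_i are, and not by q - 1/q; the ratio q of the two tends to 1.\<close>

lemma clim_moments:
  fixes p :: "nat \<Rightarrow> Cq mpol" and C :: "nat \<Rightarrow> complex mpol"
  assumes N: "N \<ge> 1"
    and p0: "p 0 = scal ((1 - inverse q ^ (2 * N)) / (q - inverse q))"
    and gfq: "(1 + fps_const (scal (q - inverse q)) * Abs_fps (\<lambda>n. if n \<ge> 1 then p n else 0)) *
       (\<Prod>i\<in>{1..N}. 1 - fps_const (scal (q powi (1 - int N)) - scal \<epsilon> * Var i) * fps_X) =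
      (\<Prod>i\<in>{1..N}. 1 - fps_const (scal (q powi (-2)) * (scal (q powi (1 - int N)) - scal \<epsilon> * Var i)) * fps_X)"
    and gfc: "(1 - of_nat N * fps_X - Abs_fps (\<lambda>n. if n \<ge> 2 then C (n - 1) else 0)) *
       (\<Prod>i\<in>{1..N}. 1 - fps_const (Var i + scal ((of_nat N - 1) / 2)) * fps_X) =
      (\<Prod>i\<in>{1..N}. 1 - fps_const (Var i + scal ((of_nat N + 1) / 2)) * fps_X)"
  shows "clim (scal (inverse \<epsilon>) ^ k * (\<Sum>i\<le>k. of_nat (k choose i) * (- 1) ^ i * p i))
    (if k = 0 then of_nat N else C k)"
proof -
  let ?I = "{1..N}" and ?\<kappa> = "q - inverse q" and ?s = "inverse q ^ (2 * N)" and ?b = "scal (inverse \<epsilon>) :: Cq mpol"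
  define y where "y = (\<lambda>i. Var i + scal ((1 - q powi (1 - int N)) / \<epsilon>) :: Cq mpol)"
  define \<xi> where "\<xi> = (\<lambda>i. scal (q powi (1 - int N)) - scal \<epsilon> * Var i :: Cq mpol)"
  define y' where "y' = (\<lambda>i. Var i + scal ((of_nat N - 1) / 2) :: complex mpol)"
  define s2 where "s2 = (scal (q powi (-2)) :: Cq mpol)"
  have q2: "q powi (-2) = inverse q ^ 2"
  proof -
    have "- 2 = - int 2" by simp
    then show ?thesis by (simp only: power_int_minus power_int_of_nat power_inverse)
  qed
  have \<kappa>: "?\<kappa> \<noteq> 0" by (rule q_diff_nz)
  have \<epsilon>\<kappa>: "\<epsilon> = q * ?\<kappa>" by (simp add: power2_eq_square algebra_simps)
  have cancel: "scal \<epsilon> * ?b = 1" by (simp only: scal_mult[symmetric] right_inverse[OF \<epsilon>_nz] scal_one)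
  have "\<epsilon> * ((1 - q powi (1 - int N)) / \<epsilon>) = 1 - q powi (1 - int N)" using \<epsilon>_nz by simp
  then have "scal \<epsilon> * scal ((1 - q powi (1 - int N)) / \<epsilon>) = (scal (1 - q powi (1 - int N)) :: Cq mpol)"
    by (simp only: scal_mult[symmetric])
  then have "scal \<epsilon> * scal ((1 - q powi (1 - int N)) / \<epsilon>) = (1 - scal (q powi (1 - int N)) :: Cq mpol)"
    by (simp only: scal.c_diff[of 1] scal_one)
  then have y\<xi>: "scal \<epsilon> * y i = 1 - \<xi> i" for i
    by (simp only: y_def \<xi>_def distrib_left) simp
  have \<xi>b: "(1 - \<xi> i) * ?b = y i" for i
    unfolding y\<xi>[symmetric] using cancel by (simp add: mult_ac)
  have "inverse q ^ 2 * \<epsilon> = 1 - inverse q ^ 2"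
    using q_nz by (simp add: right_diff_distrib flip: power_mult_distrib)
  then have "scal (inverse q ^ 2) * scal \<epsilon> = (scal (1 - inverse q ^ 2) :: Cq mpol)"
    by (simp only: scal_mult[symmetric])
  then have s2\<epsilon>: "s2 * scal \<epsilon> = 1 - s2"
    unfolding s2_def q2 by (simp only: scal.c_diff[of 1] scal_one)
  have s2b: "(1 - s2 * \<xi> i) * ?b = s2 * (1 + y i)" for i
  proof -
    have "1 - s2 * \<xi> i = (1 - s2) + s2 * (1 - \<xi> i)" by (simp add: algebra_simps)
    also have "\<dots> = s2 * (1 + y i) * scal \<epsilon>" unfolding s2\<epsilon>[symmetric] y\<xi>[symmetric] by (simp add: algebra_simps)
    finally show ?thesis using cancel by (simp add: mult_ac)
  qed
  define u where "u = fps_const ?b * fps_X"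
  define geo where "geo = Abs_fps (\<lambda>n. ?b ^ n)"
  define V where "V = - (u * geo)"
  define G where "G = Abs_fps p"
  define K where "K = Abs_fps (\<lambda>k. ?b ^ k * (\<Sum>i\<le>k. of_nat (k choose i) * (- 1) ^ i * p i))"
  note sub = moments_substitution(1,2)[where b = ?b, folded u_def, folded geo_def, folded V_def]
    moments_substitution(3)[where b = ?b and p = p, folded u_def, folded geo_def, folded V_def, folded G_def K_def]
  have FV: "(1 - u) * V = - u" unfolding V_def using sub(1) by (simp add: mult_ac)
  \<comment> \<open>The zeroth moment satisfies (q - 1/q) p_0 + q^(-2N) = 1, so the constant 1 of
    the given formula can be absorbed into the full series.\<close>
  have G: "(fps_const (scal ?\<kappa>) * G + fps_const (scal ?s)) * (\<Prod>i\<in>?I. 1 - fps_const (\<xi> i) * fps_X) =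
      (\<Prod>i\<in>?I. 1 - fps_const (s2 * \<xi> i) * fps_X)"
  proof -
    have "fps_const (scal ?\<kappa>) * G + fps_const (scal ?s) = 1 + fps_const (scal ?\<kappa>) * Abs_fps (\<lambda>n. if n \<ge> 1 then p n else 0)"
    proof (rule fps_ext)
      fix n
      show "(fps_const (scal ?\<kappa>) * G + fps_const (scal ?s)) $ n = (1 + fps_const (scal ?\<kappa>) * Abs_fps (\<lambda>n. if n \<ge> 1 then p n else 0)) $ n"
      proof (cases n)
        case 0
        have "scal ?\<kappa> * p 0 + scal ?s = scal (?\<kappa> * ((1 - ?s) / ?\<kappa>) + ?s)"
          unfolding p0 by (simp only: scal_mult scal_add)
        also have "?\<kappa> * ((1 - ?s) / ?\<kappa>) + ?s = 1" using \<kappa> by simp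
        finally show ?thesis using 0 by (simp add: G_def scal_one)
      qed (simp add: G_def)
    qed
    then show ?thesis using gfq by (simp only: \<xi>_def s2_def)
  qed
  define D where "D = (\<Prod>i\<in>?I. [:1, - y i:])"
  define B where "B = (\<Prod>i\<in>?I. [:1, - (s2 * (1 + y i)):])"
  \<comment> \<open>Substitute \<open>V\<close> for the variable and multiply each of the N factors
    by 1 - u, which clears the denominator of \<open>V\<close>.\<close>
  have key: "(fps_const (scal ?\<kappa>) * ((1 - u) * K) + fps_const (scal ?s)) * fps_of_poly D = fps_of_poly B"
  proof -
    have lin: "(1 - u) * (1 - fps_const a * V) = 1 - fps_const ((1 - a) * ?b) * fps_X" for a
    proof -
      have "(1 - u) * (1 - fps_const a * V) = (1 - u) - fps_const a * ((1 - u) * V)" by (simp add: algebra_simps)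
      also have "\<dots> = 1 - (1 - fps_const a) * u" unfolding FV by (simp add: algebra_simps)
      also have "(1 - fps_const a) * u = fps_const ((1 - a) * ?b) * fps_X"
        unfolding u_def by (simp only: fps_const_mult[symmetric] fps_const_sub[symmetric] fps_const_1_eq_1 mult.assoc)
      finally show ?thesis .
    qed
    have GK: "(1 - u) * K = G oo V"
      unfolding sub(3) using sub(1) by (simp only: mult.assoc[symmetric] mult_1_left)
    have "(fps_const (scal ?\<kappa>) * (G oo V) + fps_const (scal ?s)) * (\<Prod>i\<in>?I. 1 - fps_const (\<xi> i) * V) =
        (\<Prod>i\<in>?I. 1 - fps_const (s2 * \<xi> i) * V)"
      using arg_cong[OF G, of "\<lambda>f. f oo V"]
      by (simp only: fps_compose_mult_distrib[OF sub(2)] fps_compose_add_distrib fps_const_compose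
          fps_compose_prod_distrib[OF sub(2)] fps_compose_linear'[OF sub(2)])
    then have "(fps_const (scal ?\<kappa>) * (G oo V) + fps_const (scal ?s)) * ((\<Prod>i\<in>?I. 1 - u) * (\<Prod>i\<in>?I. 1 - fps_const (\<xi> i) * V)) =
        (\<Prod>i\<in>?I. 1 - u) * (\<Prod>i\<in>?I. 1 - fps_const (s2 * \<xi> i) * V)"
      by (simp only: mult.left_commute[of _ "\<Prod>i\<in>?I. 1 - u"])
    then have "(fps_const (scal ?\<kappa>) * (G oo V) + fps_const (scal ?s)) * (\<Prod>i\<in>?I. 1 - fps_const (y i) * fps_X) =
        (\<Prod>i\<in>?I. 1 - fps_const (s2 * (1 + y i)) * fps_X)"
      by (simp only: prod.distrib[symmetric] lin \<xi>b s2b)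
    then show ?thesis unfolding D_def B_def fps_of_poly_prod_linear GK .
  qed
  define H where "H = B - smult (scal ?s) D"
  have "fps_const (scal ?\<kappa>) * ((1 - u) * K) * fps_of_poly D = fps_of_poly H"
    using key unfolding H_def fps_of_poly_diff fps_of_poly_smult by (simp add: distrib_right algebra_simps)
  \<comment> \<open>At w = \<epsilon>, the zero of 1 - u, each factor of \<open>B\<close> is q^(-2)
    times the corresponding factor of \<open>D\<close>. So 1 - u can be divided out of
    \<open>H\<close>, and with it the pole in \<epsilon>.\<close>
  moreover have "poly H (scal \<epsilon>) = 0"
  proof -
    have "poly [:1, - (s2 * (1 + y i)):] (scal \<epsilon>) = s2 * poly [:1, - y i:] (scal \<epsilon>)" for i
    proof -
      have "poly [:1, - (s2 * (1 + y i)):] (scal \<epsilon>) = 1 - (s2 * scal \<epsilon>) * (1 + y i)" by (simp add: algebra_simps)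
      also have "\<dots> = 1 - (s2 * scal \<epsilon>) - s2 * (scal \<epsilon> * y i)" by (simp add: algebra_simps)
      also have "\<dots> = s2 - s2 * (scal \<epsilon> * y i)" unfolding s2\<epsilon> by simp
      finally show ?thesis by (simp add: algebra_simps)
    qed
    moreover have "s2 ^ N = scal ?s"
    proof -
      have "s2 ^ n = scal (inverse q ^ (2 * n))" for n
        unfolding s2_def q2 by (induction n) (simp_all only: power_0 scal_one mult_0_right power_Suc mult_Suc_right power_add scal_mult)
      then show ?thesis .
    qed
    ultimately show ?thesis unfolding H_def B_def D_def poly_diff poly_smult poly_prod
      by (simp add: prod.distrib)
  qed
  then obtain W where W: "H = [:- scal \<epsilon>, 1:] * W" by (auto simp: poly_eq_0_iff_dvd)
  ultimately have eqW: "fps_const (scal ?\<kappa>) * ((1 - u) * K) * fps_of_poly D = fps_of_poly [:- scal \<epsilon>, 1:] * fps_of_poly W"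
    by (simp only: fps_of_poly_mult)
  have U: "(K * fps_of_poly D) $ k = - (scal q * coeff W k)" for k
  proof -
    have "fps_of_poly [:- scal \<epsilon>, 1:] = - (fps_const (scal \<epsilon>) * (1 - u))"
    proof -
      have "fps_const (scal \<epsilon>) * u = fps_X"
        unfolding u_def mult.assoc[symmetric] fps_const_mult cancel by simp
      then show ?thesis by (simp add: fps_of_poly_pCons right_diff_distrib fps_const_neg[symmetric] del: fps_const_neg)
    qed
    with eqW have "fps_const (scal ?\<kappa>) * ((1 - u) * K) * fps_of_poly D + fps_const (scal \<epsilon>) * (1 - u) * fps_of_poly W = 0"
      by simp
    then have "(1 - u) * (fps_const (scal ?\<kappa>) * (K * fps_of_poly D) + fps_const (scal \<epsilon>) * fps_of_poly W) = 0"
      by (simp only: distrib_left mult_ac)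
    then have "geo * ((1 - u) * (fps_const (scal ?\<kappa>) * (K * fps_of_poly D) + fps_const (scal \<epsilon>) * fps_of_poly W)) = 0" by simp
    then have "fps_const (scal ?\<kappa>) * (K * fps_of_poly D) + fps_const (scal \<epsilon>) * fps_of_poly W = 0"
      using sub(1) by (simp only: mult.assoc[symmetric] mult.commute[of geo] mult_1_left)
    from arg_cong[OF this, of "\<lambda>f. f $ k"]
    have "scal ?\<kappa> * (K * fps_of_poly D) $ k + scal \<epsilon> * coeff W k = 0" by simp
    then have "scal (inverse ?\<kappa>) * (scal ?\<kappa> * (K * fps_of_poly D) $ k + scal \<epsilon> * coeff W k) = 0" by simp
    then have "scal (inverse ?\<kappa> * ?\<kappa>) * (K * fps_of_poly D) $ k + scal (inverse ?\<kappa> * \<epsilon>) * coeff W k = 0"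
      by (simp only: scal_mult distrib_left mult.assoc)
    moreover have "inverse ?\<kappa> * ?\<kappa> = 1" "inverse ?\<kappa> * \<epsilon> = q" using \<kappa> unfolding \<epsilon>\<kappa> by simp_all
    ultimately have "(K * fps_of_poly D) $ k + scal q * coeff W k = 0" by (simp only: scal_one mult_1_left)
    then show ?thesis by (simp add: eq_neg_iff_add_eq_0)
  qed
  define D' where "D' = (\<Prod>i\<in>?I. [:1, - y' i:])"
  define H' where "H' = (\<Prod>i\<in>?I. [:1, - (1 + y' i):]) - D'"
  have yl: "clim (y i) (y' i)" for i
    unfolding y_def y'_def by (intro clim_add clim_Var clim_scal tendsto_q1_offset N)
  have "clim s2 (scal 1)" unfolding s2_def q2 by (rule clim_scal, rule tendsto_q1_inverse_q_power)
  then have s2l: "clim s2 1" unfolding scal_one .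
  have Dl: "clim (coeff D k) (coeff D' k)" for k
    unfolding D_def D'_def by (intro clim_coeff_prod yl)
  have "clim (s2 * (1 + y i)) (1 * (1 + y' i))" for i
    by (intro clim_mult clim_add clim_1 s2l yl)
  then have Hl: "clim (coeff H k) (coeff H' k)" for k
  proof -
    have "clim (coeff H k) (coeff (\<Prod>i\<in>?I. [:1, - (1 * (1 + y' i)):]) k - scal 1 * coeff D' k)"
      unfolding H_def B_def coeff_diff coeff_smult
      by (intro clim_diff clim_coeff_prod clim_mult Dl clim_scal tendsto_q1_inverse_q_power \<open>clim (s2 * (1 + y _)) _\<close>)
    then show ?thesis by (simp add: H'_def scal_one)
  qed
  have H0: "coeff H k = 0" "coeff H' k = 0" if "k > N" for k
  proof -
    have "degree B \<le> N" "degree D \<le> N" "degree (\<Prod>i\<in>?I. [:1, - (1 + y' i):]) \<le> N" "degree D' \<le> N"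
      unfolding B_def D_def D'_def using degree_prod_linear[of _ ?I] by (metis card_atLeastAtMost diff_Suc_1)+
    then show "coeff H k = 0" "coeff H' k = 0"
      using that by (simp_all add: H_def H'_def coeff_eq_0)
  qed
  have "degree H \<le> N" using H0(1) by (intro degree_le) auto
  then have W0: "coeff W k = 0" if "k \<ge> N" for k
  proof (cases "W = 0")
    case False
    then have "degree H = 1 + degree W" unfolding W by (subst degree_mult_eq) simp_all
    then show ?thesis using \<open>degree H \<le> N\<close> that by (intro coeff_eq_0) simp
  qed simp
  have Wrec: "coeff W k = coeff H (Suc k) + scal \<epsilon> * coeff W (Suc k)" for k
    unfolding W by simp
  have \<epsilon>l: "clim (scal \<epsilon>) (scal (1 ^ 2 - 1))"
    by (intro clim_scal tendsto_q1_diff tendsto_q1_power) simp_all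
  \<comment> \<open>Downward induction from the degree bound: in \<open>Wrec\<close> the next
    coefficient is multiplied by \<epsilon>, which tends to 0.\<close>
  have Wl: "clim (coeff W k) (coeff H' (Suc k))" for k
  proof (induction "N - k" arbitrary: k)
    case 0
    then show ?case using W0[of k] H0(2)[of "Suc k"] by simp
  next
    case (Suc n)
    have "clim (coeff H (Suc k) + scal \<epsilon> * coeff W (Suc k)) (coeff H' (Suc k) + scal (1 ^ 2 - 1) * coeff H' (Suc (Suc k)))"
      by (intro clim_add clim_mult Hl \<epsilon>l Suc(1)) (use Suc(2) in simp)
    then show ?case unfolding Wrec[of k] by (simp add: scal_zero)
  qed
  \<comment> \<open>The classical moments together with the zeroth, N, which accounts for the linear
    term of the classical formula.\<close>
  define c where "c = (\<lambda>k. if k = 0 then of_nat N else C k)"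
  have D0: "coeff D 0 = 1" "coeff D' 0 = 1"
    unfolding D_def D'_def by (simp_all add: poly_0_coeff_0[symmetric] poly_prod)
  have Krec: "K $ k = - (scal q * coeff W k) - (\<Sum>i<k. K $ i * coeff D (k - i))" for k
  proof -
    have "(\<Sum>i\<in>{0..k}. K $ i * coeff D (k - i)) = K $ k + (\<Sum>i<k. K $ i * coeff D (k - i))"
      by (simp add: atLeast0AtMost lessThan_Suc_atMost[symmetric] D0)
    then show ?thesis using U[of k] by (simp add: fps_mult_nth algebra_simps)
  qed
  have crec: "c k = - coeff H' (Suc k) - (\<Sum>i<k. c i * coeff D' (k - i))" for k
  proof -
    have "(1 - fps_X * Abs_fps c) * fps_of_poly D' = fps_of_poly (\<Prod>i\<in>?I. [:1, - (1 + y' i):])"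
    proof -
      have "1 - of_nat N * fps_X - Abs_fps (\<lambda>n. if n \<ge> 2 then C (n - 1) else 0) = 1 - fps_X * Abs_fps c"
      proof (rule fps_ext)
        fix n
        consider "n = 0" | "n = 1" | k where "n = Suc (Suc k)" by (metis One_nat_def not0_implies_Suc)
        then show "(1 - of_nat N * fps_X - Abs_fps (\<lambda>n. if n \<ge> 2 then C (n - 1) else 0)) $ n = (1 - fps_X * Abs_fps c) $ n"
          by cases (simp_all add: c_def fps_of_nat[symmetric] del: fps_of_nat)
      qed
      moreover have "Var i + scal ((of_nat N + 1) / 2) = 1 + y' i" for i
      proof -
        have "(of_nat N + 1) / 2 = 1 + (of_nat N - 1) / (2 :: complex)" by (simp add: field_simps)
        then show ?thesis by (simp only: y'_def scal_add scal_one ac_simps)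
      qed
      ultimately show ?thesis using gfc by (simp only: D'_def y'_def fps_of_poly_prod_linear)
    qed
    from arg_cong[OF this, of "\<lambda>f. f $ Suc k"]
    have "(Abs_fps c * fps_of_poly D') $ k = - coeff H' (Suc k)"
      by (simp add: H'_def left_diff_distrib mult.assoc algebra_simps)
    moreover have "(\<Sum>i\<in>{0..k}. c i * coeff D' (k - i)) = c k + (\<Sum>i<k. c i * coeff D' (k - i))"
      by (simp add: atLeast0AtMost lessThan_Suc_atMost[symmetric] D0)
    ultimately show ?thesis by (simp add: fps_mult_nth algebra_simps)
  qed
  \<comment> \<open>Both sequences obey the same recursion, which is solvable because
    \<open>D\<close> and \<open>D'\<close> have constant term 1.\<close>
  have "clim (K $ k) (c k)"
  proof (induction k rule: less_induct)
    case (less k)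
    have "clim (- (scal q * coeff W k) - (\<Sum>i<k. K $ i * coeff D (k - i)))
       (- (scal 1 * coeff H' (Suc k)) - (\<Sum>i<k. c i * coeff D' (k - i)))"
      by (intro clim_diff clim_minus clim_mult clim_sum clim_scal tendsto_q1_q Wl Dl less) simp
    then show ?case unfolding Krec[of k] crec[of k] by (simp add: scal_one)
  qed
  then show ?thesis by (simp add: K_def c_def)
qed

section \<open>Permutations acting on multi-indices\<close>

definition act :: "nat \<Rightarrow> (nat \<Rightarrow> nat) \<Rightarrow> (nat \<Rightarrow> nat) \<Rightarrow> nat \<Rightarrow> nat" where
  "act m \<pi> K = restrict (K \<circ> \<pi>) {1..m}"

lemma act_midx: "\<pi> permutes {1..m} \<Longrightarrow> K \<in> midx N m \<Longrightarrow> act m \<pi> K \<in> midx N m"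
  using permutes_in_image[of \<pi> "{1..m}"] by (auto simp: act_def midx_def PiE_iff)

text \<open>Precomposition is a right action; this reverses the order of products here and in
  \<open>P_mult\<close>.\<close>

lemma act_comp: "\<pi> permutes {1..m} \<Longrightarrow> act m \<pi> (act m \<sigma> K) = act m (\<sigma> \<circ> \<pi>) K"
  using permutes_in_image[of \<pi> "{1..m}"] by (auto simp: act_def fun_eq_iff)

text \<open>A transposition of distant points is one of closer points conjugated by an adjacent
  transposition.\<close>

lemma permutes_adjacent_induct [consumes 1, case_names id adj comp]:
  assumes "\<pi> permutes {1..m}" and id: "P id"
    and adj: "\<And>k. Suc k < m \<Longrightarrow> P (Transposition.transpose (Suc k) (Suc (Suc k)))"
    and comp: "\<And>\<sigma> \<rho>. P \<sigma> \<Longrightarrow> P \<rho> \<Longrightarrow> \<sigma> permutes {1..m} \<Longrightarrow> \<rho> permutes {1..m} \<Longrightarrow> P (\<sigma> \<circ> \<rho>)"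
  shows "P \<pi>"
proof -
  have T: "P (Transposition.transpose a (Suc (a + n)))" if "1 \<le> a" "Suc (a + n) \<le> m" for a n
    using that(2)
  proof (induction n)
    case 0
    then show ?case using adj[of "a - 1"] that(1) by simp
  next
    case (Suc n)
    let ?b = "Suc (a + n)"
    have s: "P (Transposition.transpose ?b (Suc ?b))" using adj[of "?b - 1"] Suc.prems by simp
    have p: "Transposition.transpose ?b (Suc ?b) permutes {1..m}" "Transposition.transpose a ?b permutes {1..m}"
      using Suc.prems that(1) by (auto intro!: permutes_swap_id)
    have "Transposition.transpose a (Suc ?b) =
        Transposition.transpose ?b (Suc ?b) \<circ> (Transposition.transpose a ?b \<circ> Transposition.transpose ?b (Suc ?b))"
      by (auto simp: fun_eq_iff Transposition.transpose_def)
    moreover have "P (Transposition.transpose a ?b)" using Suc by simp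
    ultimately show ?case using s p by (simp only: add_Suc_right) (intro comp permutes_compose)
  qed
  have T': "P (Transposition.transpose a b)" if "a \<in> {1..m}" "b \<in> {1..m}" "a < b" for a b
    using T[of a "b - Suc a"] that by simp
  have T'': "P (Transposition.transpose a b)" if "a \<in> {1..m}" "b \<in> {1..m}" "a \<noteq> b" for a b
    using T'[of a b] T'[of b a] that by (cases "a < b") (auto simp: transpose_commute)
  show ?thesis
    using assms(1) finite_atLeastAtMost
  proof (induction rule: permutes_induct)
    case (swap a b p)
    then show ?case by (intro comp T'' permutes_swap_id)
  qed (rule id)
qed

context classical
begin

section \<open>Casimir elements and the classical average as traces\<close>

definition G :: "nat \<Rightarrow> (nat \<Rightarrow> nat) \<Rightarrow> (nat \<Rightarrow> nat) \<Rightarrow> (nat \<times> nat, complex) falg" where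
  "G m I J = prod_list (map (\<lambda>k. gen (I k, J k)) [1..<Suc m])"

lemma G_cong: "(\<And>k. k \<in> {1..m} \<Longrightarrow> I k = I' k) \<Longrightarrow> (\<And>k. k \<in> {1..m} \<Longrightarrow> J k = J' k) \<Longrightarrow> G m I J = G m I' J'"
  unfolding G_def by (intro arg_cong[of _ _ prod_list] map_cong refl) auto

lemma G_carrier: "I \<in> midx N m \<Longrightarrow> (\<And>k. k \<in> {1..m} \<Longrightarrow> J k \<in> {1..N}) \<Longrightarrow> G m I J \<in> carrier (free_alg (gl_gens N))"
proof -
  assume IJ: "I \<in> midx N m" "\<And>k. k \<in> {1..m} \<Longrightarrow> J k \<in> {1..N}"
  have "set ks \<subseteq> {1..m} \<Longrightarrow> prod_list (map (\<lambda>k. gen (I k, J k)) ks) \<in> carrier (free_alg (gl_gens N) :: (nat \<times> nat, complex) falg ring)" for ks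
  proof (induction ks)
    case (Cons k ks)
    then have "(I k, J k) \<in> gl_gens N" using midx_in[OF IJ(1), of k] IJ(2)[of k] by (auto simp: gl_gens_def)
    then show ?case using Cons by (simp add: carrier_closed)
  qed (simp add: carrier_closed)
  note * = this
  show "G m I J \<in> carrier (free_alg (gl_gens N))" unfolding G_def by (rule *) auto
qed

text \<open>At t = 1 the conjugate \<open>Xs (E 0) k\<close> is \<open>E k\<close>, which acts in
  factor k alone, so the product is the matrix of ordered monomials in the generators.\<close>

lemma asc_E: "C.asc (Xs (E 0)) 0 m = \<Phi> m (G m)"
proof (induction m)
  case 0
  show ?case by (simp add: \<Phi>_def midx_0 G_def \<eta>_hom)
next
  case (Suc m)
  let ?I = "{1..N}"
  have G: "G (Suc m) (I(Suc m := a)) (J(Suc m := b)) = G m I J * gen (a, b)" for I J a b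
  proof -
    have "G (Suc m) (I(Suc m := a)) (J(Suc m := b)) = G m (I(Suc m := a)) (J(Suc m := b)) * gen (a, b)"
      by (simp add: G_def)
    also have "G m (I(Suc m := a)) (J(Suc m := b)) = G m I J" by (rule G_cong) auto
    finally show ?thesis .
  qed
  have u: "u (Suc m) (I(Suc m := a)) (J(Suc m := b)) = u m I J * e m a b" for I J a b
    using u_cong[of m "I(Suc m := a)" I "J(Suc m := b)" J] by simp
  have swap: "\<eta> p * u m I J * (\<eta> p' * e m a b) = \<eta> (p * p') * (u m I J * e m a b)" for p p' I J a b
  proof -
    have "\<eta> p * u m I J * (\<eta> p' * e m a b) = \<eta> p * (u m I J * \<eta> p') * e m a b" by (simp only: mult.assoc)
    then show ?thesis by (simp only: \<eta>_u \<eta>_hom mult.assoc)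
  qed
  have "C.asc (Xs (E 0)) 0 (Suc m) = \<Phi> m (G m) * E m"
    by (simp add: C.asc_Suc Suc Xs_E)
  also have "\<dots> = (\<Sum>I\<in>midx N m. \<Sum>J\<in>midx N m. \<Sum>a\<in>?I. \<Sum>b\<in>?I. \<eta> (G m I J * gen (a, b)) * (u m I J * e m a b))"
    unfolding \<Phi>_def sum_distrib_right unfolding E_def sum_distrib_left swap ..
  also have "\<dots> = (\<Sum>I\<in>midx N m. \<Sum>a\<in>?I. \<Sum>J\<in>midx N m. \<Sum>b\<in>?I. \<eta> (G m I J * gen (a, b)) * (u m I J * e m a b))"
    by (intro sum.cong refl sum.swap)
  finally show ?case unfolding \<Phi>_def sum_midx_Suc G u .
qed

lemma d_1: "d a = 1"
  by (simp add: d_def)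

text \<open>An operator that permutes the basis vectors by \<pi> selects from the matrix
  \<open>G m\<close> the entries in row I and column I composed with \<pi>. It is applied to cycles
  for the Casimir elements and to all permutations for the average.\<close>

lemma tr_shift:
  assumes x: "\<And>K J. K \<in> midx N m \<Longrightarrow> x * u m K J = u m (act m \<pi> K) J" and \<pi>: "\<pi> permutes {1..m}"
  shows "C.tr m (x * \<Phi> m (G m)) = \<eta> (w_rep N m \<pi>)"
proof -
  have xe: "x * (\<eta> p * u m I J) = \<eta> p * (x * u m I J)" if "I \<in> midx N m" for p I J
  proof -
    have "x * (\<eta> p * u m I J) = (x * u m I J) * \<eta> p" by (simp only: \<eta>_u[symmetric] mult.assoc)
    then show ?thesis unfolding x[OF that] \<eta>_u .
  qed
  have tr: "C.tr m (u m (act m \<pi> I) J) = (if J = act m \<pi> I then 1 else 0)" if "I \<in> midx N m" "J \<in> midx N m" for I J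
  proof -
    have "(\<forall>k\<in>{1..m}. act m \<pi> I k = J k \<and> act m \<pi> I k \<in> {1..N}) \<longleftrightarrow> J = act m \<pi> I"
      using midx_ext[OF act_midx[OF \<pi> that(1)] that(2)] midx_in[OF act_midx[OF \<pi> that(1)]] by auto
    then show ?thesis unfolding C.tr_u d_1 by (simp add: scal_one \<eta>_hom)
  qed
  have "C.tr m (x * \<Phi> m (G m)) = (\<Sum>I\<in>midx N m. \<Sum>J\<in>midx N m. if J = act m \<pi> I then \<eta> (G m I (act m \<pi> I)) else 0)"
    unfolding \<Phi>_def sum_distrib_left C.tr_sum
    by (intro sum.cong refl) (simp add: xe x C.tr_\<eta> tr)
  also have "\<dots> = (\<Sum>I\<in>midx N m. \<eta> (G m I (act m \<pi> I)))"
    using act_midx[OF \<pi>] by (intro sum.cong refl) simp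
  also have "\<dots> = (\<Sum>I\<in>midx N m. \<eta> (G m I (I \<circ> \<pi>)))"
    by (intro sum.cong refl arg_cong[of _ _ \<eta>] G_cong) (auto simp: act_def)
  finally show ?thesis by (simp add: w_rep_def G_def \<eta>_sum)
qed

lemma R_act:
  assumes "Suc k < m" "K \<in> midx N m"
  shows "R k * u m K J = u m (act m (Transposition.transpose (Suc k) (Suc (Suc k))) K) J"
proof -
  have "u m (K(Suc k := K (Suc (Suc k)), Suc (Suc k) := K (Suc k))) J = u m (act m (Transposition.transpose (Suc k) (Suc (Suc k))) K) J"
    using assms(1) by (intro u_cong) (auto simp: act_def Transposition.transpose_def)
  then show ?thesis using R_u[OF assms] by simp
qed

definition cyc_perm :: "nat \<Rightarrow> nat \<Rightarrow> nat" where
  "cyc_perm m = (\<lambda>k. if k \<in> {1..m} then if k = m then 1 else Suc k else k)"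

lemma cyc_perm_Suc: "cyc_perm (Suc (Suc j)) = cyc_perm (Suc j) \<circ> Transposition.transpose (Suc j) (Suc (Suc j))"
  by (auto simp: cyc_perm_def fun_eq_iff Transposition.transpose_def)

lemma cyc_perm_permutes: "cyc_perm (Suc j) permutes {1..Suc j}"
proof (induction j)
  case 0
  have "cyc_perm (Suc 0) = id" by (auto simp: cyc_perm_def fun_eq_iff)
  then show ?case by (simp only: permutes_id)
next
  case (Suc j)
  then have "cyc_perm (Suc j) permutes {1..Suc (Suc j)}" by (rule permutes_subset) auto
  then show ?case unfolding cyc_perm_Suc by (intro permutes_compose permutes_swap_id) auto
qed

text \<open>Each further generator is an adjacent transposition that lengthens the cycle by one
  point, so the Casimir elements come from the same product \<open>desc\<close> as the p_k.\<close>

lemma desc_u: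
  assumes "j < m" "K \<in> midx N m"
  shows "C.desc 0 j * u m K J = u m (act m (cyc_perm (Suc j)) K) J"
  using assms(1)
proof (induction j)
  case 0
  have "u m (act m (cyc_perm (Suc 0)) K) J = u m K J"
    by (rule u_cong) (auto simp: act_def cyc_perm_def)
  then show ?case by simp
next
  case (Suc j)
  have p: "cyc_perm (Suc j) permutes {1..m}" by (rule permutes_subset[OF cyc_perm_permutes]) (use Suc.prems in auto)
  have t: "Transposition.transpose (Suc j) (Suc (Suc j)) permutes {1..m}" using Suc.prems by (intro permutes_swap_id) auto
  have "C.desc 0 (Suc j) * u m K J = R j * (C.desc 0 j * u m K J)" by (simp add: mult.assoc)
  also have "\<dots> = u m (act m (Transposition.transpose (Suc j) (Suc (Suc j))) (act m (cyc_perm (Suc j)) K)) J"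
    using Suc by (simp add: R_act act_midx[OF p assms(2)])
  finally show ?case unfolding act_comp[OF t] cyc_perm_Suc .
qed

definition cas_rep :: "nat \<Rightarrow> (nat \<times> nat, complex) falg" where
  "cas_rep m = (\<Sum>i\<in>midx N m. prod_list (map (\<lambda>k. gen (i k, i (if k = m then 1 else Suc k))) [1..<Suc m]))"

lemma casimir_classof: "casimir N m = classof (cas_rep m)"
  by (simp add: casimir_def cas_rep_def classof_def)

lemma cas_rep_eq: "cas_rep m = w_rep N m (cyc_perm m)"
  unfolding cas_rep_def w_rep_def
  by (intro sum.cong refl arg_cong[of _ _ prod_list] map_cong) (auto simp: cyc_perm_def)

lemma w_rep_carrier: "\<pi> permutes {1..m} \<Longrightarrow> w_rep N m \<pi> \<in> carrier (free_alg (gl_gens N))"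
proof -
  assume \<pi>: "\<pi> permutes {1..m}"
  have "G m I (I \<circ> \<pi>) \<in> carrier (free_alg (gl_gens N))" if "I \<in> midx N m" for I
    using permutes_in_image[OF \<pi>] midx_in[OF that] by (intro G_carrier that) auto
  then show ?thesis unfolding w_rep_def by (intro free_alg_closed) (simp add: G_def)
qed

lemma \<eta>_cas:
  assumes "m \<ge> 1"
  shows "\<eta> (cas_rep m) = \<tau> 0 (E 0 ^ m)"
proof -
  obtain j where j: "m = Suc j" using assms by (cases m) auto
  have "\<eta> (cas_rep m) = C.tr m (C.desc 0 j * C.asc (Xs (E 0)) 0 m)"
    unfolding cas_rep_eq asc_E
    by (rule tr_shift[symmetric]) (unfold j, rule desc_u[OF lessI], assumption, rule cyc_perm_permutes)
  also have "\<dots> = C.tr m (C.asc (Xs (E 0)) 0 m * C.desc 0 j)"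
    by (rule C.cycD[OF C.desc_cyc C.asc_X_lev]) (simp_all add: j)
  finally show ?thesis using C.tr_asc_desc[of j] by (simp add: j del: C.tr.simps power_Suc)
qed

text \<open>\<open>E 0 - R 0\<close> commutes with \<open>E 1\<close>, hence with its powers. Under
  the partial trace over the second factor the two terms with \<open>R 0\<close> both become
  \<open>E 0 ^ m\<close> and cancel, so the trace of \<open>E 0 ^ m\<close> commutes with
  \<open>E 0\<close>.\<close>

lemma central_cas:
  assumes "m \<ge> 1"
  shows "central (cas_rep m)"
proof (rule central_of_commute)
  let ?z = "\<tau> 0 (E 0 ^ m)"
  have pow: "E k ^ n \<in> lev (Suc k)" for k n
    using E_lev[of k] by (induction n) (simp_all add: lev_mult C.lev_one)
  have z: "?z \<in> lev 0" by (rule C.\<tau>_lev[OF pow])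
  then show "\<eta> (cas_rep m) \<in> lev 0" unfolding \<eta>_cas[OF assms] .
  show "cas_rep m \<in> carrier (free_alg (gl_gens N))"
    unfolding cas_rep_eq using assms cyc_perm_permutes[of "m - 1"] by (intro w_rep_carrier) simp
  have EP: "E 1 * R 0 = R 0 * E 0" and PE: "R 0 * E 1 = E 0 * R 0"
    using E_Suc[of 0] by (simp_all add: mult.assoc R_R R_R_left)
  have comm1: "E 0 * E 1 = E 1 * E 0 + (R 0 * E 1 - R 0 * E 0)"
    unfolding E_commutator left_diff_distrib EP PE ..
  have EkP: "R 0 * E 0 ^ n = E 1 ^ n * R 0" "R 0 * E 1 ^ n = E 0 ^ n * R 0" for n
  proof (induction n)
    case (Suc n)
    have "R 0 * E 0 ^ Suc n = E 1 * (R 0 * E 0 ^ n)" using EP by (simp flip: mult.assoc)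
    then show "R 0 * E 0 ^ Suc n = E 1 ^ Suc n * R 0" using Suc by (simp add: mult.assoc)
    have "R 0 * E 1 ^ Suc n = E 0 * (R 0 * E 1 ^ n)" using PE by (simp flip: mult.assoc)
    then show "R 0 * E 1 ^ Suc n = E 0 ^ Suc n * R 0" using Suc by (simp add: mult.assoc)
  qed simp_all
  have comm: "E 0 * E 1 ^ n = E 1 ^ n * E 0 + (R 0 * E 1 ^ n - E 1 ^ n * R 0)" for n
  proof (induction n)
    case (Suc n)
    have "E 0 * E 1 ^ Suc n = (E 0 * E 1 ^ n) * E 1" by (simp only: power_Suc2 mult.assoc)
    also have "\<dots> = E 1 ^ n * (E 0 * E 1) + R 0 * E 1 ^ Suc n - E 1 ^ n * (R 0 * E 1)"
      unfolding Suc power_Suc2 by (simp only: distrib_right left_diff_distrib mult.assoc) simp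
    also have "\<dots> = E 1 ^ n * (E 1 * E 0) + R 0 * E 1 ^ Suc n - E 1 ^ n * (E 1 * R 0)"
      unfolding comm1 EP by (simp add: distrib_left right_diff_distrib)
    finally show ?case by (simp only: power_Suc2 mult.assoc add_diff_eq)
  qed simp
  have E1: "E 1 = R 0 * E 0 * ginv 0" using E_Suc[of 0] by (simp add: ginv_R)
  have conj: "E 1 ^ n = R 0 * E 0 ^ n * ginv 0" for n
    using EkP(1)[of n] by (simp add: ginv_R mult.assoc R_R)
  have \<tau>1: "\<tau> (Suc 0) (E 1 ^ n) = \<tau> 0 (E 0 ^ n)" for n
    unfolding conj by (rule C.\<tau>_conj[OF pow])
  have \<tau>diff: "\<tau> n (x - y) = \<tau> n x - \<tau> n y" for n x y
    using C.\<tau>_add[of n "x - y" y] by (simp add: eq_diff_eq)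
  have "\<tau> (Suc 0) (E 0 * E 1 ^ m) = \<tau> (Suc 0) (E 1 ^ m * E 0 + (R 0 * E 1 ^ m - E 1 ^ m * R 0))"
    unfolding comm[of m] ..
  then have "E 0 * ?z = ?z * E 0 + (E 0 ^ m - E 0 ^ m)"
    unfolding C.\<tau>_add \<tau>diff C.\<tau>_left[OF E_lev] C.\<tau>_right[OF E_lev] \<tau>1 EkP(2) EkP(1)[symmetric]
      C.\<tau>_left[OF pow] C.\<tau>_right[OF pow] C.\<tau>_g by simp
  then have "E 0 * ?z = ?z * E 0" by simp
  then show "\<eta> (cas_rep m) * (\<Sum>i\<in>{1..N}. \<Sum>j\<in>{1..N}. \<eta> (gen (i, j)) * e 0 i j) =
      (\<Sum>i\<in>{1..N}. \<Sum>j\<in>{1..N}. \<eta> (gen (i, j)) * e 0 i j) * \<eta> (cas_rep m)"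
    unfolding \<eta>_cas[OF assms] E_def[symmetric] ..
qed

definition P :: "nat \<Rightarrow> (nat \<Rightarrow> nat) \<Rightarrow> (nat \<times> nat, complex) falg quotients endo" where
  "P m \<pi> = (\<Sum>K\<in>midx N m. u m (act m \<pi> K) K)"

lemma P_u:
  assumes "K \<in> midx N m"
  shows "P m \<pi> * u m K J = u m (act m \<pi> K) J"
proof -
  have "P m \<pi> * u m K J = (\<Sum>L\<in>midx N m. if L = K then u m (act m \<pi> K) J else 0)"
    unfolding P_def sum_distrib_right by (intro sum.cong refl) (auto simp: u_mult_midx assms)
  then show ?thesis using assms by simp
qed

lemma P_mult: "\<pi> permutes {1..m} \<Longrightarrow> \<sigma> permutes {1..m} \<Longrightarrow> P m \<pi> * P m \<sigma> = P m (\<sigma> \<circ> \<pi>)"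
  by (rule ket_ext_u[of m]) (simp add: mult.assoc P_u act_midx act_comp)

lemma R_P: "Suc k < m \<Longrightarrow> R k = P m (Transposition.transpose (Suc k) (Suc (Suc k)))"
  by (rule ket_ext_u[of m]) (simp add: R_act P_u)

lemma P_id: "P m id = 1"
proof (rule ket_ext_u)
  fix J assume J: "J \<in> midx N m"
  have "u m (act m id J) J = u m J J" by (rule u_cong) (auto simp: act_def)
  then show "P m id * u m J J = 1 * u m J J" using J by (simp add: P_u)
qed

text \<open>The sum of all permutation operators times \<open>hs m\<close> is computed in two ways:
  the sum absorbs the generators, so the product is the sum itself; and \<open>hs m\<close> absorbs
  each permutation operator, so the product is m! times \<open>hs m\<close>.\<close>

lemma hs_eq_average: "hs m = (1 / fact m) \<cdot> (\<Sum>\<pi> | \<pi> permutes {1..m}. P m \<pi>)"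
proof -
  let ?A = "\<Sum>\<pi> | \<pi> permutes {1..m}. P m \<pi>" and ?T = "\<lambda>k. Transposition.transpose (Suc k) (Suc (Suc k))"
  have T: "?T k permutes {1..m}" if "Suc k < m" for k
    using that by (intro permutes_swap_id) auto
  have "?A * R k = 1 \<cdot> ?A" if k: "Suc k < m" for k
  proof -
    have "?A * R k = (\<Sum>\<pi> | \<pi> permutes {1..m}. P m (?T k \<circ> \<pi>))"
      unfolding R_P[OF k] sum_distrib_right by (intro sum.cong refl) (simp only: P_mult T[OF k] mem_Collect_eq)
    also have "\<dots> = ?A" by (rule setum_permutations_compose_left[OF T[OF k], symmetric])
    finally show ?thesis by (simp add: scal_one \<eta>_hom)
  qed
  then have 1: "?A * hs m = ?A"
    by (intro absorbs_r_hs_mult[of m]) (auto simp: absorbs_r_def)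
  have 2: "P m \<pi> * hs m = hs m" if "\<pi> permutes {1..m}" for \<pi>
    using that
  proof (induction rule: permutes_adjacent_induct)
    case id
    then show ?case by (simp only: P_id mult_1_left)
  next
    case (adj k)
    then show ?case using hs_absorb_left[of k m] by (simp add: R_P scal_one \<eta>_hom)
  next
    case (comp \<sigma> \<rho>)
    from comp(3,4) have "P m (\<sigma> \<circ> \<rho>) * hs m = P m \<rho> * (P m \<sigma> * hs m)" by (simp only: P_mult mult.assoc[symmetric])
    then show ?case by (simp only: comp)
  qed
  have "?A * hs m = (\<Sum>\<pi> | \<pi> permutes {1..m}. hs m)" unfolding sum_distrib_right by (intro sum.cong refl) (simp add: 2)
  then have A: "?A = of_nat (fact m) * hs m" unfolding 1 by (simp add: card_permutations)
  have nat: "(of_nat n :: (nat \<times> nat, complex) falg quotients endo) = of_nat n \<cdot> 1" for n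
    by (induction n) (simp_all add: scal_zero scal_add scal_one \<eta>_hom distrib_right)
  have "?A = (fact m :: complex) \<cdot> hs m"
    unfolding A nat[of "fact m"] of_nat_fact by (simp only: mult.assoc mult_1_left)
  then have "(1 / fact m) \<cdot> ?A = \<eta> (scal (1 / fact m * fact m)) * hs m"
    by (simp only: scal_mult \<eta>_hom mult.assoc)
  also have "1 / fact m * fact m = (1 :: complex)" by simp
  finally show ?thesis by (simp only: scal_one \<eta>_hom mult_1_left)
qed

definition W_rep :: "nat \<Rightarrow> (nat \<times> nat, complex) falg" where
  "W_rep m = scal (1 / fact m) * (\<Sum>\<pi> | \<pi> permutes {1..m}. w_rep N m \<pi>)"

lemma W_classof: "W N m = classof (W_rep m)"
  by (simp add: W_def W_rep_def classof_def)

lemma W_rep_carrier: "W_rep m \<in> carrier (free_alg (gl_gens N))"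
  unfolding W_rep_def by (intro free_alg_closed) (auto intro: w_rep_carrier)

lemma \<eta>_W: "\<eta> (W_rep m) = C.\<Omega> m"
proof -
  have "C.\<Omega> m = (1 / fact m) \<cdot> (\<Sum>\<pi> | \<pi> permutes {1..m}. C.tr m (P m \<pi> * \<Phi> m (G m)))"
    unfolding C.\<Omega>_def hs_eq_average asc_E mult.assoc sum_distrib_right C.tr_\<eta> C.tr_sum ..
  also have "\<dots> = (1 / fact m) \<cdot> (\<Sum>\<pi> | \<pi> permutes {1..m}. \<eta> (w_rep N m \<pi>))"
    by (intro arg_cong2[of _ _ _ _ "(*)"] refl sum.cong tr_shift) (simp_all add: P_u)
  finally show ?thesis by (simp only: W_rep_def \<eta>_hom \<eta>_sum)
qed

end

section \<open>Comparison of the two systems of Newton identities\<close>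

text \<open>The identities \<open>newton\<close>, \<open>\<theta>_expansion\<close> and
  \<open>S_expansion\<close> after evaluation: \<open>p\<close> holds the moments, \<open>s\<close>
  the traces S and \<open>\<omega>\<close> the averages. Only polynomials occur, so a quantum and a
  classical solution can be compared.\<close>

definition newton_system :: "'k::field \<Rightarrow> (nat \<Rightarrow> 'k) \<Rightarrow> 'k \<Rightarrow> (nat \<Rightarrow> 'k mpol) \<Rightarrow> (nat \<Rightarrow> 'k mpol) \<Rightarrow> (nat \<Rightarrow> 'k mpol) \<Rightarrow> bool" where
  "newton_system t a \<delta> p s \<omega> \<longleftrightarrow> s 0 = 1 \<and>
     (\<forall>m. scal (qn t m) * s m = (\<Sum>n<m. scal (inverse t ^ (m - 1 - n) * inverse t ^ (2 * n)) *
        (s n * (\<Sum>k\<le>m - n. scal (coeff (\<Prod>b\<leftarrow>map a [n..<n + (m - n)]. [:b, 1:]) k) * p k)))) \<and>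
     (\<forall>m. s m = (\<Sum>k\<le>m. scal (coeff (\<Prod>b\<leftarrow>map a [0..<m]. [:b, 1:]) k *
        (\<Prod>j\<in>{k..<m}. (inverse t ^ (2 * j) * \<delta> + inverse t * qn t j) / qn t (Suc j))) * \<omega> k))"

lemma coeff_linear_mult: "coeff ([:b, 1:] * P) k = b * coeff P k + (case k of 0 \<Rightarrow> 0 | Suc l \<Rightarrow> coeff P l)"
  for b :: "'a::comm_ring_1"
  by (cases k) (simp_all add: coeff_pCons)

lemma coeff_prod_linear_top: "coeff (\<Prod>b\<leftarrow>bs. [:b, 1:]) (length bs) = (1 :: 'a::comm_ring_1)"
proof (induction bs)
  case (Cons b bs)
  have "coeff (\<Prod>b\<leftarrow>bs. [:b, 1:]) (Suc (length bs)) = 0"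
    using degree_prod_linear_le[of bs] by (intro coeff_eq_0) simp
  with Cons show ?case by (simp only: list.map prod_list.Cons coeff_linear_mult list.size) simp
qed simp

section \<open>Characters of the center\<close>

locale character = presentation X rel
  for X :: "'x set" and rel :: "('x, 'k::field) falg set" +
  fixes F :: "('x, 'k) falg set \<Rightarrow> 'k mpol"
  assumes F_add: "central p \<Longrightarrow> central p' \<Longrightarrow> F (classof (p + p')) = F (classof p) + F (classof p')"
    and F_mult: "central p \<Longrightarrow> central p' \<Longrightarrow> F (classof (p * p')) = F (classof p) * F (classof p')"
    and F_scal: "F (classof (scal c)) = scal c"
begin

text \<open>A relation, because an operator need not come from a word: it asserts at once that there
  is a central representative and that \<open>F\<close> has this value on it. Centrality of the
  averages is thus obtained along the recursion.\<close>

definition evaluates_to :: "('x, 'k) falg quotients endo \<Rightarrow> 'k mpol \<Rightarrow> bool" where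
  "evaluates_to x y \<longleftrightarrow> (\<exists>p. central p \<and> \<eta> p = x \<and> F (classof p) = y)"

lemma evaluates_to_unique: "evaluates_to x y \<Longrightarrow> evaluates_to x y' \<Longrightarrow> y = y'"
  unfolding evaluates_to_def by (metis central_def \<eta>_eq_classof)

lemma evaluates_to_add: "evaluates_to x y \<Longrightarrow> evaluates_to x' y' \<Longrightarrow> evaluates_to (x + x') (y + y')"
  and evaluates_to_mult: "evaluates_to x y \<Longrightarrow> evaluates_to x' y' \<Longrightarrow> evaluates_to (x * x') (y * y')"
  unfolding evaluates_to_def using F_add F_mult central_closed(1,2) \<eta>_hom(1,2) by metis+

lemma evaluates_to_scal: "evaluates_to (\<eta> (scal c)) (scal c)"
  unfolding evaluates_to_def using F_scal central_closed(3) by blast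

lemma evaluates_to_sc: "evaluates_to x y \<Longrightarrow> evaluates_to (\<eta> (scal c) * x) (scal c * y)"
  by (intro evaluates_to_mult evaluates_to_scal)

lemma evaluates_to_0: "evaluates_to 0 0" and evaluates_to_1: "evaluates_to 1 1"
  using evaluates_to_scal[of 0] evaluates_to_scal[of 1] by (simp_all add: scal_zero scal_one \<eta>_hom)

lemma evaluates_to_sum: "(\<And>i. i \<in> A \<Longrightarrow> evaluates_to (f i) (h i)) \<Longrightarrow> evaluates_to (\<Sum>i\<in>A. f i) (\<Sum>i\<in>A. h i)"
  by (induction A rule: infinite_finite_induct) (simp_all add: evaluates_to_0 evaluates_to_add)

end

locale evaluation = tensor_tower N rel t X a + character "gl_gens N" rel F
  for N and rel :: "(nat \<times> nat, 'k::field) falg set" and t :: 'k and X a F +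
  fixes mom :: "nat \<Rightarrow> 'k mpol"
  assumes evaluates_to_mom: "evaluates_to (\<tau> 0 (X 0 ^ k)) (mom k)"
begin

text \<open>The Newton identities yield S_m from lower terms after division by [m], and the
  unitriangular expansion then yields \<Omega>_m; both steps preserve
  \<open>evaluates_to\<close>.\<close>

lemma evaluates_to_\<Omega>: "\<exists>s \<omega>. newton_system t a \<delta> mom s \<omega> \<and> (\<forall>m. evaluates_to (\<Omega> m) (\<omega> m))"
proof -
  \<comment> \<open>The values are chosen before their existence is known; the inductions for
    \<open>hS\<close> and \<open>h\<Omega>\<close> supply it.\<close>
  define s where "s = (\<lambda>m. SOME y. evaluates_to (S m) y)"
  define \<omega> where "\<omega> = (\<lambda>m. SOME y. evaluates_to (\<Omega> m) y)"
  define c where "c = (\<lambda>m k. coeff (\<Prod>b\<leftarrow>map a [0..<m]. [:b, 1:]) k * cf m k)"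
  define \<theta>v where "\<theta>v = (\<lambda>n j. \<Sum>k\<le>j. scal (coeff (\<Prod>b\<leftarrow>map a [n..<n + j]. [:b, 1:]) k) * mom k)"
  have \<theta>: "evaluates_to (\<theta> n j) (\<theta>v n j)" for n j
    unfolding \<theta>_expansion \<theta>v_def by (intro evaluates_to_sum evaluates_to_sc evaluates_to_mom)
  let ?rhs = "\<lambda>m. \<Sum>n<m. scal (inverse t ^ (m - 1 - n) * inverse t ^ (2 * n)) * (s n * \<theta>v n (m - n))"
  have rhs: "evaluates_to (\<eta> (scal (qn t m)) * S m) (?rhs m)" if "\<And>n. n < m \<Longrightarrow> evaluates_to (S n) (s n)" for m
    unfolding newton using that by (intro evaluates_to_sum evaluates_to_sc evaluates_to_mult \<theta>) simp
  have S0: "S 0 = 1" by (simp add: S_def)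
  have hS: "evaluates_to (S m) (s m)" for m
  proof (induction m rule: less_induct)
    case (less m)
    have "\<exists>y. evaluates_to (S m) y"
    proof (cases m)
      case 0
      then show ?thesis using S0 evaluates_to_1 by auto
    next
      case (Suc n)
      have "\<eta> (scal (inverse (qn t m))) * (\<eta> (scal (qn t m)) * S m) = \<eta> (scal (inverse (qn t m) * qn t m)) * S m"
        by (simp only: scal_mult \<eta>_hom mult.assoc)
      also have "inverse (qn t m) * qn t m = 1" using qn_t_nz[of n] Suc by simp
      finally have eq: "\<eta> (scal (inverse (qn t m))) * (\<eta> (scal (qn t m)) * S m) = S m" by (simp only: scal_one \<eta>_hom mult_1_left)
      have "evaluates_to (\<eta> (scal (inverse (qn t m))) * (\<eta> (scal (qn t m)) * S m)) (scal (inverse (qn t m)) * ?rhs m)"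
        by (intro evaluates_to_sc rhs less)
      then show ?thesis unfolding eq by (rule exI)
    qed
    then show ?case unfolding s_def by (rule someI_ex)
  qed
  have c1: "c m m = 1" for m
    using coeff_prod_linear_top[of "map a [0..<m]"] by (simp add: c_def cf_def)
  have S_c: "S m = (\<Sum>k\<le>m. \<eta> (scal (c m k)) * \<Omega> k)" for m
    unfolding c_def by (rule S_expansion)
  have h\<Omega>: "evaluates_to (\<Omega> m) (\<omega> m)" for m
  proof (induction m rule: less_induct)
    case (less m)
    have "S m = (\<Sum>k<m. \<eta> (scal (c m k)) * \<Omega> k) + \<Omega> m"
      unfolding S_c[of m] lessThan_Suc_atMost[symmetric] sum.lessThan_Suc c1 scal_one \<eta>_hom mult_1_left ..
    moreover have "(\<Sum>k<m. \<eta> (scal (- c m k)) * \<Omega> k) = - (\<Sum>k<m. \<eta> (scal (c m k)) * \<Omega> k)"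
      unfolding scal.c_minus \<eta>_minus minus_mult_left[symmetric] sum_negf ..
    ultimately have "\<Omega> m = S m + (\<Sum>k<m. \<eta> (scal (- c m k)) * \<Omega> k)" by simp
    moreover have "evaluates_to (S m + (\<Sum>k<m. \<eta> (scal (- c m k)) * \<Omega> k)) (s m + (\<Sum>k<m. scal (- c m k) * \<omega> k))"
      using less by (intro evaluates_to_add hS evaluates_to_sum evaluates_to_sc) simp
    ultimately have "\<exists>y. evaluates_to (\<Omega> m) y" by metis
    then show ?case unfolding \<omega>_def by (rule someI_ex)
  qed
  have "s 0 = 1" using evaluates_to_unique[OF hS[of 0, unfolded S0] evaluates_to_1] .
  moreover have "scal (qn t m) * s m = ?rhs m" for m
    using evaluates_to_unique[OF evaluates_to_sc[OF hS] rhs[OF hS]] .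
  moreover have "s m = (\<Sum>k\<le>m. scal (c m k) * \<omega> k)" for m
    by (rule evaluates_to_unique[OF hS, unfolded S_c]) (intro evaluates_to_sum evaluates_to_sc h\<Omega>)
  ultimately have "newton_system t a \<delta> mom s \<omega>"
    unfolding newton_system_def by (simp only: c_def cf_def \<theta>v_def simp_thms)
  with h\<Omega> show ?thesis by blast
qed

end

lemma tendsto_q1_coeff_prod:
  assumes "\<And>j. tendsto_q1 (a j) (a' j)"
  shows "tendsto_q1 (coeff (\<Prod>b\<leftarrow>map a js. [:b, 1:]) k) (coeff (\<Prod>b\<leftarrow>map a' js. [:b, 1:]) k)"
proof (induction js arbitrary: k)
  case Nil
  then show ?case by (cases k) simp_all
next
  case (Cons j js)
  have "tendsto_q1 (case k of 0 \<Rightarrow> 0 | Suc l \<Rightarrow> coeff (\<Prod>b\<leftarrow>map a js. [:b, 1:]) l) (case k of 0 \<Rightarrow> 0 | Suc l \<Rightarrow> coeff (\<Prod>b\<leftarrow>map a' js. [:b, 1:]) l)"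
    using Cons by (cases k) auto
  then show ?case using Cons assms
    by (simp only: list.map prod_list.Cons coeff_linear_mult) (intro tendsto_q1_add tendsto_q1_mult)
qed

text \<open>The two systems are solved side by side. The only divisions are by quantum integers with
  nonzero limits, so convergence passes from the moments to \<open>s\<close> and from there to
  \<open>\<omega>\<close>.\<close>

lemma newton_system_limit:
  assumes sys: "newton_system q a \<delta> p s \<omega>" "newton_system 1 a' \<delta>' p' s' \<omega>'"
    and lims: "\<And>j. tendsto_q1 (a j) (a' j)" "tendsto_q1 \<delta> \<delta>'" "\<And>k. clim (p k) (p' k)"
  shows "clim (\<omega> m) (\<omega>' m)"
proof -
  have one: "inverse (1 :: complex) ^ n = 1" for n by simp
  have qn: "tendsto_q1 (qn q n) (qn 1 n)" for n
    using tendsto_q1_qn by (simp add: qn_1)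
  have iq: "tendsto_q1 (inverse q ^ n) (inverse 1 ^ n)" for n
    unfolding one by (rule tendsto_q1_inverse_q_power)
  have iq1: "tendsto_q1 (inverse q) (inverse 1)" by simp
  have qnS: "tendsto_q1 (inverse (qn q (Suc n))) (inverse (qn 1 (Suc n)))" for n
    by (rule tendsto_q1_inverse[OF qn]) (simp add: qn_1 del: of_nat_Suc)
  note coeff = tendsto_q1_coeff_prod[OF lims(1)]
  have cf: "tendsto_q1 (\<Prod>j\<in>{k..<m}. (inverse q ^ (2 * j) * \<delta> + inverse q * qn q j) / qn q (Suc j))
      (\<Prod>j\<in>{k..<m}. (inverse 1 ^ (2 * j) * \<delta>' + inverse 1 * qn 1 j) / qn 1 (Suc j))" for m k
    unfolding divide_inverse
    by (intro tendsto_q1_prod tendsto_q1_mult tendsto_q1_add iq iq1 qn qnS lims(2))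
  have s: "clim (s m) (s' m)" for m
  proof (induction m rule: less_induct)
    case (less m)
    show ?case
    proof (cases m)
      case 0
      have "s 0 = 1" "s' 0 = 1" using sys unfolding newton_system_def by blast+
      then show ?thesis using 0 by simp
    next
      case (Suc n)
      let ?r = "\<lambda>t a p s. \<Sum>n<m. scal (inverse t ^ (m - 1 - n) * inverse t ^ (2 * n)) *
        (s n * (\<Sum>k\<le>m - n. scal (coeff (\<Prod>b\<leftarrow>map a [n..<n + (m - n)]. [:b, 1:]) k) * p k))"
      have r: "clim (?r q a p s) (?r 1 a' p' s')"
        by (intro clim_sum clim_mult clim_scal tendsto_q1_mult iq coeff lims(3) less) simp
      have "scal (qn q m) * s m = ?r q a p s" "scal (qn 1 m) * s' m = ?r 1 a' p' s'"
        using sys unfolding newton_system_def by blast+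
      moreover have "scal (inverse (qn q m)) * (scal (qn q m) * s m) = s m"
      proof -
        have "scal (inverse (qn q m)) * (scal (qn q m) * s m) = scal (inverse (qn q m) * qn q m) * s m"
          by (simp only: scal_mult mult.assoc)
        also have "inverse (qn q m) * qn q m = 1" using qn_q_nz[of n] Suc by simp
        finally show ?thesis by (simp only: scal_one mult_1_left)
      qed
      moreover have "scal (inverse (qn 1 m)) * (scal (qn 1 m) * s' m) = s' m"
      proof -
        have "scal (inverse (qn 1 m)) * (scal (qn 1 m) * s' m) = scal (inverse (qn 1 m) * qn 1 m) * s' m"
          by (simp only: scal_mult mult.assoc)
        also have "inverse (qn 1 m) * qn 1 m = (1 :: complex)" using Suc by (simp add: qn_1 del: of_nat_Suc)
        finally show ?thesis by (simp only: scal_one mult_1_left)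
      qed
      moreover have "clim (scal (inverse (qn q m)) * ?r q a p s) (scal (inverse (qn 1 m)) * ?r 1 a' p' s')"
        unfolding Suc by (intro clim_mult clim_scal qnS r[unfolded Suc])
      ultimately show ?thesis by simp
    qed
  qed
  show ?thesis
  proof (induction m rule: less_induct)
    case (less m)
    let ?c = "\<lambda>t d a k. coeff (\<Prod>b\<leftarrow>map a [0..<m]. [:b, 1:]) k *
        (\<Prod>j\<in>{k..<m}. (inverse t ^ (2 * j) * d + inverse t * qn t j) / qn t (Suc j))"
    have c1: "?c q \<delta> a m = 1" "?c 1 \<delta>' a' m = 1"
      using coeff_prod_linear_top[of "map a [0..<m]"] coeff_prod_linear_top[of "map a' [0..<m]"] by simp_all
    have "s m = (\<Sum>k<m. scal (?c q \<delta> a k) * \<omega> k) + \<omega> m"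
    proof -
      have "s m = (\<Sum>k\<le>m. scal (?c q \<delta> a k) * \<omega> k)" using sys(1) unfolding newton_system_def by blast
      then show ?thesis unfolding lessThan_Suc_atMost[symmetric] sum.lessThan_Suc c1 scal_one mult_1_left .
    qed
    moreover have "s' m = (\<Sum>k<m. scal (?c 1 \<delta>' a' k) * \<omega>' k) + \<omega>' m"
    proof -
      have "s' m = (\<Sum>k\<le>m. scal (?c 1 \<delta>' a' k) * \<omega>' k)" using sys(2) unfolding newton_system_def by blast
      then show ?thesis unfolding lessThan_Suc_atMost[symmetric] sum.lessThan_Suc c1 scal_one mult_1_left .
    qed
    moreover have "clim (s m - (\<Sum>k<m. scal (?c q \<delta> a k) * \<omega> k)) (s' m - (\<Sum>k<m. scal (?c 1 \<delta>' a' k) * \<omega>' k))"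
      by (intro clim_diff s clim_sum clim_mult clim_scal tendsto_q1_mult coeff cf less) simp
    ultimately show ?case by simp
  qed
qed

section \<open>Moments of L and the change of coordinates\<close>

lemma one_minus_power: "(1 - x) ^ k = (\<Sum>i\<le>k. of_nat (k choose i) * ((- 1) ^ i * x ^ i))"
  for x :: "'a::ring_1"
proof (induction k)
  case (Suc k)
  let ?f = "\<lambda>i. (- 1) ^ i * x ^ i"
  have x: "x * (of_nat n * ?f i) = - (of_nat n * ?f (Suc i))" for n i
  proof -
    have "x * of_nat n = of_nat n * x" by (rule mult_of_nat_commute[symmetric])
    moreover have "x * (- 1) ^ i = (- 1) ^ i * x" by (cases "even i") simp_all
    ultimately show ?thesis by (simp add: mult.assoc[symmetric]) (simp add: mult.assoc)
  qed
  have "(\<Sum>i\<le>Suc k. of_nat (Suc k choose i) * ?f i) =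
      ?f 0 + (\<Sum>i\<le>k. of_nat (k choose Suc i) * ?f (Suc i)) + (\<Sum>i\<le>k. of_nat (k choose i) * ?f (Suc i))"
    by (simp only: sum.atMost_Suc_shift binomial_Suc_Suc of_nat_add distrib_right sum.distrib binomial_n_0 of_nat_1 mult_1_left add_ac)
  also have "?f 0 + (\<Sum>i\<le>k. of_nat (k choose Suc i) * ?f (Suc i)) = (\<Sum>i\<le>Suc k. of_nat (k choose i) * ?f i)"
    unfolding sum.atMost_Suc_shift[of _ k] by simp
  also have "\<dots> = (\<Sum>i\<le>k. of_nat (k choose i) * ?f i)" by (simp add: binomial_eq_0)
  also have "(\<Sum>i\<le>k. of_nat (k choose i) * ?f (Suc i)) = - (x * (\<Sum>i\<le>k. of_nat (k choose i) * ?f i))"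
    unfolding sum_distrib_left x sum_negf by simp
  finally show ?case unfolding power_Suc Suc by (simp add: left_diff_distrib)
qed simp

text \<open>The value is independent of the representative, so it can be read off at the word given
  by a definition, about which only its operator is known.\<close>

lemma (in character) evaluates_to_rep: "evaluates_to (\<eta> p) y \<Longrightarrow> p \<in> carrier (free_alg X) \<Longrightarrow> F (classof p) = y"
  unfolding evaluates_to_def using \<eta>_eq_classof by (metis central_def)

lemma (in central_hom) c_of_nat: "c (of_nat n) = of_nat n"
  and c_power: "c (x ^ n) = c x ^ n"
  by (induction n) (simp_all add: c_zero c_one c_add c_mult)

context quantum
begin

interpretation cs: central_hom "\<lambda>b. \<eta> (scal b)"
  by unfold_locales (simp only: scal_add \<eta>_hom(1), simp only: scal_mult \<eta>_hom(2), simp only: scal_one \<eta>_hom(3), rule \<eta>_central)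

lemma \<kappa>_\<delta>: "\<kappa> * \<delta> = 1 - inverse q ^ (2 * N)"
proof -
  have "{0<..N} = {1..N}" by auto
  then have "\<kappa> * \<delta> = q * d N - q * d 0" using d_sum[of 0 N] by (simp only: \<delta>_def)
  also have "q * d 0 = inverse q ^ (2 * N)" using q_nz by (simp add: d_def)
  finally show ?thesis unfolding d_N .
qed

text \<open>The quantum dimension is q^(-1) [N].\<close>

lemma tendsto_\<delta>: "tendsto_q1 \<delta> (of_nat N)"
proof -
  have "\<kappa> * (inverse q * qn q N) = (1 - inverse q ^ 2) * qn q N"
    using q_nz by (simp add: left_diff_distrib power2_eq_square flip: mult.assoc)
  also have "\<dots> = \<kappa> * \<delta>" unfolding \<kappa>_\<delta> qn_geometric ..
  finally have "\<delta> = inverse q * qn q N" using q_diff_nz by (simp only: mult_cancel_left simp_thms)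
  moreover have "tendsto_q1 (inverse q * qn q N) (1 * of_nat N)"
    by (intro tendsto_q1_mult tendsto_q1_inverse_q tendsto_q1_qn)
  ultimately show ?thesis by (simp only: mult_1_left)
qed

lemma tendsto_shift: "tendsto_q1 (shift j) (of_nat j)"
proof -
  have "(q ^ 2 - 1) * (\<Sum>i<j. (q ^ 2) ^ i) = (q ^ 2) ^ j - 1"
    by (induction j) (simp_all add: algebra_simps)
  moreover have "q ^ 2 - 1 = \<kappa> * q" using q_nz by (simp add: left_diff_distrib power2_eq_square)
  ultimately have "q ^ (2 * j) - 1 = \<kappa> * (q * (\<Sum>i<j. (q ^ 2) ^ i))" by (simp only: power_mult mult.assoc)
  then have "shift j = q * (\<Sum>i<j. (q ^ 2) ^ i)"
    unfolding shift_def by (simp only: nonzero_mult_div_cancel_left[OF q_diff_nz])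
  moreover have "tendsto_q1 (q * (\<Sum>i<j. (q ^ 2) ^ i)) (1 * (\<Sum>i<j. (1 ^ 2) ^ i))"
    by (intro tendsto_q1_mult tendsto_q1_sum tendsto_q1_power tendsto_q1_q)
  ultimately show ?thesis by simp
qed

lemma \<tau>_Lel_power:
  "\<tau> 0 (Lel ^ k) = inverse \<kappa> ^ k \<cdot> (\<Sum>i\<le>k. (of_nat (k choose i) * (- 1) ^ i) \<cdot> \<tau> 0 (Mel ^ i))"
proof -
  have m1: "\<eta> (scal (- 1)) = - 1" using cs.c_minus[of 1] unfolding cs.c_one .
  have "Lel ^ k = inverse \<kappa> ^ k \<cdot> (1 - Mel) ^ k"
  proof (induction k)
    case (Suc k)
    have L: "Lel = inverse \<kappa> \<cdot> (1 - Mel)" by (simp only: Lel_eq inverse_eq_divide)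
    have "Lel ^ Suc k = Lel * (inverse \<kappa> ^ k \<cdot> (1 - Mel) ^ k)" by (simp only: power_Suc Suc)
    also have "\<dots> = inverse \<kappa> \<cdot> ((1 - Mel) * (inverse \<kappa> ^ k \<cdot> (1 - Mel) ^ k))"
      by (subst L) (simp only: mult.assoc)
    also have "(1 - Mel) * (inverse \<kappa> ^ k \<cdot> (1 - Mel) ^ k) = inverse \<kappa> ^ k \<cdot> (1 - Mel) ^ Suc k"
      by (simp only: power_Suc \<eta>_central[of _ "1 - Mel"] mult.assoc[symmetric])
    finally show ?case by (simp only: cs.c_mult power_Suc[of "inverse \<kappa>"] mult.assoc)
  qed (simp add: scal_one \<eta>_hom)
  also have "\<dots> = inverse \<kappa> ^ k \<cdot> (\<Sum>i\<le>k. (of_nat (k choose i) * (- 1) ^ i) \<cdot> Mel ^ i)"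
    unfolding one_minus_power cs.c_mult cs.c_of_nat cs.c_power m1 by (simp only: mult.assoc)
  finally show ?thesis by (simp only: M.\<tau>_sc M.\<tau>_sum)
qed

end

lemma psubst_diff: "psubst \<sigma> (p - p') = psubst \<sigma> p - psubst \<sigma> p'"
  using psubst_add[of \<sigma> "p - p'" p'] by (simp add: eq_diff_eq)

lemma psubst_0: "psubst \<sigma> 0 = 0"
  using psubst_add[of \<sigma> 0 0] by simp

lemma psubst_sum: "psubst \<sigma> (\<Sum>i\<in>A. f i) = (\<Sum>i\<in>A. psubst \<sigma> (f i))"
  by (induction A rule: infinite_finite_induct) (simp_all add: psubst_0 psubst_add)

definition psubst_fps :: "(nat \<Rightarrow> 'k mpol) \<Rightarrow> 'k mpol fps \<Rightarrow> 'k::comm_ring_1 mpol fps" where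
  "psubst_fps \<sigma> f = Abs_fps (\<lambda>n. psubst \<sigma> (f $ n))"

lemma psubst_fps_hom:
  "psubst_fps \<sigma> (f + h) = psubst_fps \<sigma> f + psubst_fps \<sigma> h"
  "psubst_fps \<sigma> (f - h) = psubst_fps \<sigma> f - psubst_fps \<sigma> h"
  "psubst_fps \<sigma> (f * h) = psubst_fps \<sigma> f * psubst_fps \<sigma> h"
  "psubst_fps \<sigma> 1 = 1" "psubst_fps \<sigma> (fps_const c) = fps_const (psubst \<sigma> c)" "psubst_fps \<sigma> fps_X = fps_X"
  "psubst_fps \<sigma> (Abs_fps p) = Abs_fps (\<lambda>n. psubst \<sigma> (p n))"
  by (rule fps_ext, simp add: psubst_fps_def psubst_add psubst_diff psubst_sum psubst_mult psubst_one psubst_0 fps_mult_nth fps_X_def)+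

lemma psubst_fps_prod: "psubst_fps \<sigma> (\<Prod>i\<in>A. f i) = (\<Prod>i\<in>A. psubst_fps \<sigma> (f i))"
  by (induction A rule: infinite_finite_induct) (simp_all add: psubst_fps_hom)

section \<open>The Harish-Chandra isomorphisms as characters\<close>

lemma classical_character:
  assumes "N \<ge> 1" "classical_HC N \<phi>"
  shows "character (gl_gens N) (gl_rels N) \<phi>"
proof -
  interpret presentation "gl_gens N" "gl_rels N" by (rule presentation_gl)
  have h: "\<phi> \<in> ring_hom (center_ring (pres_alg (gl_gens N) (gl_rels N))) (sym_ring N)"
    using assms(2) by (simp add: classical_HC_def ring_iso_def U_gl_def)
  show ?thesis
    by unfold_locales (use assms(2) center_hom[OF h] in \<open>auto simp: classical_HC_def classof_def\<close>)
qed

lemma quantum_character: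
  assumes "N \<ge> 1" "quantum_HC N \<psi>"
  shows "character (gl_gens N) (re_rels N) (\<lambda>x. x_coords N (\<psi> x))"
proof -
  interpret presentation "gl_gens N" "re_rels N" by (rule presentation_re)
  have h: "\<psi> \<in> ring_hom (center_ring (pres_alg (gl_gens N) (re_rels N))) (sym_ring N)"
    using assms(2) by (simp add: quantum_HC_def ring_iso_def RE_alg_def)
  show ?thesis
    by unfold_locales (use assms(2) center_hom[OF h] in \<open>auto simp: quantum_HC_def classof_def x_coords_def psubst_hom\<close>)
qed

lemma psum_generating_function:
  assumes "quantum_HC N \<psi>"
  shows "(1 + fps_const (scal (q - inverse q)) * Abs_fps (\<lambda>n. if n \<ge> 1 then x_coords N (\<psi> (psum N n)) else 0)) *
       (\<Prod>i\<in>{1..N}. 1 - fps_const (scal (q powi (1 - int N)) - scal \<epsilon> * Var i) * fps_X) =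
      (\<Prod>i\<in>{1..N}. 1 - fps_const (scal (q powi (-2)) * (scal (q powi (1 - int N)) - scal \<epsilon> * Var i)) * fps_X)"
proof -
  let ?\<sigma> = "\<lambda>i. scal (q powi (1 - int N)) - scal \<epsilon> * Var i :: Cq mpol"
  have "(1 + fps_const (scal (q - inverse q)) * Abs_fps (\<lambda>n. if n \<ge> 1 then \<psi> (psum N n) else 0)) *
       (\<Prod>i\<in>{1..N}. 1 - fps_const (Var i) * fps_X) = (\<Prod>i\<in>{1..N}. 1 - fps_const (scal (q powi (-2)) * Var i) * fps_X)"
    using assms unfolding quantum_HC_def by blast
  from arg_cong[OF this, of "psubst_fps ?\<sigma>"]
  show ?thesis
    unfolding psubst_fps_hom psubst_fps_prod psubst_hom psubst_Var psubst_scal if_distrib[of "psubst ?\<sigma>"] psubst_0 x_coords_def .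
qed

theorem theorem21:
  fixes N m :: nat
    and \<phi> :: "(nat \<times> nat, complex) falg set \<Rightarrow> complex mpol"
    and \<psi> :: "(nat \<times> nat, Cq) falg set \<Rightarrow> Cq mpol"
  assumes "N \<ge> 1" and "m \<ge> 1"
    and "classical_HC N \<phi>" and "quantum_HC N \<psi>"
  shows "\<forall>\<mu>. tendsto_q1 (Poly_Mapping.lookup (x_coords N (\<psi> (Omega N m))) \<mu>)
                        (Poly_Mapping.lookup (\<phi> (W N m)) \<mu>)"
proof -
  interpret Q: quantum N by unfold_locales (rule assms(1))
  interpret K: classical N by unfold_locales (rule assms(1))
  define F where "F = (\<lambda>x. x_coords N (\<psi> x))"
  interpret QF: character "gl_gens N" "re_rels N" F
    unfolding F_def by (rule quantum_character[OF assms(1,4)])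
  interpret KF: character "gl_gens N" "gl_rels N" \<phi> by (rule classical_character[OF assms(1,3)])
  \<comment> \<open>The zeroth moment is the partial trace of 1; \<open>psum\<close> supplies the
    moments from 1 on.\<close>
  define p where "p = (\<lambda>k. if k = 0 then scal Q.\<delta> else F (psum N k))"
  \<comment> \<open>The moments of (1 - M) / (q - 1/q), by the binomial formula.\<close>
  define pq where "pq = (\<lambda>k. scal (inverse Q.\<kappa> ^ k) * (\<Sum>i\<le>k. scal (of_nat (k choose i) * (- 1) ^ i) * p i))"
  define pc where "pc = (\<lambda>k. if k = 0 then of_nat N else \<phi> (casimir N k))"
  have p: "QF.evaluates_to (Q.\<tau> 0 (Q.Mel ^ k)) (p k)" for k
  proof (cases "k = 0")
    case True
    then show ?thesis using QF.evaluates_to_scal[of Q.\<delta>] by (simp only: p_def power_0 Q.M.\<tau>_one mult_1_right simp_thms if_True)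
  next
    case False
    then show ?thesis using Q.central_psum[of k] Q.\<eta>_psum[of k] Q.psum_classof[of k]
      unfolding QF.evaluates_to_def p_def by auto
  qed
  interpret QE: evaluation N "re_rels N" q "Q.Xs Q.Lel" Q.shift F pq
  proof (intro evaluation.intro Q.L.tensor_tower_axioms QF.character_axioms evaluation_axioms.intro)
    show "QF.evaluates_to (Q.\<tau> 0 (Q.Xs Q.Lel 0 ^ k)) (pq k)" for k
      unfolding Q.Xs.simps Q.\<tau>_Lel_power pq_def by (intro QF.evaluates_to_sc QF.evaluates_to_sum p)
  qed
  interpret KE: evaluation N "gl_rels N" 1 "K.Xs (K.E 0)" of_nat \<phi> pc
  proof (intro evaluation.intro K.C.tensor_tower_axioms KF.character_axioms evaluation_axioms.intro)
    fix k
    show "KF.evaluates_to (K.\<tau> 0 (K.Xs (K.E 0) 0 ^ k)) (pc k)"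
    proof (cases "k = 0")
      case True
      have "K.\<delta> = of_nat N" by (simp add: K.\<delta>_def K.d_1)
      then show ?thesis using True KF.evaluates_to_scal[of "of_nat N"]
        by (simp only: pc_def power_0 K.C.\<tau>_one mult_1_right simp_thms if_True scal.c_of_nat)
    next
      case False
      then show ?thesis using K.central_cas[of k] K.\<eta>_cas[of k] K.casimir_classof[of k]
        unfolding KF.evaluates_to_def pc_def by auto
    qed
  qed
  obtain s \<omega> where q: "newton_system q Q.shift Q.\<delta> pq s \<omega>" "\<And>m. QF.evaluates_to (Q.L.\<Omega> m) (\<omega> m)"
    using QE.evaluates_to_\<Omega> by blast
  obtain s' \<omega>' where c: "newton_system 1 of_nat K.\<delta> pc s' \<omega>'" "\<And>m. KF.evaluates_to (K.C.\<Omega> m) (\<omega>' m)"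
    using KE.evaluates_to_\<Omega> by blast
  have mom: "clim (pq k) (pc k)" for k
  proof -
    let ?m = "scal (inverse \<epsilon>) ^ k * (\<Sum>i\<le>k. of_nat (k choose i) * (- 1) ^ i * p i)"
    \<comment> \<open>\<open>clim_moments\<close> is scaled by q^2 - 1 and L by q - 1/q, so the k-th
      moments differ by q^k, which tends to 1.\<close>
    have "inverse Q.\<kappa> = q * inverse \<epsilon>"
    proof -
      have "\<epsilon> = Q.\<kappa> * q" using q_nz by (simp add: left_diff_distrib power2_eq_square)
      then show ?thesis using q_nz q_diff_nz by (simp add: mult.assoc)
    qed
    then have eq: "pq k = scal (q ^ k) * ?m"
      unfolding pq_def by (simp only: power_mult_distrib scal.c_mult scal.c_power scal.c_of_nat scal.c_minus scal.c_one mult.assoc)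
    have "p 0 = scal ((1 - inverse q ^ (2 * N)) / Q.\<kappa>)"
      unfolding Q.\<kappa>_\<delta>[symmetric] p_def using q_diff_nz by simp
    moreover have "(\<lambda>n. if n \<ge> 1 then x_coords N (\<psi> (psum N n)) else 0) = (\<lambda>n. if n \<ge> 1 then p n else 0)"
      by (auto simp: p_def F_def)
    then have "(1 + fps_const (scal (q - inverse q)) * Abs_fps (\<lambda>n. if n \<ge> 1 then p n else 0)) *
       (\<Prod>i\<in>{1..N}. 1 - fps_const (scal (q powi (1 - int N)) - scal \<epsilon> * Var i) * fps_X) =
      (\<Prod>i\<in>{1..N}. 1 - fps_const (scal (q powi (-2)) * (scal (q powi (1 - int N)) - scal \<epsilon> * Var i)) * fps_X)"
      using psum_generating_function[OF assms(4)] by (simp only:)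
    moreover have "(1 - of_nat N * fps_X - Abs_fps (\<lambda>n. if n \<ge> 2 then \<phi> (casimir N (n - 1)) else 0)) *
       (\<Prod>i\<in>{1..N}. 1 - fps_const (Var i + scal ((of_nat N - 1) / 2)) * fps_X) =
      (\<Prod>i\<in>{1..N}. 1 - fps_const (Var i + scal ((of_nat N + 1) / 2)) * fps_X)"
      using assms(3) unfolding classical_HC_def by blast
    ultimately have "clim ?m (pc k)"
      unfolding pc_def by (intro clim_moments[OF assms(1), where C = "\<lambda>k. \<phi> (casimir N k)"])
    then have "clim (scal (q ^ k) * ?m) (scal (1 ^ k) * pc k)"
      by (intro clim_mult clim_scal tendsto_q1_power tendsto_q1_q)
    then show ?thesis unfolding eq power_one scal_one mult_1_left .
  qed
  have "K.\<delta> = of_nat N" by (simp add: K.\<delta>_def K.d_1)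
  then have "clim (\<omega> m) (\<omega>' m)"
    using newton_system_limit[OF q(1) c(1) Q.tendsto_shift _ mom] Q.tendsto_\<delta> by simp
  moreover have "\<omega> m = F (Omega N m)"
    unfolding Q.Omega_classof
    by (rule QF.evaluates_to_rep[symmetric, OF _ Q.Omega_rep_carrier]) (simp only: Q.\<eta>_Omega[OF assms(2)] q(2))
  moreover have "\<omega>' m = \<phi> (W N m)"
    unfolding K.W_classof
    by (rule KF.evaluates_to_rep[symmetric, OF _ K.W_rep_carrier]) (simp only: K.\<eta>_W c(2))
  ultimately show ?thesis by (simp add: clim_def F_def)
qed

end
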